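(* Let $X$ be a locally compact Hausdorff space and $\kappa$ a kernel on $X$ satisfying the energy, consistency, and domination principles. Suppose that both of the following hold: $(\mathcal A_1)$ the topology on $X$ has a countable base; $(\mathcal A_2)$ the set of all $f\in C_0(X)$ representable as potentials $f=\kappa\lambda$ with $\lambda\in\mathcal E$ is dense in $C_0(X)$ equipped with the inductive limit topology. Then for arbitrary $A\subset X$, there exists a $K_\sigma$-set $A_0\subset A$ such that \[\mu^A=\mu^{A_0}\quad\text{for all }\mu\in\mathcal E^+.\] Moreover, \[\mu^A=\mu^{A_0}=\mu^{*A_0}\quad\text{for all }\mu\in\mathcal E^+.\] Here $\mu^A$ and $\mu^{*A}$ denote the inner and the outer balayage of $\mu$ to $A$, respectively.
   Context: **Measures.** $X$ is a locally compact Hausdorff space. $C_0(X)$ is the space of continuous functions $f:X\to\mathbb R$ of compact support. Its inductive limit topology is the finest locally convex topology for which all inclusions $C_0(K;X)\to C_0(X)$, $K\subset X$ compact, are continuous, where $C_0(K;X)$ is the space of $f\in C_0(X)$ with support in $K$, with the topology of uniform convergence on $K$. $\mathfrak M$ is the linear space of (signed, real-valued) Radon measures on $X$, i.e. the dual of $C_0(X)$ with this topology (equivalently, differences of positive Radon measures, understood as functionals on $C_0(X)$). It carries the vague topology of pointwise convergence on $C_0(X)$. $\mathfrak M^+$ is the cone of positive measures; $\mu=\mu^+-\mu^-$ is the Hahn–Jordan decomposition. A $K_\sigma$-set is a countable union of compact subsets of $X$. **Kernels.** A kernel is a symmetric lower semicontinuous function $\kappa:X\times X\to[0,\infty]$.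 Put $\kappa\mu(x):=\int\kappa(x,y)\,d\mu(y)$ (potential) and $\kappa(\mu,\nu):=\int\kappa\,d(\mu\otimes\nu)$ (mutual energy; $\kappa(\mu,\mu)$ is the energy of $\mu$), whenever well defined as a finite number or $\pm\infty$. $\mathcal E$ is the set of $\mu\in\mathfrak M$ of finite energy, $\mathcal E^+:=\mathcal E\cap\mathfrak M^+$. - Energy principle: $\kappa(\mu,\mu)\geqslant0$ for all $\mu\in\mathfrak M$ for which the energy is defined, and $\kappa(\mu,\mu)=0$ implies $\mu=0$. Then $\mathcal E$ is a pre-Hilbert space with inner product $\kappa(\mu,\nu)$ and norm $\|\mu\|=\sqrt{\kappa(\mu,\mu)}$; the norm topology is called strong. - Consistency principle: every strong Cauchy net in $\mathcal E^+$ converges strongly to any of its vague limit (cluster) points. - Domination principle: if $\mu,\nu\in\mathcal E^+$ and $\kappa\mu\leqslant\kappa\nu$ $\mu$-a.e., then $\kappa\mu\leqslant\kappa\nu$ on all of $X$. **Capacity.** $\mathcal E^+_A$ is the set of $\mu\in\mathcal E^+$ concentrated on $A$, i.e. such that $X\setminus A$ is locally $\mu$-negligible ($(X\setminus A)\cap K$ is $\mu$-negligible for every compact $K$). Inner capacity: $c_*(A):=\bigl[\inf\{\kappa(\mu,\mu):\mu\in\mathcal E^+_A,\ \mu(X)=1\}\bigr]^{-1}$ ($\inf\varnothing=+\infty$). Outer capacity: $c^*(A):=\inf c_*(D)$ over open $D\supset A$. "N.e. on $A$" (resp. "q.e. on $A$") means: everywhere on $A$ except for a subset of $A$ of inner (resp.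 outer) capacity zero. **Balayage.** For $\mu\in\mathcal E^+$ and $A\subset X$, let $\Lambda_{A,\mu}$ be the set of $\nu\in\mathcal E^+$ with $\kappa\nu\geqslant\kappa\mu$ n.e. on $A$. The inner balayage $\mu^A$ is the unique measure in $\Lambda_{A,\mu}$ with $\kappa\mu^A=\min_{\nu\in\Lambda_{A,\mu}}\kappa\nu$ everywhere on $X$ (under the three principles it is known to exist and be unique). The outer balayage $\mu^{*A}$ is defined in the same way with "n.e." replaced by "q.e."; it is unique if it exists, and an equality involving it includes its existence. *)

theory Defs
  imports "HOL-Analysis.Analysis"
begin

section \<open>The space \<open>C\<^sub>0(X)\<close> and its inductive limit topology\<close>

typedef (overloaded) 'a ccfun =
  "{f :: 'a::topological_space \<Rightarrow> real. continuous_on UNIV f \<and> compact (closure {x. f x \<noteq> 0})}"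
  morphisms cc_apply Abs_ccfun
  by (rule exI[where x = "\<lambda>_. 0"]) auto

setup_lifting type_definition_ccfun

lemma compact_support_subset:
  assumes "compact (closure S)" "T \<subseteq> S"
  shows "compact (closure T)"
proof -
  have "closure T = closure S \<inter> closure T"
    using closure_mono[OF assms(2)] by blast
  then show ?thesis
    using compact_Int_closed[OF assms(1) closed_closure] by metis
qed

instantiation ccfun :: (topological_space) real_vector
begin

lift_definition zero_ccfun :: "'a ccfun" is "\<lambda>_. 0"
  by auto

lift_definition plus_ccfun :: "'a ccfun \<Rightarrow> 'a ccfun \<Rightarrow> 'a ccfun" is "\<lambda>f g x. f x + g x"
proof -
  fix f g :: "'a \<Rightarrow> real"
  assume f: "continuous_on UNIV f \<and> compact (closure {x. f x \<noteq> 0})"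
    and g: "continuous_on UNIV g \<and> compact (closure {x. g x \<noteq> 0})"
  have "compact (closure ({x. f x \<noteq> 0} \<union> {x. g x \<noteq> 0}))"
    using f g by (simp add: compact_Un)
  then have "compact (closure {x. f x + g x \<noteq> 0})"
    by (rule compact_support_subset) auto
  then show "continuous_on UNIV (\<lambda>x. f x + g x) \<and> compact (closure {x. f x + g x \<noteq> 0})"
    using f g by (auto intro: continuous_intros)
qed

lift_definition uminus_ccfun :: "'a ccfun \<Rightarrow> 'a ccfun" is "\<lambda>f x. - f x"
  by (auto intro: continuous_intros)

lift_definition minus_ccfun :: "'a ccfun \<Rightarrow> 'a ccfun \<Rightarrow> 'a ccfun" is "\<lambda>f g x. f x - g x"
proof -
  fix f g :: "'a \<Rightarrow> real"
  assume f: "continuous_on UNIV f \<and> compact (closure {x. f x \<noteq> 0})"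
    and g: "continuous_on UNIV g \<and> compact (closure {x. g x \<noteq> 0})"
  have "compact (closure ({x. f x \<noteq> 0} \<union> {x. g x \<noteq> 0}))"
    using f g by (simp add: compact_Un)
  then have "compact (closure {x. f x - g x \<noteq> 0})"
    by (rule compact_support_subset) auto
  then show "continuous_on UNIV (\<lambda>x. f x - g x) \<and> compact (closure {x. f x - g x \<noteq> 0})"
    using f g by (auto intro: continuous_intros)
qed

lift_definition scaleR_ccfun :: "real \<Rightarrow> 'a ccfun \<Rightarrow> 'a ccfun" is "\<lambda>c f x. c * f x"
proof -
  fix c :: real and f :: "'a \<Rightarrow> real"
  assume f: "continuous_on UNIV f \<and> compact (closure {x. f x \<noteq> 0})"
  then have "compact (closure {x. c * f x \<noteq> 0})"
    by (auto intro: compact_support_subset)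
  then show "continuous_on UNIV (\<lambda>x. c * f x) \<and> compact (closure {x. c * f x \<noteq> 0})"
    using f by (auto intro: continuous_intros)
qed

instance
  by (standard; transfer; auto simp: algebra_simps)

end

definition ccfun_on :: "'a::topological_space set \<Rightarrow> 'a ccfun set" where
  "ccfun_on K = {f. closure {x. cc_apply f x \<noteq> 0} \<subseteq> K}"

definition sup_dist :: "'a::topological_space ccfun \<Rightarrow> 'a ccfun \<Rightarrow> real" where
  "sup_dist f g = (SUP x. \<bar>cc_apply f x - cc_apply g x\<bar>)"

lemma bdd_above_cc_diff: "bdd_above (range (\<lambda>x. \<bar>cc_apply f x - cc_apply g x\<bar>))"
proof -
  let ?h = "cc_apply (f - g)"
  let ?S = "closure {x. ?h x \<noteq> 0}"
  have h: "continuous_on UNIV ?h" "compact ?S"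
    using cc_apply[of "f - g"] by auto
  then have "compact (?h ` ?S)"
    by (meson compact_continuous_image continuous_on_subset subset_UNIV)
  then have "\<exists>B. \<forall>x\<in>?S. \<bar>?h x\<bar> \<le> B"
    by (auto dest!: compact_imp_bounded simp: bounded_iff)
  then obtain B where B: "\<And>x. x \<in> ?S \<Longrightarrow> \<bar>?h x\<bar> \<le> B"
    by blast
  have "\<bar>?h x\<bar> \<le> max B 0" for x
  proof (cases "?h x = 0")
    case False
    then have "x \<in> ?S"
      using closure_subset by fastforce
    then show ?thesis
      using B[of x] by linarith
  qed simp
  then show ?thesis
    unfolding minus_ccfun.rep_eq by (intro bdd_aboveI[where M = "max B 0"]) blast
qed

text \<open>Functions in \<open>ccfun_on K\<close> vanish off \<open>K\<close>, so for them the supremum over the whole space is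
  the supremum over \<open>K\<close> (and it stays meaningful for empty \<open>K\<close>).\<close>

lemma Metric_space_sup_dist: "Metric_space (ccfun_on K) sup_dist"
proof
  fix f g h :: "'a ccfun"
  have le: "\<bar>cc_apply u x - cc_apply v x\<bar> \<le> sup_dist u v" for u v :: "'a ccfun" and x
    unfolding sup_dist_def by (rule cSUP_upper[OF UNIV_I bdd_above_cc_diff])
  show "0 \<le> sup_dist f g"
    using le[of f undefined g] by linarith
  show "sup_dist f g = sup_dist g f"
    by (simp add: sup_dist_def abs_minus_commute)
  show "(sup_dist f g = 0) = (f = g)"
  proof
    assume "sup_dist f g = 0"
    then have "cc_apply f x = cc_apply g x" for x
      using le[of f x g] by simp
    then show "f = g"
      by (simp add: cc_apply_inject[symmetric] fun_eq_iff)
  qed (simp add: sup_dist_def)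
  show "sup_dist f h \<le> sup_dist f g + sup_dist g h"
    unfolding sup_dist_def[of f h]
  proof (rule cSUP_least)
    fix x
    show "\<bar>cc_apply f x - cc_apply h x\<bar> \<le> sup_dist f g + sup_dist g h"
      using le[of f x g] le[of g x h] by linarith
  qed simp
qed

definition locally_convex_topology :: "'v::real_vector topology \<Rightarrow> bool" where
  "locally_convex_topology T \<longleftrightarrow>
     topspace T = UNIV \<and>
     continuous_map (prod_topology T T) T (\<lambda>(u, v). u + v) \<and>
     continuous_map (prod_topology euclideanreal T) T (\<lambda>(c, v). c *\<^sub>R v) \<and>
     (\<forall>U. openin T U \<and> 0 \<in> U \<longrightarrow> (\<exists>V. openin T V \<and> 0 \<in> V \<and> convex V \<and> V \<subseteq> U))"

text \<open>The supremum of all locally convex topologies making the inclusions continuous. It is itself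
  locally convex and makes the inclusions continuous, so it is the finest one.\<close>

definition indlim_topology :: "'a::topological_space ccfun topology" where
  "indlim_topology = topology_generated_by
     {U. \<exists>T. locally_convex_topology T \<and>
             (\<forall>K. compact K \<longrightarrow> continuous_map (Metric_space.mtopology (ccfun_on K) sup_dist) T id) \<and>
             openin T U}"


section \<open>Radon measures\<close>

text \<open>Radon measures are functionals on \<open>C\<^sub>0(X)\<close>. The vague topology is the topology of pointwise
  convergence, i.e. the subspace topology inherited from the library topology on
  \<open>'a ccfun \<Rightarrow> real\<close>.\<close>

definition radon_measures :: "('a::topological_space ccfun \<Rightarrow> real) set" where
  "radon_measures = {\<phi>. linear \<phi> \<and> continuous_map indlim_topology euclideanreal \<phi>}"

definition pos_radon_measures :: "('a::topological_space ccfun \<Rightarrow> real) set" where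
  "pos_radon_measures = {\<phi> \<in> radon_measures. \<forall>f. (\<forall>x. 0 \<le> cc_apply f x) \<longrightarrow> 0 \<le> \<phi> f}"

text \<open>From here on the space has a countable base. On a locally compact Hausdorff space with
  countable base every Borel measure finite on compact sets is regular, so no regularity has to be
  imposed on the representing measures; they are \<open>\<sigma>\<close>-finite, and the Borel sets of the square are
  the product \<open>\<sigma>\<close>-algebra, so library product measures are the Radon ones.\<close>

definition locally_finite_borel :: "'a::{t2_space,second_countable_topology} measure \<Rightarrow> bool" where
  "locally_finite_borel P \<longleftrightarrow> sets P = sets borel \<and> (\<forall>K. compact K \<longrightarrow> emeasure P K < \<infinity>)"

definition hahn_jordan ::
  "('a::{t2_space,second_countable_topology} ccfun \<Rightarrow> real) \<Rightarrow> 'a measure \<Rightarrow> 'a measure \<Rightarrow> bool" where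
  "hahn_jordan \<phi> P N \<longleftrightarrow>
     locally_finite_borel P \<and> locally_finite_borel N \<and>
     (\<exists>S\<in>sets borel. emeasure P S = 0 \<and> emeasure N (- S) = 0) \<and>
     (\<forall>f. \<phi> f = (\<integral>x. cc_apply f x \<partial>P) - (\<integral>x. cc_apply f x \<partial>N))"

text \<open>The parts \<open>\<mu>\<^sup>+\<close> and \<open>\<mu>\<^sup>-\<close> of a Radon measure, as Borel measures; existence and uniqueness of
  the pair are the Riesz representation theorem and the Hahn--Jordan decomposition.\<close>

definition pos_part :: "('a::{t2_space,second_countable_topology} ccfun \<Rightarrow> real) \<Rightarrow> 'a measure" where
  "pos_part \<phi> = fst (THE PN. hahn_jordan \<phi> (fst PN) (snd PN))"

definition neg_part :: "('a::{t2_space,second_countable_topology} ccfun \<Rightarrow> real) \<Rightarrow> 'a measure" where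
  "neg_part \<phi> = snd (THE PN. hahn_jordan \<phi> (fst PN) (snd PN))"

definition K_sigma :: "'a::topological_space set \<Rightarrow> bool" where
  "K_sigma = countable union_of compact"


section \<open>Kernels, potentials, energies\<close>

definition symmetric_lsc_kernel :: "('a::topological_space \<Rightarrow> 'a \<Rightarrow> ennreal) \<Rightarrow> bool" where
  "symmetric_lsc_kernel \<kappa> \<longleftrightarrow> (\<forall>x y. \<kappa> x y = \<kappa> y x) \<and> (\<forall>c. open {p. c < \<kappa> (fst p) (snd p)})"

context
  fixes \<kappa> :: "'a::{t2_space,second_countable_topology} \<Rightarrow> 'a \<Rightarrow> ennreal"
begin

definition potential_defined :: "('a ccfun \<Rightarrow> real) \<Rightarrow> 'a \<Rightarrow> bool" where
  "potential_defined \<mu> x \<longleftrightarrow>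
     (\<integral>\<^sup>+y. \<kappa> x y \<partial>pos_part \<mu>) < \<infinity> \<or> (\<integral>\<^sup>+y. \<kappa> x y \<partial>neg_part \<mu>) < \<infinity>"

definition potential :: "('a ccfun \<Rightarrow> real) \<Rightarrow> 'a \<Rightarrow> ereal" where
  "potential \<mu> x =
     enn2ereal (\<integral>\<^sup>+y. \<kappa> x y \<partial>pos_part \<mu>) - enn2ereal (\<integral>\<^sup>+y. \<kappa> x y \<partial>neg_part \<mu>)"

definition product_energy :: "'a measure \<Rightarrow> 'a measure \<Rightarrow> ennreal" where
  "product_energy P Q = (\<integral>\<^sup>+p. \<kappa> (fst p) (snd p) \<partial>(P \<Otimes>\<^sub>M Q))"

text \<open>The positive part of \<open>\<mu> \<otimes> \<nu>\<close> is \<open>\<mu>\<^sup>+ \<otimes> \<nu>\<^sup>+ + \<mu>\<^sup>- \<otimes> \<nu>\<^sup>-\<close>, the negative part is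
  \<open>\<mu>\<^sup>+ \<otimes> \<nu>\<^sup>- + \<mu>\<^sup>- \<otimes> \<nu>\<^sup>+\<close>.\<close>

definition energy_pos :: "('a ccfun \<Rightarrow> real) \<Rightarrow> ('a ccfun \<Rightarrow> real) \<Rightarrow> ennreal" where
  "energy_pos \<mu> \<nu> = product_energy (pos_part \<mu>) (pos_part \<nu>) + product_energy (neg_part \<mu>) (neg_part \<nu>)"

definition energy_neg :: "('a ccfun \<Rightarrow> real) \<Rightarrow> ('a ccfun \<Rightarrow> real) \<Rightarrow> ennreal" where
  "energy_neg \<mu> \<nu> = product_energy (pos_part \<mu>) (neg_part \<nu>) + product_energy (neg_part \<mu>) (pos_part \<nu>)"

definition mutual_energy_defined :: "('a ccfun \<Rightarrow> real) \<Rightarrow> ('a ccfun \<Rightarrow> real) \<Rightarrow> bool" where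
  "mutual_energy_defined \<mu> \<nu> \<longleftrightarrow> energy_pos \<mu> \<nu> < \<infinity> \<or> energy_neg \<mu> \<nu> < \<infinity>"

definition mutual_energy :: "('a ccfun \<Rightarrow> real) \<Rightarrow> ('a ccfun \<Rightarrow> real) \<Rightarrow> ereal" where
  "mutual_energy \<mu> \<nu> = enn2ereal (energy_pos \<mu> \<nu>) - enn2ereal (energy_neg \<mu> \<nu>)"

definition finite_energy :: "('a ccfun \<Rightarrow> real) set" where
  "finite_energy =
     {\<mu> \<in> radon_measures. mutual_energy_defined \<mu> \<mu> \<and> \<bar>mutual_energy \<mu> \<mu>\<bar> \<noteq> \<infinity>}"

definition pos_finite_energy :: "('a ccfun \<Rightarrow> real) set" where
  "pos_finite_energy = finite_energy \<inter> pos_radon_measures"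

definition energy_principle :: bool where
  "energy_principle \<longleftrightarrow>
     (\<forall>\<mu>\<in>radon_measures. mutual_energy_defined \<mu> \<mu> \<longrightarrow>
        0 \<le> mutual_energy \<mu> \<mu> \<and> (mutual_energy \<mu> \<mu> = 0 \<longrightarrow> \<mu> = (\<lambda>_. 0)))"

definition energy_norm :: "('a ccfun \<Rightarrow> real) \<Rightarrow> real" where
  "energy_norm \<mu> = sqrt (real_of_ereal (mutual_energy \<mu> \<mu>))"

definition strong_dist :: "('a ccfun \<Rightarrow> real) \<Rightarrow> ('a ccfun \<Rightarrow> real) \<Rightarrow> real" where
  "strong_dist \<mu> \<nu> = energy_norm (\<lambda>f. \<mu> f - \<nu> f)"

text \<open>Nets are rendered as proper filters: \<open>F \<noteq> bot\<close> containing \<open>\<E>\<^sup>+\<close>. A vague cluster point \<open>\<mu>\<^sub>0\<close>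
  is a point each of whose vague neighbourhoods meets every member of \<open>F\<close>.\<close>

definition consistency_principle :: bool where
  "consistency_principle \<longleftrightarrow>
     (\<forall>F. F \<noteq> bot \<and> (\<forall>\<^sub>F \<mu> in F. \<mu> \<in> pos_finite_energy) \<and>
          (\<forall>\<epsilon>>0. \<forall>\<^sub>F (\<mu>, \<nu>) in F \<times>\<^sub>F F. strong_dist \<mu> \<nu> < \<epsilon>) \<longrightarrow>
        (\<forall>\<mu>0\<in>radon_measures. inf F (nhds \<mu>0) \<noteq> bot \<longrightarrow>
           \<mu>0 \<in> finite_energy \<and> ((\<lambda>\<mu>. strong_dist \<mu> \<mu>0) \<longlongrightarrow> 0) F))"

definition domination_principle :: bool where
  "domination_principle \<longleftrightarrow>
     (\<forall>\<mu>\<in>pos_finite_energy. \<forall>\<nu>\<in>pos_finite_energy.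
        (AE x in pos_part \<mu>. potential \<mu> x \<le> potential \<nu> x) \<longrightarrow>
        (\<forall>x. potential \<mu> x \<le> potential \<nu> x))"

definition cc_potentials :: "'a ccfun set" where
  "cc_potentials =
     {f. \<exists>\<nu>\<in>finite_energy. \<forall>x. potential_defined \<nu> x \<and> potential \<nu> x = ereal (cc_apply f x)}"


section \<open>Capacities\<close>

definition concentrated_on :: "('a ccfun \<Rightarrow> real) \<Rightarrow> 'a set \<Rightarrow> bool" where
  "concentrated_on \<mu> A \<longleftrightarrow> (\<forall>K. compact K \<longrightarrow> (\<exists>N\<in>null_sets (pos_part \<mu>). (- A) \<inter> K \<subseteq> N))"

definition inner_capacity :: "'a set \<Rightarrow> ereal" where
  "inner_capacity A = inverse (INF \<mu>\<in>{\<mu> \<in> pos_finite_energy.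
     concentrated_on \<mu> A \<and> emeasure (pos_part \<mu>) UNIV = 1}. mutual_energy \<mu> \<mu>)"

definition outer_capacity :: "'a set \<Rightarrow> ereal" where
  "outer_capacity A = (INF D\<in>{D. open D \<and> A \<subseteq> D}. inner_capacity D)"

definition nearly_everywhere :: "'a set \<Rightarrow> ('a \<Rightarrow> bool) \<Rightarrow> bool" where
  "nearly_everywhere A P \<longleftrightarrow> (\<exists>N\<subseteq>A. inner_capacity N = 0 \<and> (\<forall>x\<in>A - N. P x))"

definition quasi_everywhere :: "'a set \<Rightarrow> ('a \<Rightarrow> bool) \<Rightarrow> bool" where
  "quasi_everywhere A P \<longleftrightarrow> (\<exists>N\<subseteq>A. outer_capacity N = 0 \<and> (\<forall>x\<in>A - N. P x))"


section \<open>Balayage\<close>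

definition is_unique_minimizer ::
  "('a ccfun \<Rightarrow> real) set \<Rightarrow> ('a ccfun \<Rightarrow> real) \<Rightarrow> bool" where
  "is_unique_minimizer \<Lambda> \<nu> \<longleftrightarrow>
     (\<forall>\<nu>'. \<nu>' \<in> \<Lambda> \<and> (\<forall>\<xi>\<in>\<Lambda>. \<forall>x. potential \<nu>' x \<le> potential \<xi> x) \<longleftrightarrow> \<nu>' = \<nu>)"

definition is_inner_balayage ::
  "'a set \<Rightarrow> ('a ccfun \<Rightarrow> real) \<Rightarrow> ('a ccfun \<Rightarrow> real) \<Rightarrow> bool" where
  "is_inner_balayage A \<mu> = is_unique_minimizer
     {\<nu> \<in> pos_finite_energy. nearly_everywhere A (\<lambda>x. potential \<mu> x \<le> potential \<nu> x)}"

definition is_outer_balayage ::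
  "'a set \<Rightarrow> ('a ccfun \<Rightarrow> real) \<Rightarrow> ('a ccfun \<Rightarrow> real) \<Rightarrow> bool" where
  "is_outer_balayage A \<mu> = is_unique_minimizer
     {\<nu> \<in> pos_finite_energy. quasi_everywhere A (\<lambda>x. potential \<mu> x \<le> potential \<nu> x)}"

end

end

theory Submission
  imports Defs "HOL-Library.Nat_Bijection"
begin

text \<open>
  Positive Radon functionals are identified with locally finite Borel measures (\<open>pos_radon_measuresE\<close>,
  \<open>functional_of_parts\<close>); \<open>pot M\<close> denotes the potential of such a measure, and \<open>ip\<close>, \<open>sqdist\<close> the
  inner product and the squared strong distance on measures of finite energy.

  The set \<open>A\<^sub>0\<close> comes from strong separability. Energy is a supremum of functions of countably many
  vaguely continuous coordinates (\<open>step_energy_approx\<close>), so for vague convergence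
  \<open>liminf \<kappa>(\<mu>\<^sub>n, \<mu>) \<ge> \<parallel>\<mu>\<parallel>\<^sup>2\<close>. If in addition \<open>\<parallel>\<mu>\<^sub>n\<parallel> \<rightarrow> \<parallel>\<mu>\<parallel>\<close>, then
  \<open>\<parallel>\<mu>\<^sub>n - \<mu>\<parallel>\<^sup>2 = \<parallel>\<mu>\<^sub>n\<parallel>\<^sup>2 + \<parallel>\<mu>\<parallel>\<^sup>2 - 2 \<kappa>(\<mu>\<^sub>n, \<mu>) \<rightarrow> 0\<close>. Hence any set of measures of finite
  energy, embedded by these coordinates and the norm into a second countable space, is strongly separable
  (\<open>strong_separability\<close>). Applied to the measures carried by compact subsets of \<open>A\<close>, this yields
  countably many compact subsets of \<open>A\<close>, arranged in an increasing sequence \<open>K\<^sub>n\<close> with union \<open>A\<^sub>0\<close>,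
  such that the measures carried by some \<open>K\<^sub>n\<close> are strongly dense among those carried by compact subsets of
  \<open>A\<close> (\<open>dense_compact_sequence\<close>).

  Let \<open>\<nu>\<^sub>n\<close> be the projection of \<open>\<mu>\<close> onto the cone of measures carried by \<open>K\<^sub>n\<close>; it exists because
  strong Cauchy sequences converge (\<open>strong_completeness\<close>: masses of compact sets are controlled by the norm,
  so there is a vague cluster point, and consistency applies). The \<open>\<nu>\<^sub>n\<close> converge strongly to a measure
  \<open>\<nu>\<close>, and \<open>\<kappa>(\<mu>, \<xi>) \<le> \<kappa>(\<nu>, \<xi>)\<close> for all \<open>\<xi>\<close> carried by some \<open>K\<^sub>n\<close>, hence by density for
  all \<open>\<xi>\<close> carried by a compact subset of \<open>A\<close>. So no measure of finite energy charges
  \<open>{x \<in> A. \<kappa>\<nu> < \<kappa>\<mu>}\<close>, that is, \<open>\<nu>\<close> is a candidate for the inner balayage onto \<open>A\<close>. Conversely,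
  let \<open>\<xi>\<close> be a candidate for \<open>A\<^sub>0\<close>. Then \<open>\<kappa>\<nu>\<^sub>n = \<kappa>\<mu> \<le> \<kappa>\<xi>\<close> holds almost everywhere for
  \<open>\<nu>\<^sub>n\<close>, so everywhere \<open>\<kappa>\<nu>\<^sub>n \<le> \<kappa>\<xi>\<close> by domination, and \<open>\<kappa>\<nu> \<le> \<kappa>\<xi>\<close> by lower
  semicontinuity (\<open>inner_balayage_exists\<close>). Thus \<open>\<nu>\<close> is the inner balayage onto both \<open>A\<close> and
  \<open>A\<^sub>0\<close>.

  For the outer balayage onto \<open>A\<^sub>0\<close> it remains to see that \<open>{x \<in> A\<^sub>0. \<kappa>\<nu> < \<kappa>\<mu>}\<close> has outer capacity
  zero. It is a countable union of compact sets by lower semicontinuity of potentials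
  (\<open>exceptional_set_countable_compact\<close>); a compact set of inner capacity zero has neighbourhoods of
  arbitrarily small capacity, by vague compactness (\<open>compact_inner_null_neighbourhood\<close>), and capacity is
  countably subadditive in the form needed because \<open>\<kappa> \<ge> 0\<close> (\<open>inner_capacity_UN_le\<close>).
\<close>


section \<open>Compactly supported functions on a locally compact space\<close>

definition cc_support :: "'a::topological_space ccfun \<Rightarrow> 'a set" where
  "cc_support f = closure {x. cc_apply f x \<noteq> 0}"

lemma continuous_cc_apply: "continuous_on S (cc_apply f)"
  using cc_apply[of f] by (auto intro: continuous_on_subset)

lemma compact_cc_support: "compact (cc_support f)"
  using cc_apply[of f] by (simp add: cc_support_def)

lemma cc_apply_eq_0: "x \<notin> cc_support f \<Longrightarrow> cc_apply f x = 0"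
  using closure_subset[of "{x. cc_apply f x \<noteq> 0}"] by (auto simp: cc_support_def)

lemma ccfun_eqI: "(\<And>x. cc_apply f x = cc_apply g x) \<Longrightarrow> f = g"
  by (simp add: cc_apply_inject[symmetric] fun_eq_iff)

lemma cc_support_subset:
  assumes "closed K" "\<And>x. x \<notin> K \<Longrightarrow> cc_apply f x = 0"
  shows "cc_support f \<subseteq> K"
  unfolding cc_support_def using assms by (intro closure_minimal) auto

lemma ccfun_exists:
  fixes h :: "'a::t2_space \<Rightarrow> real"
  assumes "continuous_on UNIV h" "compact K" "\<And>x. x \<notin> K \<Longrightarrow> h x = 0"
  shows "\<exists>f. cc_apply f = h \<and> cc_support f \<subseteq> K"
proof -
  have cl: "closed K"
    using assms(2) by (rule compact_imp_closed)
  have "closure {x. h x \<noteq> 0} \<subseteq> K"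
    using assms(3) cl by (intro closure_minimal) auto
  then have "compact (closure {x. h x \<noteq> 0})"
    using assms(2) by (metis closed_closure compact_Int_closed inf.absorb_iff2)
  then have 1: "cc_apply (Abs_ccfun h) = h"
    using assms(1) by (intro Abs_ccfun_inverse) auto
  then have "cc_support (Abs_ccfun h) \<subseteq> K"
    using cl assms(3) by (intro cc_support_subset) auto
  with 1 show ?thesis by blast
qed

lemma cc_bounded: "\<exists>B\<ge>0. \<forall>x. \<bar>cc_apply f x\<bar> \<le> B"
proof -
  have "bdd_above (range (\<lambda>x. \<bar>cc_apply f x - cc_apply 0 x\<bar>))"
    by (rule bdd_above_cc_diff)
  then obtain B where "\<And>x. \<bar>cc_apply f x\<bar> \<le> B"
    by (auto simp: bdd_above_def zero_ccfun.rep_eq)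
  then show ?thesis
    by (intro exI[of _ B]) (meson abs_ge_zero order_trans)
qed

lemma cc_apply_sum: "cc_apply (\<Sum>i\<in>I. f i) x = (\<Sum>i\<in>I. cc_apply (f i) x)"
  by (induction I rule: infinite_finite_induct) (auto simp: zero_ccfun.rep_eq plus_ccfun.rep_eq)

lemma Hausdorff_space_euclidean_t2: "Hausdorff_space (euclidean :: 'a::t2_space topology)"
  unfolding Hausdorff_space_def
proof (intro allI impI)
  fix x y :: 'a assume "x \<in> topspace euclidean \<and> y \<in> topspace euclidean \<and> x \<noteq> y"
  then obtain U V where "open U" "open V" "x \<in> U" "y \<in> V" "U \<inter> V = {}"
    using hausdorff[of x y] by blast
  then show "\<exists>U V. openin euclidean U \<and> openin euclidean V \<and> x \<in> U \<and> y \<in> V \<and> disjnt U V"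
    by (intro exI[of _ U] exI[of _ V]) (simp add: disjnt_def)
qed

text \<open>The assumption concerns a type. The witness turns the space into a locale parameter, so that locales about
  kernels on the same space can extend this one.\<close>

locale lc_space =
  fixes type_witness :: "'a::{t2_space,second_countable_topology} itself"
  assumes locally_compact: "locally_compact_space (euclidean :: 'a topology)"
begin

lemma compact_neighbourhood_between:
  assumes "compact (K :: 'a set)" "open U" "K \<subseteq> U"
  shows "\<exists>V L. open V \<and> compact L \<and> K \<subseteq> V \<and> V \<subseteq> L \<and> L \<subseteq> U"
proof -
  have "neighbourhood_base_of (\<lambda>C. compactin euclidean C \<and> closedin euclidean C) (euclidean :: 'a topology)"
    by (rule iffD1[OF locally_compact_space_neighbourhood_base_closedin locally_compact])
       (rule disjI1[OF Hausdorff_space_euclidean_t2])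
  then have nb: "\<exists>V L. open V \<and> compact L \<and> x \<in> V \<and> V \<subseteq> L \<and> L \<subseteq> U" if "x \<in> K" for x
    using assms(2,3) that 
    unfolding neighbourhood_base_of open_openin[symmetric] compactin_euclidean_iff by (meson subsetD)
  then obtain V L where VL: "\<And>x. x \<in> K \<Longrightarrow> open (V x) \<and> compact (L x) \<and> x \<in> V x \<and> V x \<subseteq> L x \<and> L x \<subseteq> U"
    by metis
  obtain D where D: "D \<subseteq> K" "finite D" "K \<subseteq> (\<Union>x\<in>D. V x)"
    using compactE_image[OF assms(1), of K V] VL by blast
  have "open (\<Union>x\<in>D. V x)" "compact (\<Union>x\<in>D. L x)" "(\<Union>x\<in>D. V x) \<subseteq> (\<Union>x\<in>D. L x)" "(\<Union>x\<in>D. L x) \<subseteq> U"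
    subgoal using VL D(1) by (intro open_UN ballI) (meson subsetD)
    subgoal using VL D(1,2) by (intro compact_UN) (meson subsetD)+
    subgoal using VL D(1) by (intro UN_mono) (auto dest: subsetD)
    subgoal using VL D(1) by (intro UN_least) (meson subsetD)
    done
  with D(3) show ?thesis
    by blast
qed

text \<open>The Urysohn function is taken for a neighbourhood \<open>V\<close> of \<open>K\<close> with a compact set
  between \<open>V\<close> and \<open>U\<close>, so that also its closed support stays inside \<open>U\<close>.\<close>

lemma bump_function:
  assumes "compact (K :: 'a set)" "open U" "K \<subseteq> U"
  shows "\<exists>f. (\<forall>x. 0 \<le> cc_apply f x \<and> cc_apply f x \<le> 1) \<and> (\<forall>x\<in>K. cc_apply f x = 1) \<and> cc_support f \<subseteq> U"
proof -
  obtain V L where VL: "open V" "compact L" "K \<subseteq> V" "V \<subseteq> L" "L \<subseteq> U"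
    using compact_neighbourhood_between[OF assms] by blast
  have "completely_regular_space (euclidean :: 'a topology)"
    by (rule locally_compact_regular_imp_completely_regular_space[OF locally_compact])
       (rule disjI1[OF Hausdorff_space_euclidean_t2])
  then obtain h where h: "continuous_map euclidean (top_of_set {0..1::real}) h" "h ` (- V) \<subseteq> {0}" "h ` K \<subseteq> {1}"
    using Urysohn_completely_regular_compact_closed[of 0 1 "euclidean :: 'a topology" K "- V"] VL assms
    by (auto simp: disjnt_def)
  have c: "continuous_on UNIV h" and r: "\<And>x. h x \<in> {0..1}"
    using h(1) by (auto simp: continuous_map_in_subtopology)
  obtain f where "cc_apply f = h" "cc_support f \<subseteq> L"
    using ccfun_exists[OF c VL(2)] h(2) VL(4) by (metis ComplI image_subset_iff singletonD subset_iff)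
  then show ?thesis
    using r h VL by (intro exI[of _ f]) auto
qed

text \<open>One bump function for each pair \<open>(b, c)\<close> of members of a countable base such that the closure
  of \<open>b\<close> is compact and contained in \<open>c\<close>.\<close>

lemma countable_bump_family:
  obtains g :: "nat \<Rightarrow> 'a ccfun" where
    "\<And>i x. 0 \<le> cc_apply (g i) x" "\<And>i x. cc_apply (g i) x \<le> 1"
    "\<And>U x. open U \<Longrightarrow> x \<in> U \<Longrightarrow> \<exists>i. cc_apply (g i) x = 1 \<and> cc_support (g i) \<subseteq> U"
proof -
  obtain B :: "'a set set" where B: "countable B" "topological_basis B"
    using ex_countable_basis by blast
  define Q where "Q = {(b, c) \<in> B \<times> B. compact (closure b) \<and> closure b \<subseteq> c}"
  have "\<forall>p\<in>Q. \<exists>f. (\<forall>x. 0 \<le> cc_apply f x \<and> cc_apply f x \<le> 1) \<and> (\<forall>x\<in>closure (fst p). cc_apply f x = 1) \<and>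
      cc_support f \<subseteq> snd p"
    using B(2) by (intro ballI bump_function) (auto simp: Q_def topological_basis_open)
  then obtain F where F: "\<And>p. p \<in> Q \<Longrightarrow> (\<forall>x. 0 \<le> cc_apply (F p) x \<and> cc_apply (F p) x \<le> 1) \<and>
      (\<forall>x\<in>closure (fst p). cc_apply (F p) x = 1) \<and> cc_support (F p) \<subseteq> snd p"
    by metis
  have "countable Q"
    using B(1) by (intro countable_subset[of Q "B \<times> B"]) (auto simp: Q_def)
  have nb: "\<exists>p\<in>Q. x \<in> fst p \<and> snd p \<subseteq> U" if U: "open U" "x \<in> U" for U and x :: 'a
  proof -
    obtain c where c: "c \<in> B" "x \<in> c" "c \<subseteq> U"
      using topological_basisE[OF B(2) U] by blast
    obtain V L where VL: "open V" "compact L" "x \<in> V" "V \<subseteq> L" "L \<subseteq> c"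
      using compact_neighbourhood_between[of "{x}" c] c topological_basis_open[OF B(2)] by auto
    obtain b where b: "b \<in> B" "x \<in> b" "b \<subseteq> V"
      using topological_basisE[OF B(2) VL(1,3)] by blast
    have "closure b \<subseteq> L"
      using b VL by (meson closure_minimal compact_imp_closed order_trans)
    then have "compact (closure b)" "closure b \<subseteq> c"
      using VL by (metis closed_closure compact_Int_closed inf.absorb_iff2, blast)
    then show ?thesis
      using b c by (intro bexI[of _ "(b, c)"]) (auto simp: Q_def)
  qed
  have "Q \<noteq> {}"
    using nb[of UNIV] by blast
  let ?g = "\<lambda>i. F (from_nat_into Q i)"
  show thesis
  proof
    have *: "from_nat_into Q i \<in> Q" for i
      using \<open>Q \<noteq> {}\<close> by (rule from_nat_into)
    show "0 \<le> cc_apply (?g i) x" "cc_apply (?g i) x \<le> 1" for i x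
      using F[OF *[of i]] by auto
    fix U :: "'a set" and x assume "open U" "x \<in> U"
    then obtain p where p: "p \<in> Q" "x \<in> fst p" "snd p \<subseteq> U"
      using nb by blast
    obtain i where "p = from_nat_into Q i"
      using from_nat_into_surj[OF \<open>countable Q\<close> p(1)] by metis
    then show "\<exists>i. cc_apply (?g i) x = 1 \<and> cc_support (?g i) \<subseteq> U"
      using F[OF p(1)] p closure_subset[of "fst p"] by (intro exI[of _ i]) blast
  qed
qed

end

section \<open>The Riesz representation theorem\<close>

lemma cc_compose:
  fixes f :: "'a::t2_space ccfun" and h :: "real \<Rightarrow> real"
  assumes "continuous_on UNIV h" "h 0 = 0"
  shows "\<exists>g. cc_apply g = (\<lambda>x. h (cc_apply f x)) \<and> cc_support g \<subseteq> cc_support f"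
proof (rule ccfun_exists)
  show "continuous_on UNIV (\<lambda>x. h (cc_apply f x))"
    using continuous_on_compose2[OF assms(1) continuous_cc_apply[of UNIV f]] by auto
  show "compact (cc_support f)"
    by (rule compact_cc_support)
  show "h (cc_apply f x) = 0" if "x \<notin> cc_support f" for x
    using cc_apply_eq_0[OF that] assms(2) by simp
qed

lemma cc_mult:
  fixes f u :: "'a::t2_space ccfun"
  shows "\<exists>g. cc_apply g = (\<lambda>x. cc_apply f x * cc_apply u x) \<and> cc_support g \<subseteq> cc_support f \<inter> cc_support u"
proof (rule ccfun_exists)
  show "continuous_on UNIV (\<lambda>x. cc_apply f x * cc_apply u x)"
    by (intro continuous_on_mult continuous_cc_apply)
  show "compact (cc_support f \<inter> cc_support u)"
    by (intro compact_Int compact_cc_support)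
  show "cc_apply f x * cc_apply u x = 0" if "x \<notin> cc_support f \<inter> cc_support u" for x
    using cc_apply_eq_0[of x f] cc_apply_eq_0[of x u] that by auto
qed

lemma closed_cc_support: "closed (cc_support f)"
  by (simp add: cc_support_def)

lemma measurable_cc_apply: "sets M = sets borel \<Longrightarrow> cc_apply f \<in> borel_measurable M"
  using borel_measurable_continuous_onI[OF continuous_cc_apply[of UNIV f]] measurable_cong_sets by blast

lemma emeasure_compact_finite:
  "locally_finite_borel P \<Longrightarrow> compact K \<Longrightarrow> emeasure P K < \<infinity>"
  by (simp add: locally_finite_borel_def)

lemma sets_lf: "locally_finite_borel P \<Longrightarrow> sets P = sets borel"
  by (simp add: locally_finite_borel_def)

lemma space_lf: "locally_finite_borel P \<Longrightarrow> space P = UNIV"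
  using sets_eq_imp_space_eq[OF sets_lf] by simp

lemma integrable_cc_apply:
  assumes P: "locally_finite_borel P"
  shows "integrable P (cc_apply f)"
proof -
  obtain B where B: "\<And>x. \<bar>cc_apply f x\<bar> \<le> B"
    using cc_bounded by blast
  have S: "cc_support f \<in> sets P"
    using borel_closed[OF closed_cc_support] sets_lf[OF P] by simp
  have "integrable P (\<lambda>x. B * indicator (cc_support f) x)"
    using S emeasure_compact_finite[OF P compact_cc_support]
    by (intro integrable_mult_right integrable_real_indicator) auto
  then show ?thesis
  proof (rule Bochner_Integration.integrable_bound)
    show "cc_apply f \<in> borel_measurable P"
      by (rule measurable_cc_apply[OF sets_lf[OF P]])
    show "AE x in P. norm (cc_apply f x) \<le> norm (B * indicator (cc_support f) x)"
    proof (rule AE_I2)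
      fix x
      show "norm (cc_apply f x) \<le> norm (B * indicator (cc_support f) x)"
        using B[of x] cc_apply_eq_0[of x f] by (cases "x \<in> cc_support f") auto
    qed
  qed
qed

lemma (in lc_space) locally_finite_null_measure: "locally_finite_borel (null_measure (borel :: 'a measure))"
  by (simp add: locally_finite_borel_def)

locale positive_functional = lc_space "TYPE('a)"
  for \<phi> :: "'a::{t2_space,second_countable_topology} ccfun \<Rightarrow> real" +
  assumes linear: "linear \<phi>"
    and nonneg: "\<And>f. (\<And>x. 0 \<le> cc_apply f x) \<Longrightarrow> 0 \<le> \<phi> f"
begin

lemma functional_mono: "(\<And>x. cc_apply f x \<le> cc_apply g x) \<Longrightarrow> \<phi> f \<le> \<phi> g"
  using nonneg[of "g - f"] linear_diff[OF linear, of g f] by (simp add: minus_ccfun.rep_eq)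

text \<open>The measure is built from \<open>\<mu>(U) = sup {\<phi> f | 0 \<le> f \<le> 1, supp f \<subseteq> U}\<close> on open sets,
  extended to an outer measure by approximation from outside.\<close>

definition below :: "'a ccfun \<Rightarrow> 'a set \<Rightarrow> bool" where
  "below f U \<longleftrightarrow> (\<forall>x. 0 \<le> cc_apply f x \<and> cc_apply f x \<le> 1) \<and> cc_support f \<subseteq> U"

definition open_content :: "'a set \<Rightarrow> ennreal" where
  "open_content U = (SUP f\<in>{f. below f U}. ennreal (\<phi> f))"

definition outer_content :: "'a set \<Rightarrow> ennreal" where
  "outer_content E = (INF U\<in>{U. open U \<and> E \<subseteq> U}. open_content U)"

lemma below_0: "below 0 U"
  using cc_support_subset[of "{}" 0] by (auto simp: below_def zero_ccfun.rep_eq)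

lemma le_open_content: "below f U \<Longrightarrow> ennreal (\<phi> f) \<le> open_content U"
  unfolding open_content_def by (rule SUP_upper) simp

lemma open_content_mono: "U \<subseteq> V \<Longrightarrow> open_content U \<le> open_content V"
  unfolding open_content_def by (rule SUP_subset_mono) (auto simp: below_def)

lemma outer_content_mono: "E \<subseteq> F \<Longrightarrow> outer_content E \<le> outer_content F"
  unfolding outer_content_def by (rule INF_superset_mono) auto

lemma outer_content_open: "open U \<Longrightarrow> outer_content U = open_content U"
  unfolding outer_content_def
  by (intro antisym INF_lower INF_greatest) (auto intro: open_content_mono)

lemma open_content_empty: "open_content {} = 0"
proof -
  have "\<phi> f = 0" if "below f {}" for f
  proof -
    have "f = 0"
      using that cc_apply_eq_0[of _ f] by (intro ccfun_eqI) (auto simp: below_def zero_ccfun.rep_eq)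
    then show ?thesis
      using linear_0[OF linear] by simp
  qed
  then show ?thesis
    unfolding open_content_def by (intro antisym SUP_least) auto
qed

text \<open>A function supported in \<open>U \<union> V\<close> is split by a cutoff which equals \<open>1\<close> on a neighbourhood
  of the part of its support outside \<open>V\<close>. Being \<open>1\<close> on that part alone would not keep the
  closed support of the remainder inside \<open>V\<close>.\<close>

lemma open_content_Un:
  assumes "open U" "open V"
  shows "open_content (U \<union> V) \<le> open_content U + open_content V"
  unfolding open_content_def[of "U \<union> V"]
proof (rule SUP_least, safe)
  fix f assume f: "below f (U \<union> V)"
  have "compact (cc_support f - V)"
    using compact_cc_support assms(2) by (rule compact_diff)
  moreover have "cc_support f - V \<subseteq> U"
    using f by (auto simp: below_def)
  ultimately obtain W L where W: "open W" "compact L" "cc_support f - V \<subseteq> W" "W \<subseteq> L" "L \<subseteq> U"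
    using compact_neighbourhood_between[OF _ assms(1)] by metis
  obtain u where u: "\<And>x. 0 \<le> cc_apply u x" "\<And>x. cc_apply u x \<le> 1" "\<And>x. x \<in> L \<Longrightarrow> cc_apply u x = 1" "cc_support u \<subseteq> U"
    using bump_function[OF W(2) assms(1) W(5)] by blast
  obtain g where g: "cc_apply g = (\<lambda>x. cc_apply f x * cc_apply u x)" "cc_support g \<subseteq> cc_support f \<inter> cc_support u"
    using cc_mult by blast
  have f01: "0 \<le> cc_apply f x" "cc_apply f x \<le> 1" for x
    using f by (auto simp: below_def)
  have gU: "below g U"
    using f01 u g unfolding below_def by (auto intro: mult_le_one)
  have fg: "cc_apply (f - g) x = cc_apply f x * (1 - cc_apply u x)" for x
    by (simp add: g(1) minus_ccfun.rep_eq algebra_simps)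
  have "cc_support (f - g) \<subseteq> cc_support f \<inter> - W"
  proof (rule cc_support_subset)
    show "closed (cc_support f \<inter> - W)"
      using W(1) closed_cc_support by (intro closed_Int) auto
    show "cc_apply (f - g) x = 0" if "x \<notin> cc_support f \<inter> - W" for x
      unfolding fg using that cc_apply_eq_0[of x f] u(3)[of x] W(4) by auto
  qed
  then have "below (f - g) V"
    using W(3) f01 u unfolding below_def fg by (auto intro: mult_le_one)
  then have "ennreal (\<phi> g) + ennreal (\<phi> (f - g)) \<le> open_content U + open_content V"
    using gU by (intro add_mono le_open_content)
  moreover have "ennreal (\<phi> g) + ennreal (\<phi> (f - g)) = ennreal (\<phi> f)"
  proof -
    have "0 \<le> \<phi> g" "0 \<le> \<phi> (f - g)"
      using f01 u by (auto intro!: nonneg simp: fg g)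
    then show ?thesis
      by (simp add: linear_diff[OF linear] flip: ennreal_plus)
  qed
  ultimately show "ennreal (\<phi> f) \<le> open_content U + open_content V"
    by simp
qed

lemma open_content_UN_finite:
  "(\<And>i. open (U i)) \<Longrightarrow> open_content (\<Union>i<n::nat. U i) \<le> (\<Sum>i<n. open_content (U i))"
proof (induction n)
  case 0
  then show ?case by (simp add: open_content_empty)
next
  case (Suc n)
  have "open_content (\<Union>i<Suc n. U i) \<le> open_content (\<Union>i<n. U i) + open_content (U n)"
    using open_content_Un[of "\<Union>i<n. U i" "U n"] Suc.prems by (simp add: lessThan_Suc Un_commute open_UN)
  also have "\<dots> \<le> (\<Sum>i<Suc n. open_content (U i))"
    using Suc by (simp add: add_right_mono)
  finally show ?case .
qed

lemma open_content_UN: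
  assumes "\<And>i::nat. open (U i)"
  shows "open_content (\<Union>i. U i) \<le> (\<Sum>i. open_content (U i))"
  unfolding open_content_def[of "\<Union>i. U i"]
proof (rule SUP_least, safe)
  fix f assume f: "below f (\<Union>i. U i)"
  then obtain D where D: "finite D" "cc_support f \<subseteq> (\<Union>i\<in>D. U i)"
    using compactE_image[OF compact_cc_support[of f], of UNIV U] assms by (auto simp: below_def)
  obtain n where "D \<subseteq> {..<n}"
    using D(1) finite_nat_iff_bounded by blast
  then have "below f (\<Union>i<n. U i)"
    using f D unfolding below_def by blast
  then have "ennreal (\<phi> f) \<le> open_content (\<Union>i<n. U i)"
    by (rule le_open_content)
  also have "\<dots> \<le> (\<Sum>i<n. open_content (U i))"
    by (rule open_content_UN_finite[OF assms])
  also have "\<dots> \<le> (\<Sum>i. open_content (U i))"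
    by (rule sum_le_suminf) auto
  finally show "ennreal (\<phi> f) \<le> (\<Sum>i. open_content (U i))" .
qed

lemma outer_measure_space_outer_content: "outer_measure_space (Pow UNIV) outer_content"
  unfolding outer_measure_space_def
proof (intro conjI)
  show "positive (Pow UNIV) outer_content"
    by (simp add: positive_def outer_content_open open_content_empty)
  show "increasing (Pow UNIV) outer_content"
    by (simp add: increasing_def outer_content_mono)
  show "countably_subadditive (Pow UNIV) outer_content"
    unfolding countably_subadditive_def
  proof (intro allI impI)
    fix A :: "nat \<Rightarrow> 'a set"
    show "outer_content (\<Union>i. A i) \<le> (\<Sum>i. outer_content (A i))"
    proof (rule ennreal_le_epsilon)
      fix e :: real assume fin: "(\<Sum>i. outer_content (A i)) < top" and e: "0 < e"
      have "\<exists>U. open U \<and> A i \<subseteq> U \<and> open_content U \<le> outer_content (A i) + ennreal (e * (1/2)^Suc i)" for i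
      proof -
        have "outer_content (A i) \<noteq> top"
          using ennreal_suminf_lessD[OF fin] by (simp add: less_top)
        moreover have "0 < e * (1/2)^Suc i"
          using e by simp
        ultimately have "outer_content (A i) < outer_content (A i) + ennreal (e * (1/2)^Suc i)"
          by (simp add: ennreal_add_left_cancel_less[of _ 0, simplified] less_top)
        then show ?thesis
          unfolding outer_content_def INF_less_iff by (auto intro: less_imp_le)
      qed
      then obtain U where U: "\<And>i. open (U i)" "\<And>i. A i \<subseteq> U i"
          "\<And>i. open_content (U i) \<le> outer_content (A i) + ennreal (e * (1/2)^Suc i)"
        by metis
      have "outer_content (\<Union>i. A i) \<le> outer_content (\<Union>i. U i)"
        using U(2) by (intro outer_content_mono UN_mono) auto
      also have "\<dots> \<le> (\<Sum>i. open_content (U i))"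
        using open_content_UN[of U] U(1) by (simp add: outer_content_open open_UN)
      also have "\<dots> \<le> (\<Sum>i. outer_content (A i) + ennreal (e * (1/2)^Suc i))"
        by (intro suminf_le U(3)) auto
      also have "\<dots> = (\<Sum>i. outer_content (A i)) + (\<Sum>i. ennreal (e * (1/2)^Suc i))"
        by (rule suminf_add[symmetric]) auto
      also have "(\<Sum>i. ennreal (e * (1/2)^Suc i)) = ennreal e"
        using e sums_mult[OF power_half_series, of e] 
        by (intro suminf_ennreal_eq) (auto simp del: power_Suc)
      finally show "outer_content (\<Union>i. A i) \<le> (\<Sum>i. outer_content (A i)) + ennreal e" .
    qed
  qed
qed

lemma outer_content_Un: "outer_content (A \<union> B) \<le> outer_content A + outer_content B"
proof -
  have "subadditive (Pow UNIV) outer_content"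
    using outer_measure_space_outer_content unfolding outer_measure_space_def
    by (intro ring_of_sets.countably_subadditive_subadditive[OF ring_of_sets_Pow]) blast+
  then show ?thesis
  proof -
    assume *: "subadditive (Pow UNIV) outer_content"
    have "A \<union> B = A \<union> (B - A)" by blast
    then have "outer_content (A \<union> B) \<le> outer_content A + outer_content (B - A)"
      using subadditiveD[OF *, of A "B - A"] by simp
    also have "\<dots> \<le> outer_content A + outer_content B"
      by (intro add_left_mono outer_content_mono) auto
    finally show ?thesis .
  qed
qed

text \<open>If \<open>f\<close> is admissible for \<open>V \<inter> U\<close> and \<open>g\<close> for \<open>U - supp f\<close>, then their
  supports are disjoint, so \<open>f + g\<close> is admissible for \<open>U\<close>. This is the Caratheodory criterion for
  \<open>V\<close>, tested on open sets; the general case follows by outer approximation.\<close>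

lemma open_split:
  assumes "open U" "open V"
  shows "open_content (V \<inter> U) + outer_content (U - V) \<le> open_content U"
proof -
  have *: "ennreal (\<phi> f) + outer_content (U - V) \<le> open_content U" if f: "below f (V \<inter> U)" for f
  proof -
    have o: "open (U - cc_support f)"
      using assms(1) closed_cc_support by (rule open_Diff)
    have "outer_content (U - V) \<le> open_content (U - cc_support f)"
      using f outer_content_mono[of "U - V" "U - cc_support f"] outer_content_open[OF o] by (auto simp: below_def)
    then have "ennreal (\<phi> f) + outer_content (U - V) \<le> ennreal (\<phi> f) + open_content (U - cc_support f)"
      by (rule add_left_mono)
    also have "\<dots> = (SUP g\<in>{g. below g (U - cc_support f)}. ennreal (\<phi> f) + ennreal (\<phi> g))"
      unfolding open_content_def using below_0 by (subst ennreal_SUP_add_right) auto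
    also have "\<dots> \<le> open_content U"
    proof (rule SUP_least, safe)
      fix g assume g: "below g (U - cc_support f)"
      have "cc_apply f x + cc_apply g x \<le> 1" for x
      proof (cases "x \<in> cc_support f")
        case True
        then have "cc_apply g x = 0"
          using g by (intro cc_apply_eq_0) (auto simp: below_def)
        then show ?thesis
          using f by (simp add: below_def)
      next
        case False
        then show ?thesis
          using g by (simp add: below_def cc_apply_eq_0)
      qed
      moreover have "cc_support (f + g) \<subseteq> cc_support f \<union> cc_support g"
        using closed_cc_support cc_apply_eq_0[of _ f] cc_apply_eq_0[of _ g]
        by (intro cc_support_subset) (auto simp: plus_ccfun.rep_eq)
      ultimately have "below (f + g) U"
        using f g unfolding below_def by (auto simp: plus_ccfun.rep_eq)
      then have "ennreal (\<phi> (f + g)) \<le> open_content U"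
        by (rule le_open_content)
      moreover have "0 \<le> \<phi> f" "0 \<le> \<phi> g"
        using f g by (auto intro!: nonneg simp: below_def)
      ultimately show "ennreal (\<phi> f) + ennreal (\<phi> g) \<le> open_content U"
        by (simp add: linear_add[OF linear] flip: ennreal_plus)
    qed
    finally show ?thesis .
  qed
  have "open_content (V \<inter> U) + outer_content (U - V) =
      (SUP f\<in>{f. below f (V \<inter> U)}. ennreal (\<phi> f) + outer_content (U - V))"
    unfolding open_content_def using below_0 by (intro ennreal_SUP_add_left[symmetric]) auto
  also have "\<dots> \<le> open_content U"
    using * by (intro SUP_least) auto
  finally show ?thesis .
qed

lemma open_in_lambda_system:
  assumes "open V"
  shows "V \<in> lambda_system UNIV (Pow UNIV) outer_content"
proof -
  have "outer_content (V \<inter> E) + outer_content (E - V) = outer_content E" for E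
  proof (rule antisym)
    have "outer_content (V \<inter> E) + outer_content (E - V) \<le> open_content U" if "open U" "E \<subseteq> U" for U
    proof -
      have "outer_content (V \<inter> E) \<le> open_content (V \<inter> U)"
        using outer_content_mono[of "V \<inter> E" "V \<inter> U"] that assms by (auto simp: outer_content_open open_Int)
      moreover have "outer_content (E - V) \<le> outer_content (U - V)"
        using that by (intro outer_content_mono) auto
      ultimately show ?thesis
        using open_split[OF that(1) assms] by (meson add_mono order_trans)
    qed
    then show "outer_content (V \<inter> E) + outer_content (E - V) \<le> outer_content E"
      unfolding outer_content_def[of E] by (intro INF_greatest) auto
    show "outer_content E \<le> outer_content (V \<inter> E) + outer_content (E - V)"
    proof -
      have "E = (V \<inter> E) \<union> (E - V)" by blast
      then show ?thesis
        using outer_content_Un[of "V \<inter> E" "E - V"] by metis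
    qed
  qed
  moreover have "(UNIV - V) \<inter> E = E - V" for E
    by blast
  ultimately show ?thesis
    by (simp add: lambda_system_def)
qed

definition riesz_measure :: "'a measure" where
  "riesz_measure = measure_of UNIV (sets borel) outer_content"

lemma sets_riesz_measure [simp]: "sets riesz_measure = sets borel"
  unfolding riesz_measure_def by (metis sets.sigma_sets_eq sets_measure_of sets.space_closed space_borel)

lemma emeasure_riesz_measure:
  assumes "E \<in> sets borel"
  shows "emeasure riesz_measure E = outer_content E"
proof -
  have ms: "measure_space UNIV (lambda_system UNIV (Pow UNIV) outer_content) outer_content"
    by (rule sigma_algebra.caratheodory_lemma[OF sigma_algebra_Pow outer_measure_space_outer_content])
  then have sa: "sigma_algebra UNIV (lambda_system UNIV (Pow UNIV) outer_content)"
    by (simp add: measure_space_def)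
  have "sets borel \<subseteq> lambda_system UNIV (Pow UNIV) outer_content"
    unfolding sets_borel using open_in_lambda_system by (intro sigma_algebra.sigma_sets_subset[OF sa]) auto
  then have "measure_space UNIV (sets (borel :: 'a measure)) outer_content"
    using measure_down[OF ms _] sets.sigma_algebra_axioms[of "borel :: 'a measure"] by (metis space_borel)
  then show ?thesis
    unfolding riesz_measure_def using assms
    by (intro emeasure_measure_of_sigma) (auto simp: measure_space_def)
qed

lemma open_content_le:
  assumes "open U" "0 < c" "\<And>x. 0 \<le> cc_apply f x" "\<And>x. x \<in> U \<Longrightarrow> c \<le> cc_apply f x"
  shows "open_content U \<le> ennreal (\<phi> f / c)"
  unfolding open_content_def
proof (rule SUP_least, safe)
  fix g assume g: "below g U"
  have "cc_apply g x \<le> cc_apply ((1/c) *\<^sub>R f) x" for x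
  proof (cases "x \<in> U")
    case True
    then have "1 \<le> cc_apply f x / c"
      using assms(2) assms(4)[of x] by (simp add: field_simps)
    moreover have "cc_apply g x \<le> 1"
      using g by (simp add: below_def)
    ultimately show ?thesis
      by (simp add: scaleR_ccfun.rep_eq)
  next
    case False
    then have "cc_apply g x = 0"
      using g by (intro cc_apply_eq_0) (auto simp: below_def)
    then show ?thesis
      using assms(2) assms(3)[of x] by (simp add: scaleR_ccfun.rep_eq)
  qed
  then have "\<phi> g \<le> \<phi> f / c"
    using functional_mono[of g "(1/c) *\<^sub>R f"] linear_scale[OF linear] by simp
  then show "ennreal (\<phi> g) \<le> ennreal (\<phi> f / c)"
    by (rule ennreal_leI)
qed

text \<open>\<open>K\<close> lies in the open sets \<open>{f > 1 - 1 / n}\<close>.\<close>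

lemma compact_content_le:
  assumes "compact K" "\<And>x. 0 \<le> cc_apply f x" "\<And>x. x \<in> K \<Longrightarrow> 1 \<le> cc_apply f x"
  shows "outer_content K \<le> ennreal (\<phi> f)"
proof -
  have "outer_content K \<le> ennreal (\<phi> f / (1 - 1 / real (Suc (Suc n))))" for n
  proof -
    let ?c = "1 - 1 / real (Suc (Suc n))"
    have c: "0 < ?c" "?c < 1"
      by (auto simp: field_simps)
    have o: "open {x. ?c < cc_apply f x}"
      by (intro open_Collect_less continuous_on_const continuous_cc_apply)
    have "outer_content K \<le> outer_content {x. ?c < cc_apply f x}"
      using less_le_trans[OF c(2) assms(3)] by (intro outer_content_mono) blast
    also have "\<dots> \<le> ennreal (\<phi> f / ?c)"
      unfolding outer_content_open[OF o] using c assms(2) by (intro open_content_le o) auto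
    finally show ?thesis .
  qed
  moreover have "(\<lambda>n. ennreal (\<phi> f / (1 - 1 / real (Suc (Suc n))))) \<longlonglongrightarrow> ennreal (\<phi> f / (1 - 0))"
    by (intro tendsto_ennrealI tendsto_divide tendsto_diff tendsto_const
      LIMSEQ_Suc[OF LIMSEQ_Suc[OF lim_1_over_n]]) auto
  ultimately show ?thesis
    by (intro LIMSEQ_le_const[of _ "ennreal (\<phi> f)"]) auto
qed

lemma le_content:
  assumes "\<And>x. 0 \<le> cc_apply f x" "\<And>x. cc_apply f x \<le> 1" "cc_support f \<subseteq> E"
  shows "ennreal (\<phi> f) \<le> outer_content E"
  unfolding outer_content_def using assms by (intro INF_greatest le_open_content) (auto simp: below_def)

lemma locally_finite_riesz_measure: "locally_finite_borel riesz_measure"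
  unfolding locally_finite_borel_def
proof (intro conjI allI impI)
  fix K :: "'a set" assume K: "compact K"
  obtain f where f: "\<And>x. 0 \<le> cc_apply f x" "\<And>x. x \<in> K \<Longrightarrow> cc_apply f x = 1"
    using bump_function[OF K open_UNIV] by auto
  have "outer_content K \<le> ennreal (\<phi> f)"
    using f by (intro compact_content_le[OF K]) auto
  then show "emeasure riesz_measure K < \<infinity>"
    using K by (simp add: emeasure_riesz_measure borel_compact le_less_trans)
qed simp

text \<open>Cut \<open>f\<close> into \<open>n\<close> horizontal slices of height \<open>1 / n\<close>. With \<open>E k = {f \<ge> k / n} \<inter> supp f\<close>, the
  \<open>k\<close>-th slice, rescaled to height \<open>1\<close>, lies between the indicators of \<open>E (k + 1)\<close> and
  \<open>E k\<close>. Hence its integral and its value under \<open>\<phi>\<close> both lie between the measures of these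
  sets. These bounds telescope, so the total error is at most \<open>1 / n\<close> times the measure of the support.\<close>

lemma riesz_unit_interval:
  assumes f: "\<And>x. 0 \<le> cc_apply f x" "\<And>x. cc_apply f x \<le> 1"
  shows "\<phi> f = (\<integral>x. cc_apply f x \<partial>riesz_measure)"
proof -
  let ?R = "riesz_measure"
  have lf: "locally_finite_borel ?R"
    by (rule locally_finite_riesz_measure)
  let ?S = "measure ?R (cc_support f)"
  have approx: "\<bar>\<phi> f - (\<integral>x. cc_apply f x \<partial>?R)\<bar> \<le> ?S / real (Suc m)" for m
  proof -
    define n where "n = Suc m"
    have n: "0 < real n" "n \<noteq> 0"
      by (auto simp: n_def)
    \<comment> \<open>The part of \<open>n t\<close> between the levels \<open>k\<close> and \<open>k + 1\<close>.\<close>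
    define slice where "slice k t = min (max (real n * t - real k) 0) 1" for k :: nat and t :: real
    define E where "E k = {x. real k \<le> real n * cc_apply f x} \<inter> cc_support f" for k
    have "\<exists>g. cc_apply g = (\<lambda>x. slice k (cc_apply f x)) \<and> cc_support g \<subseteq> cc_support f" for k
      unfolding slice_def by (rule cc_compose) (auto intro!: continuous_intros)
    then obtain h where h: "\<And>k. cc_apply (h k) = (\<lambda>x. slice k (cc_apply f x))" "\<And>k. cc_support (h k) \<subseteq> cc_support f"
      by metis
    have E_compact: "compact (E k)" for k
      unfolding E_def Int_commute[of _ "cc_support f"]
      by (intro compact_Int_closed compact_cc_support closed_Collect_le continuous_intros continuous_cc_apply)
    have E_sets: "E k \<in> sets borel" for k
      using E_compact by (rule borel_compact)
    have E_fin: "emeasure ?R (E k) \<noteq> top" for k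
      using emeasure_compact_finite[OF lf E_compact] by (auto simp: less_top)
    have h01: "0 \<le> cc_apply (h k) x" "cc_apply (h k) x \<le> 1" for k x
      by (auto simp: h slice_def)
    have h1: "1 \<le> cc_apply (h k) x" if "x \<in> E (Suc k)" for k x
      using that by (auto simp: h slice_def E_def)
    have h0: "cc_apply (h k) x = 0" if "x \<notin> E k" for k x
      using that cc_apply_eq_0[of x f] by (auto simp: h slice_def E_def)
    have supp: "cc_support (h k) \<subseteq> E k" for k
      using h0 compact_imp_closed[OF E_compact] by (rule cc_support_subset[rotated])
    have upper: "\<phi> (h k) \<le> measure ?R (E k)" for k
      using le_content[OF h01 supp] emeasure_riesz_measure[OF E_sets] emeasure_eq_ennreal_measure[OF E_fin]
      by (metis ennreal_le_iff measure_nonneg)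
    have lower: "measure ?R (E (Suc k)) \<le> \<phi> (h k)" for k
    proof -
      have "0 \<le> \<phi> (h k)"
        using h01 by (intro nonneg) auto
      then show ?thesis
        using compact_content_le[OF E_compact h01(1) h1, of "Suc k" k] emeasure_riesz_measure[OF E_sets]
          emeasure_eq_ennreal_measure[OF E_fin]
        by (metis ennreal_le_iff)
    qed
    have int_ind: "integrable ?R (indicator (E k) :: _ \<Rightarrow> real)" for k
      using E_sets E_fin[of k] by (intro integrable_real_indicator) (auto simp: less_top)
    have upper': "(\<integral>x. cc_apply (h k) x \<partial>?R) \<le> measure ?R (E k)" for k
    proof -
      have "(\<integral>x. cc_apply (h k) x \<partial>?R) \<le> (\<integral>x. indicator (E k) x \<partial>?R)"
        using h01 h0 by (intro integral_mono integrable_cc_apply lf int_ind) (auto simp: indicator_def)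
      then show ?thesis
        by (simp add: space_lf[OF lf])
    qed
    have lower': "measure ?R (E (Suc k)) \<le> (\<integral>x. cc_apply (h k) x \<partial>?R)" for k
    proof -
      have "(\<integral>x. indicator (E (Suc k)) x \<partial>?R) \<le> (\<integral>x. cc_apply (h k) x \<partial>?R)"
        using h01 h1 by (intro integral_mono integrable_cc_apply lf int_ind) (auto simp: indicator_def)
      then show ?thesis
        by (simp add: space_lf[OF lf])
    qed
    have slices: "(\<Sum>k<N. slice k t) = min (real n * t) (real N)" if "0 \<le> t" for t N
    proof -
      have "0 \<le> real n * t"
        using that by simp
      then show ?thesis
        by (induction N) (auto simp: slice_def min_def max_def)
    qed
    have "f = (1 / real n) *\<^sub>R (\<Sum>k<n. h k)"
    proof (rule ccfun_eqI)
      fix x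
      have "real n * cc_apply f x \<le> real n"
        using f(2)[of x] n by (simp add: mult_left_le)
      then show "cc_apply f x = cc_apply ((1 / real n) *\<^sub>R (\<Sum>k<n. h k)) x"
        using slices[OF f(1)[of x], of n] n by (simp add: scaleR_ccfun.rep_eq cc_apply_sum h)
    qed
    then have phi: "real n * \<phi> f = (\<Sum>k<n. \<phi> (h k))"
      using n linear_sum[OF linear, of h "{..<n}"] linear_scale[OF linear, of "1 / real n" "\<Sum>k<n. h k"] by simp
    have "real n * (\<integral>x. cc_apply f x \<partial>?R) = (\<integral>x. (\<Sum>k<n. cc_apply (h k) x) \<partial>?R)"
    proof -
      have "(\<Sum>k<n. cc_apply (h k) x) = real n * cc_apply f x" for x
        using slices[OF f(1)[of x], of n] f(2)[of x] n by (simp add: h mult_left_le)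
      then show ?thesis by simp
    qed
    also have "\<dots> = (\<Sum>k<n. \<integral>x. cc_apply (h k) x \<partial>?R)"
      by (intro Bochner_Integration.integral_sum integrable_cc_apply lf)
    finally have int: "real n * (\<integral>x. cc_apply f x \<partial>?R) = (\<Sum>k<n. \<integral>x. cc_apply (h k) x \<partial>?R)" .
    have "\<bar>real n * \<phi> f - real n * (\<integral>x. cc_apply f x \<partial>?R)\<bar> = \<bar>\<Sum>k<n. \<phi> (h k) - (\<integral>x. cc_apply (h k) x \<partial>?R)\<bar>"
      by (simp add: phi int sum_subtractf)
    also have "\<dots> \<le> (\<Sum>k<n. measure ?R (E k) - measure ?R (E (Suc k)))"
    proof (rule order_trans[OF sum_abs], rule sum_mono)
      fix k
      show "\<bar>\<phi> (h k) - (\<integral>x. cc_apply (h k) x \<partial>?R)\<bar> \<le> measure ?R (E k) - measure ?R (E (Suc k))"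
        using upper[of k] lower[of k] upper'[of k] lower'[of k] by linarith
    qed
    also have "\<dots> = measure ?R (E 0) - measure ?R (E n)"
      by (rule sum_lessThan_telescope')
    also have "\<dots> \<le> ?S"
    proof -
      have "E 0 = cc_support f"
        using f n by (auto simp: E_def)
      then show ?thesis by simp
    qed
    finally have "real n * \<bar>\<phi> f - (\<integral>x. cc_apply f x \<partial>?R)\<bar> \<le> ?S"
      using n by (simp add: abs_mult flip: right_diff_distrib)
    then show ?thesis
      using n by (simp add: n_def field_simps)
  qed
  have "(\<lambda>m. ?S / real (Suc m)) \<longlonglongrightarrow> 0"
    by (rule LIMSEQ_Suc[OF lim_const_over_n])
  then have "\<bar>\<phi> f - (\<integral>x. cc_apply f x \<partial>?R)\<bar> \<le> 0"
    using approx by (intro LIMSEQ_le_const[of _ 0]) auto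
  then show ?thesis
    by simp
qed

theorem riesz_representation: "\<phi> f = (\<integral>x. cc_apply f x \<partial>riesz_measure)"
proof -
  obtain B where B: "\<And>x. \<bar>cc_apply f x\<bar> \<le> B" "0 \<le> B"
    using cc_bounded by blast
  define C where "C = B + 1"
  have C: "\<And>x. \<bar>cc_apply f x\<bar> \<le> C" "0 < C"
    using B by (auto simp: C_def intro: order_trans[OF B(1)])
  have cont: "continuous_on UNIV (\<lambda>t. max (c * t / C) 0)" for c
    using C(2) by (intro continuous_intros) auto
  obtain p where p: "cc_apply p = (\<lambda>x. max (cc_apply f x / C) 0)"
    using cc_compose[OF cont, of "1" f] by auto
  obtain q where q: "cc_apply q = (\<lambda>x. max (- cc_apply f x / C) 0)"
    using cc_compose[OF cont, of "- 1" f] by auto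
  have b: "\<bar>cc_apply f x / C\<bar> \<le> 1" for x
    using C(1)[of x] C(2) by simp
  have pq: "f = C *\<^sub>R (p - q)"
    using C(2) by (intro ccfun_eqI) (auto simp: p q scaleR_ccfun.rep_eq minus_ccfun.rep_eq max_def field_simps)
  have "cc_apply p x \<le> 1 \<and> cc_apply q x \<le> 1" for x
    using b[of x] unfolding p q abs_le_iff by simp
  then have "\<phi> p = (\<integral>x. cc_apply p x \<partial>riesz_measure)" "\<phi> q = (\<integral>x. cc_apply q x \<partial>riesz_measure)"
    by (intro riesz_unit_interval; simp add: p q)+
  moreover have "(\<integral>x. cc_apply f x \<partial>riesz_measure) =
      C * ((\<integral>x. cc_apply p x \<partial>riesz_measure) - (\<integral>x. cc_apply q x \<partial>riesz_measure))"
    by (subst pq) (simp add: scaleR_ccfun.rep_eq minus_ccfun.rep_eq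
        Bochner_Integration.integral_diff integrable_cc_apply[OF locally_finite_riesz_measure])
  moreover have "\<phi> f = C * (\<phi> p - \<phi> q)"
    by (subst pq) (simp add: linear_scale[OF linear] linear_diff[OF linear])
  ultimately show ?thesis by simp
qed

end

section \<open>Locally finite measures and their functionals\<close>

definition functional_of :: "'a::{t2_space,second_countable_topology} measure \<Rightarrow> 'a ccfun \<Rightarrow> real" where
  "functional_of P f = (\<integral>x. cc_apply f x \<partial>P)"

lemma linear_functional_of:
  assumes "locally_finite_borel P"
  shows "linear (functional_of P)"
proof (rule linearI)
  show "functional_of P (f + g) = functional_of P f + functional_of P g" for f g
    by (simp add: functional_of_def plus_ccfun.rep_eq integrable_cc_apply[OF assms])
  show "functional_of P (c *\<^sub>R f) = c *\<^sub>R functional_of P f" for c f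
    by (simp add: functional_of_def scaleR_ccfun.rep_eq)
qed

lemma functional_of_nonneg: "(\<And>x. 0 \<le> cc_apply f x) \<Longrightarrow> 0 \<le> functional_of P f"
  by (simp add: functional_of_def)

lemma functional_of_eq_nn_integral:
  assumes "locally_finite_borel P" "\<And>x. 0 \<le> cc_apply f x"
  shows "ennreal (functional_of P f) = (\<integral>\<^sup>+x. ennreal (cc_apply f x) \<partial>P)"
  unfolding functional_of_def using assms by (intro nn_integral_eq_integral[symmetric] integrable_cc_apply) auto

lemma emeasure_compact_le_functional:
  assumes "locally_finite_borel P" "compact K" "\<And>x. 0 \<le> cc_apply f x" "\<And>x. x \<in> K \<Longrightarrow> 1 \<le> cc_apply f x"
  shows "emeasure P K \<le> ennreal (functional_of P f)"
proof -
  have "emeasure P K = (\<integral>\<^sup>+x. indicator K x \<partial>P)"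
    using assms(1,2) by (simp add: sets_lf borel_compact)
  also have "\<dots> \<le> (\<integral>\<^sup>+x. ennreal (cc_apply f x) \<partial>P)"
    using assms(3,4) by (intro nn_integral_mono) (auto simp: indicator_def)
  finally show ?thesis
    by (simp add: functional_of_eq_nn_integral assms)
qed

lemma functional_le_emeasure:
  assumes "locally_finite_borel P" "E \<in> sets borel" "\<And>x. 0 \<le> cc_apply f x" "\<And>x. cc_apply f x \<le> 1" "cc_support f \<subseteq> E"
  shows "ennreal (functional_of P f) \<le> emeasure P E"
proof -
  have "(\<integral>\<^sup>+x. ennreal (cc_apply f x) \<partial>P) \<le> (\<integral>\<^sup>+x. indicator E x \<partial>P)"
  proof (rule nn_integral_mono)
    fix x
    show "ennreal (cc_apply f x) \<le> indicator E x"
      using assms(3)[of x] assms(4)[of x] assms(5) cc_apply_eq_0[of x f] by (cases "x \<in> E") auto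
  qed
  also have "\<dots> = emeasure P E"
    using assms(1,2) by (simp add: sets_lf)
  finally show ?thesis
    by (simp add: functional_of_eq_nn_integral assms)
qed

context lc_space
begin

text \<open>The sets are finite unions of supports of bump functions. A compact subset of \<open>U\<close> is covered by
  finitely many of the sets on which one of these functions is positive.\<close>

lemma open_absorbing_exhaustion:
  assumes U: "open (U :: 'a set)"
  shows "\<exists>K :: nat \<Rightarrow> 'a set. (\<forall>n. compact (K n)) \<and> incseq K \<and> (\<Union>n. K n) = U \<and>
    (\<forall>C. compact C \<longrightarrow> C \<subseteq> U \<longrightarrow> (\<exists>n. C \<subseteq> K n))"
proof -
  obtain g :: "nat \<Rightarrow> 'a ccfun" where g:
    "\<And>U x. open U \<Longrightarrow> x \<in> U \<Longrightarrow> \<exists>i. cc_apply (g i) x = 1 \<and> cc_support (g i) \<subseteq> U"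
    using countable_bump_family by metis
  define K where "K n = (\<Union>i\<in>{i\<in>{..<n}. cc_support (g i) \<subseteq> U}. cc_support (g i))" for n
  have absorb: "\<exists>n. C \<subseteq> K n" if C: "compact C" "C \<subseteq> U" for C
  proof -
    have "\<exists>i. cc_apply (g i) x = 1 \<and> cc_support (g i) \<subseteq> U" if "x \<in> C" for x
      by (rule g[OF U subsetD[OF C(2) that]])
    then obtain i where i: "\<And>x. x \<in> C \<Longrightarrow> cc_apply (g (i x)) x = 1 \<and> cc_support (g (i x)) \<subseteq> U"
      by metis
    have op: "open {y. 0 < cc_apply (g j) y}" for j
      by (intro open_Collect_less continuous_on_const continuous_cc_apply)
    have cover: "C \<subseteq> (\<Union>x\<in>C. {y. 0 < cc_apply (g (i x)) y})"
    proof
      fix x assume "x \<in> C"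
      then show "x \<in> (\<Union>x\<in>C. {y. 0 < cc_apply (g (i x)) y})"
        using i[of x] by (intro UN_I[of x]) simp_all
    qed
    obtain E where E: "E \<subseteq> C" "finite E" "C \<subseteq> (\<Union>x\<in>E. {y. 0 < cc_apply (g (i x)) y})"
      using compactE_image[OF C(1) op cover] by metis
    obtain n where n: "i ` E \<subseteq> {..<n}"
      using E(2) finite_nat_iff_bounded by blast
    have "C \<subseteq> K n"
    proof
      fix y assume "y \<in> C"
      then obtain x where x: "x \<in> E" "0 < cc_apply (g (i x)) y"
        using E(3) by blast
      have "y \<in> cc_support (g (i x))"
        using cc_apply_eq_0[of y "g (i x)"] x(2) by (metis less_irrefl)
      then show "y \<in> K n"
        unfolding K_def using i[OF subsetD[OF E(1) x(1)]] x(1) n by (intro UN_I[of "i x"]) auto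
    qed
    then show ?thesis ..
  qed
  have K: "compact (K n)" "K n \<subseteq> U" for n
    unfolding K_def by (auto intro!: compact_UN compact_cc_support)
  have "U \<subseteq> (\<Union>n. K n)"
  proof
    fix x assume "x \<in> U"
    then show "x \<in> (\<Union>n. K n)"
      using absorb[of "{x}"] by auto
  qed
  then have "(\<Union>n. K n) = U"
    using K(2) by blast
  moreover have "incseq K"
    unfolding K_def by (intro monoI UN_mono) auto
  ultimately show ?thesis
    using K(1) absorb by blast
qed

lemma open_compact_exhaustion:
  assumes "open (U :: 'a set)"
  shows "\<exists>K :: nat \<Rightarrow> 'a set. (\<forall>n. compact (K n)) \<and> incseq K \<and> (\<Union>n. K n) = U"
  using open_absorbing_exhaustion[OF assms] by (elim exE conjE) (intro exI conjI)

lemma sigma_finite_lf: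
  assumes P: "locally_finite_borel (P :: 'a measure)"
  shows "sigma_finite_measure P"
proof -
  obtain K :: "nat \<Rightarrow> 'a set" where K: "\<And>n. compact (K n)" "(\<Union>n. K n) = UNIV"
    using open_compact_exhaustion[OF open_UNIV] by blast
  show ?thesis
    using K emeasure_compact_finite[OF P K(1)]
    by (intro sigma_finite_measure.intro exI[of _ "range K"])
       (auto simp: sets_lf[OF P] space_lf[OF P] borel_compact less_top)
qed

lemma emeasure_open_le:
  assumes P: "locally_finite_borel (P :: 'a measure)" and Q: "locally_finite_borel Q"
    and le: "\<And>f. (\<And>x. 0 \<le> cc_apply f x) \<Longrightarrow> functional_of P f \<le> functional_of Q f" and U: "open U"
  shows "emeasure P U \<le> emeasure Q U"
proof -
  obtain K :: "nat \<Rightarrow> 'a set" where K: "\<And>n. compact (K n)" "incseq K" "(\<Union>n. K n) = U"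
    using open_compact_exhaustion[OF U] by blast
  have "emeasure P (K n) \<le> emeasure Q U" for n
  proof -
    obtain f where f: "\<And>x. 0 \<le> cc_apply f x" "\<And>x. cc_apply f x \<le> 1" "\<And>x. x \<in> K n \<Longrightarrow> cc_apply f x = 1" "cc_support f \<subseteq> U"
      using bump_function[OF K(1) U, of n] K(3) by blast
    have "emeasure P (K n) \<le> ennreal (functional_of P f)"
      using f by (intro emeasure_compact_le_functional P K) auto
    also have "\<dots> \<le> ennreal (functional_of Q f)"
      using le f by (intro ennreal_leI) auto
    also have "\<dots> \<le> emeasure Q U"
      using f U by (intro functional_le_emeasure Q) auto
    finally show ?thesis .
  qed
  then have "(SUP n. emeasure P (K n)) \<le> emeasure Q U"
    by (rule SUP_least)
  moreover have "range K \<subseteq> sets P"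
    using K(1) by (auto simp: sets_lf[OF P] borel_compact)
  ultimately show ?thesis
    using SUP_emeasure_incseq[of K P] K(2,3) by simp
qed

text \<open>The functional determines the measure on open sets. These form an intersection-stable generator, and by
  the Lindelof property countably many of finite measure cover the space.\<close>

lemma measure_eqI_functional:
  assumes P: "locally_finite_borel (P :: 'a measure)" and Q: "locally_finite_borel Q"
    and eq: "functional_of P = functional_of Q"
  shows "P = Q"
proof -
  have open_eq: "emeasure P U = emeasure Q U" if "open U" for U
    using emeasure_open_le[OF P Q _ that] emeasure_open_le[OF Q P _ that] eq by (auto intro: antisym)
  have "\<exists>V. open V \<and> x \<in> V \<and> emeasure P V \<noteq> \<infinity>" for x
  proof -
    obtain V L where VL: "open V" "compact L" "x \<in> V" "V \<subseteq> L"
      using compact_neighbourhood_between[of "{x}" UNIV] by auto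
    have "emeasure P V \<le> emeasure P L"
      using VL by (intro emeasure_mono) (auto simp: sets_lf[OF P] borel_compact)
    then show ?thesis
      using VL emeasure_compact_finite[OF P VL(2)] by (intro exI[of _ V]) auto
  qed
  then obtain V where V: "\<And>x. open (V x)" "\<And>x. x \<in> V x" "\<And>x. emeasure P (V x) \<noteq> \<infinity>"
    by metis
  obtain \<F> where \<F>: "\<F> \<subseteq> range V" "countable \<F>" "\<Union>\<F> = \<Union>(range V)"
    using Lindelof[of "range V"] V(1) by auto
  show ?thesis
  proof (rule measure_eqI_generator_eq_countable[where E = "{U. open U}" and \<Omega> = UNIV and A = \<F>])
    show "Int_stable {U :: 'a set. open U}"
      by (auto simp: Int_stable_def)
    show "\<Union>\<F> = UNIV"
      using \<F>(3) V(2) by auto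
  qed (use open_eq \<F> V in \<open>auto simp: sets_lf[OF P] sets_lf[OF Q] sets_borel\<close>)
qed

lemma positive_functional_functional_of:
  assumes "locally_finite_borel (P :: 'a measure)"
  shows "positive_functional (functional_of P)"
  unfolding positive_functional_def positive_functional_axioms_def
  using linear_functional_of[OF assms] functional_of_nonneg lc_space_axioms by blast

text \<open>\<open>P\<close> is the Riesz measure of its own functional, which is outer regular by construction.\<close>

lemma outer_regular_lf:
  assumes P: "locally_finite_borel (P :: 'a measure)" and E: "E \<in> sets borel"
  shows "emeasure P E = (INF U\<in>{U. open U \<and> E \<subseteq> U}. emeasure P U)"
proof -
  interpret positive_functional "functional_of P"
    by (rule positive_functional_functional_of[OF P])
  have "P = riesz_measure"
    using riesz_representation by (intro measure_eqI_functional P locally_finite_riesz_measure) (auto simp: functional_of_def fun_eq_iff)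
  then have *: "emeasure P B = outer_content B" if "B \<in> sets borel" for B
    using emeasure_riesz_measure[OF that] by simp
  show ?thesis
    unfolding *[OF E] outer_content_def by (intro INF_cong) (auto simp: * outer_content_open)
qed

text \<open>Complements of open sets that approximate \<open>- E\<close> from outside approximate \<open>E\<close> from inside; cutting
  them down to the sets of an exhaustion makes them compact.\<close>

lemma inner_regular_finite:
  assumes P: "locally_finite_borel (P :: 'a measure)" and fin: "emeasure P UNIV \<noteq> \<infinity>" and E: "E \<in> sets borel"
  shows "\<exists>\<K>. countable \<K> \<and> (\<forall>K\<in>\<K>. compact K \<and> K \<subseteq> E) \<and> emeasure P (E - \<Union>\<K>) = 0"
proof -
  have fin': "emeasure P B \<noteq> \<infinity>" for B
    using emeasure_space[of P B] fin space_lf[OF P] by (auto simp: top_unique)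
  have "\<exists>U. open U \<and> - E \<subseteq> U \<and> emeasure P U \<le> emeasure P (- E) + ennreal (1 / real (Suc n))" for n
  proof -
    have "emeasure P (- E) < emeasure P (- E) + ennreal (1 / real (Suc n))"
      using fin'[of "- E"] by (simp add: ennreal_add_left_cancel_less[of _ 0, simplified] less_top)
    moreover have "- E \<in> sets borel"
      using E by auto
    ultimately show ?thesis
      unfolding outer_regular_lf[OF P \<open>- E \<in> sets borel\<close>] INF_less_iff by (auto intro: less_imp_le)
  qed
  then obtain U where U: "\<And>n. open (U n)" "\<And>n. - E \<subseteq> U n"
      "\<And>n. emeasure P (U n) \<le> emeasure P (- E) + ennreal (1 / real (Suc n))"
    by metis
  obtain L :: "nat \<Rightarrow> 'a set" where L: "\<And>n. compact (L n)" "(\<Union>n. L n) = UNIV"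
    using open_compact_exhaustion[OF open_UNIV] by blast
  define \<K> where "\<K> = range (\<lambda>p. L (fst p) \<inter> - U (snd p))"
  have sub: "E - \<Union>\<K> \<subseteq> U n - (- E)" for n
  proof
    fix x assume x: "x \<in> E - \<Union>\<K>"
    obtain m where "x \<in> L m"
      using L(2) by blast
    moreover have "L m \<inter> - U n \<in> \<K>"
      unfolding \<K>_def by (rule image_eqI[of _ _ "(m, n)"]) auto
    ultimately show "x \<in> U n - (- E)"
      using x by blast
  qed
  have Kc: "countable \<K>"
    by (simp add: \<K>_def)
  have Kc': "compact K \<and> K \<subseteq> E" if KK: "K \<in> \<K>" for K
  proof -
    obtain p where "K = L (fst p) \<inter> - U (snd p)"
      using KK unfolding \<K>_def by blast
    then obtain m n where K: "K = L m \<inter> - U n"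
      by blast
    have "compact (L m \<inter> - U n)"
      using L(1) U(1) by (intro compact_Int_closed) (auto simp: closed_Compl)
    moreover have "- U n \<subseteq> E"
      using U(2)[of n] by auto
    ultimately show ?thesis
      unfolding K by auto
  qed
  have le: "emeasure P (E - \<Union>\<K>) \<le> ennreal (1 / real (Suc n))" for n
  proof -
    have UE: "U n \<in> sets P" "- E \<in> sets P"
      using U E by (auto simp: sets_lf[OF P])
    then have "emeasure P (E - \<Union>\<K>) \<le> emeasure P (U n - (- E))"
      using sub by (intro emeasure_mono sets.Diff)
    also have "\<dots> = emeasure P (U n) - emeasure P (- E)"
      using UE U fin' by (intro emeasure_Diff) auto
    also have "\<dots> \<le> ennreal (1 / real (Suc n))"
      using U(3)[of n] fin'[of "- E"] by (simp add: ennreal_minus_le_iff)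
    finally show ?thesis .
  qed
  have "(\<lambda>n. ennreal (1 / real (Suc n))) \<longlonglongrightarrow> ennreal 0"
    by (intro tendsto_ennrealI LIMSEQ_Suc lim_1_over_n)
  then have "emeasure P (E - \<Union>\<K>) \<le> 0"
    using le by (intro LIMSEQ_le_const[of _ 0]) auto
  then show ?thesis
    using Kc Kc' by (intro exI[of _ \<K>]) auto
qed

lemma inner_regular_lf:
  assumes P: "locally_finite_borel (P :: 'a measure)" and E: "E \<in> sets borel"
  shows "\<exists>K :: nat \<Rightarrow> 'a set. (\<forall>n. compact (K n) \<and> K n \<subseteq> E) \<and> incseq K \<and> emeasure P (E - (\<Union>n. K n)) = 0"
proof -
  obtain L :: "nat \<Rightarrow> 'a set" where L: "\<And>n. compact (L n)" "(\<Union>n. L n) = UNIV"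
    using open_compact_exhaustion[OF open_UNIV] by blast
  have Lm: "L m \<in> sets P" for m
    using L by (simp add: sets_lf[OF P] borel_compact)
  have "\<exists>\<K>. countable \<K> \<and> (\<forall>K\<in>\<K>. compact K \<and> K \<subseteq> E) \<and> emeasure P ((E - \<Union>\<K>) \<inter> L m) = 0" for m
  proof -
    let ?P = "density P (indicator (L m))"
    have e: "emeasure ?P B = emeasure P (B \<inter> L m)" if "B \<in> sets borel" for B
      using that Lm[of m] sets_lf[OF P]
      by (subst emeasure_density) (auto simp: Int_commute simp flip: indicator_inter_arith)
    have lf: "locally_finite_borel ?P"
      unfolding locally_finite_borel_def
    proof (intro conjI allI impI)
      fix K :: "'a set" assume K: "compact K"
      have "emeasure P (K \<inter> L m) \<le> emeasure P K"
        using K by (intro emeasure_mono) (auto simp: sets_lf[OF P] borel_compact)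
      then show "emeasure ?P K < \<infinity>"
        using emeasure_compact_finite[OF P K] K by (simp add: e borel_compact le_less_trans)
    qed (simp add: sets_lf[OF P])
    have fin: "emeasure ?P UNIV \<noteq> \<infinity>"
      using emeasure_compact_finite[OF P L(1)[of m]] by (simp add: e less_top)
    obtain \<K> where \<K>: "countable \<K>" "\<And>K. K \<in> \<K> \<Longrightarrow> compact K \<and> K \<subseteq> E" "emeasure ?P (E - \<Union>\<K>) = 0"
      using inner_regular_finite[OF lf fin E] by metis
    have "\<Union>\<K> \<in> sets borel"
      using \<K> by (intro sets.countable_Union) (auto simp: borel_compact)
    then show ?thesis
      using \<K> E e[of "E - \<Union>\<K>"] by (intro exI[of _ \<K>]) auto
  qed
  then obtain \<K> where \<K>: "\<And>m. countable (\<K> m)" "\<And>m K. K \<in> \<K> m \<Longrightarrow> compact K \<and> K \<subseteq> E"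
      "\<And>m::nat. emeasure P ((E - \<Union>(\<K> m)) \<inter> L m) = 0"
    by metis
  define \<L> where "\<L> = insert {} (\<Union>m. \<K> m)"
  have \<L>: "countable \<L>" "\<L> \<noteq> {}" "\<And>K. K \<in> \<L> \<Longrightarrow> compact K \<and> K \<subseteq> E"
    using \<K> by (auto simp: \<L>_def)
  have U: "(\<Union>n. from_nat_into \<L> n) = \<Union>\<L>"
    using \<L> by (metis UN_from_nat_into range_from_nat_into)
  define K where "K n = (\<Union>i<n. from_nat_into \<L> i)" for n
  have UK: "(\<Union>n. K n) = \<Union>\<L>"
    unfolding K_def U[symmetric] by blast
  have Kc: "compact (K n)" "K n \<subseteq> E" for n
    unfolding K_def using \<L>(3)[OF from_nat_into[OF \<L>(2)]] by (auto intro!: compact_UN)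
  have bo: "\<Union>(\<K> m) \<in> sets borel" "\<Union>\<L> \<in> sets borel" for m
    using \<K> \<L> by (auto intro!: sets.countable_Union simp: borel_compact)
  have "emeasure P (E - \<Union>\<L>) \<le> emeasure P (\<Union>m. (E - \<Union>(\<K> m)) \<inter> L m)"
  proof (rule emeasure_mono)
    show "E - \<Union>\<L> \<subseteq> (\<Union>m. (E - \<Union>(\<K> m)) \<inter> L m)"
    proof
      fix x assume x: "x \<in> E - \<Union>\<L>"
      obtain m where "x \<in> L m"
        using L(2) by blast
      with x show "x \<in> (\<Union>m. (E - \<Union>(\<K> m)) \<inter> L m)"
        unfolding \<L>_def by blast
    qed
  qed (use E bo Lm in \<open>auto simp: sets_lf[OF P]\<close>)
  also have "\<dots> = 0"
    using \<K>(3) E bo Lm by (intro emeasure_UN_eq_0) (auto simp: sets_lf[OF P])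
  finally have "emeasure P (E - (\<Union>n. K n)) = 0"
    by (simp add: UK)
  moreover have "incseq K"
    unfolding K_def by (intro monoI UN_mono) auto
  ultimately show ?thesis
    using Kc by blast
qed

end

section \<open>Radon measures and their Hahn--Jordan decompositions\<close>

lemma cc_apply_le_sup_dist: "\<bar>cc_apply f x\<bar> \<le> sup_dist f 0"
proof -
  have "\<bar>cc_apply f x - cc_apply 0 x\<bar> \<le> sup_dist f 0"
    unfolding sup_dist_def by (rule cSUP_upper[OF UNIV_I bdd_above_cc_diff])
  then show ?thesis
    by (simp add: zero_ccfun.rep_eq)
qed

lemma sup_dist_diff: "sup_dist (f - g) 0 = sup_dist f g"
  by (simp add: sup_dist_def minus_ccfun.rep_eq zero_ccfun.rep_eq)

lemma ccfun_on_iff: "f \<in> ccfun_on K \<longleftrightarrow> cc_support f \<subseteq> K"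
  by (simp add: ccfun_on_def cc_support_def)

lemma ccfun_on_diff:
  fixes K :: "'a::t2_space set"
  assumes "compact K" "f \<in> ccfun_on K" "g \<in> ccfun_on K"
  shows "f - g \<in> ccfun_on K"
  unfolding ccfun_on_iff
proof (rule cc_support_subset)
  show "closed K"
    using assms(1) by (rule compact_imp_closed)
  show "cc_apply (f - g) x = 0" if "x \<notin> K" for x
  proof -
    have "x \<notin> cc_support f" "x \<notin> cc_support g"
      using that assms(2,3) by (auto simp: ccfun_on_iff)
    then show ?thesis
      by (simp add: cc_apply_eq_0 minus_ccfun.rep_eq)
  qed
qed

text \<open>The weakest topology that makes a linear functional \<open>\<phi>\<close> continuous is locally convex. If
  \<open>\<phi>\<close> is bounded on each space of functions supported in a fixed compact set, this topology is one of
  those whose supremum is the inductive limit topology, so \<open>\<phi>\<close> is continuous for the latter.\<close>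

lemma locally_convex_pullback:
  assumes \<phi>: "linear \<phi>"
  shows "locally_convex_topology (pullback_topology UNIV \<phi> euclideanreal)"
  unfolding locally_convex_topology_def
proof (intro conjI allI impI)
  let ?T = "pullback_topology UNIV \<phi> euclideanreal"
  have c: "continuous_map ?T euclideanreal \<phi>"
    using continuous_map_pullback[of euclideanreal euclideanreal id UNIV \<phi>] by simp
  show "topspace ?T = UNIV"
    by (simp add: topspace_pullback_topology)
  show "continuous_map (prod_topology ?T ?T) ?T (\<lambda>(u, v). u + v)"
  proof (rule continuous_map_pullback')
    have "continuous_map (prod_topology ?T ?T) euclideanreal (\<lambda>p. \<phi> (fst p) + \<phi> (snd p))"
      by (intro continuous_map_add continuous_map_compose[OF continuous_map_fst c, unfolded comp_def]
          continuous_map_compose[OF continuous_map_snd c, unfolded comp_def])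
    then show "continuous_map (prod_topology ?T ?T) euclideanreal (\<phi> \<circ> (\<lambda>(u, v). u + v))"
      by (simp add: comp_def case_prod_unfold linear_add[OF \<phi>])
  qed simp
  show "continuous_map (prod_topology euclideanreal ?T) ?T (\<lambda>(c, v). c *\<^sub>R v)"
  proof (rule continuous_map_pullback')
    have "continuous_map (prod_topology euclideanreal ?T) euclideanreal (\<lambda>p. fst p * \<phi> (snd p))"
      by (intro continuous_map_real_mult continuous_map_fst
          continuous_map_compose[OF continuous_map_snd c, unfolded comp_def])
    then show "continuous_map (prod_topology euclideanreal ?T) euclideanreal (\<phi> \<circ> (\<lambda>(c, v). c *\<^sub>R v))"
      by (simp add: comp_def case_prod_unfold linear_scale[OF \<phi>])
  qed simp
  fix U assume "openin ?T U \<and> 0 \<in> U"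
  then obtain W where W: "open W" "U = \<phi> -` W" "0 \<in> U"
    by (auto simp: openin_pullback_topology)
  then have "0 \<in> W"
    by (simp add: linear_0[OF \<phi>])
  then obtain e where e: "0 < e" "ball 0 e \<subseteq> W"
    using W(1) openE by blast
  have "convex (\<phi> -` ball 0 e)"
    using convex_linear_vimage[OF \<phi>] by simp
  then show "\<exists>V. openin ?T V \<and> 0 \<in> V \<and> convex V \<and> V \<subseteq> U"
    using e W(2) by (intro exI[of _ "\<phi> -` ball 0 e"])
      (auto simp: openin_pullback_topology linear_0[OF \<phi>] intro!: exI[of _ "ball 0 e"])
qed

lemma radon_measuresI:
  fixes \<phi> :: "'a::t2_space ccfun \<Rightarrow> real"
  assumes \<phi>: "linear \<phi>"
    and bound: "\<And>K. compact K \<Longrightarrow> \<exists>C. \<forall>f\<in>ccfun_on K. \<bar>\<phi> f\<bar> \<le> C * sup_dist f 0"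
  shows "\<phi> \<in> radon_measures"
proof -
  let ?T = "pullback_topology UNIV \<phi> euclideanreal"
  have incl: "continuous_map (Metric_space.mtopology (ccfun_on K) sup_dist) ?T id" if K: "compact K" for K
  proof (rule continuous_map_pullback')
    interpret Metric_space "ccfun_on K" sup_dist
      by (rule Metric_space_sup_dist)
    obtain C where C: "\<And>f. f \<in> ccfun_on K \<Longrightarrow> \<bar>\<phi> f\<bar> \<le> C * sup_dist f 0"
      using bound[OF K] by blast
    have "openin mtopology {f \<in> ccfun_on K. \<phi> f \<in> W}" if "open W" for W
      unfolding openin_mtopology
    proof (intro conjI allI impI)
      fix f assume f: "f \<in> {f \<in> ccfun_on K. \<phi> f \<in> W}"
      then obtain e where e: "0 < e" "ball (\<phi> f) e \<subseteq> W"
        using \<open>open W\<close> openE by blast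
      show "\<exists>r>0. mball f r \<subseteq> {f \<in> ccfun_on K. \<phi> f \<in> W}"
      proof (intro exI[of _ "e / (\<bar>C\<bar> + 1)"] conjI subsetI)
        show "0 < e / (\<bar>C\<bar> + 1)"
          using e by (simp add: add_nonneg_pos)
        fix g assume g: "g \<in> mball f (e / (\<bar>C\<bar> + 1))"
        have gK: "g \<in> ccfun_on K" and d: "sup_dist f g < e / (\<bar>C\<bar> + 1)"
          using g by auto
        have "\<bar>\<phi> f - \<phi> g\<bar> = \<bar>\<phi> (f - g)\<bar>"
          by (simp add: linear_diff[OF \<phi>])
        also have "\<dots> \<le> C * sup_dist f g"
          using C[of "f - g"] ccfun_on_diff[OF K _ gK, of f] f by (simp add: sup_dist_diff)
        also have "\<dots> \<le> (\<bar>C\<bar> + 1) * sup_dist f g"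
          by (intro mult_right_mono) auto
        also have "\<dots> < e"
          using d by (simp add: field_simps add_nonneg_pos)
        finally have "\<phi> g \<in> ball (\<phi> f) e"
          by (simp add: dist_real_def)
        then show "g \<in> {f \<in> ccfun_on K. \<phi> f \<in> W}"
          using e gK by blast
      qed
    qed auto
    then show "continuous_map mtopology euclideanreal (\<phi> \<circ> id)"
      by (auto simp: continuous_map_def Pi_iff)
  qed simp
  have "openin indlim_topology (\<phi> -` W)" if "open W" for W
    unfolding indlim_topology_def
    by (rule topology_generated_by_Basis, rule CollectI, rule exI[of _ ?T])
       (use incl locally_convex_pullback[OF \<phi>] that in \<open>auto simp: openin_pullback_topology\<close>)
  moreover have "topspace (indlim_topology :: 'a ccfun topology) = UNIV"
    using openin_subset[OF calculation[OF open_UNIV]] by auto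
  ultimately show ?thesis
    using \<phi> by (auto simp: radon_measures_def continuous_map_def vimage_def)
qed

lemma functional_of_bound:
  assumes P: "locally_finite_borel P" and K: "compact K" and f: "f \<in> ccfun_on K"
  shows "\<bar>functional_of P f\<bar> \<le> measure P K * sup_dist f 0"
proof -
  have KP: "K \<in> sets P"
    using K by (simp add: sets_lf[OF P] borel_compact)
  have "\<bar>functional_of P f\<bar> \<le> (\<integral>x. \<bar>cc_apply f x\<bar> \<partial>P)"
    unfolding functional_of_def by (rule integral_abs_bound)
  also have "\<dots> \<le> (\<integral>x. sup_dist f 0 * indicator K x \<partial>P)"
  proof (rule integral_mono)
    show "integrable P (\<lambda>x. \<bar>cc_apply f x\<bar>)"
      by (intro integrable_abs integrable_cc_apply P)
    show "integrable P (\<lambda>x. sup_dist f 0 * indicator K x)"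
      using KP emeasure_compact_finite[OF P K] by (intro integrable_mult_right integrable_real_indicator) auto
    show "\<bar>cc_apply f x\<bar> \<le> sup_dist f 0 * indicator K x" for x
      using f cc_apply_le_sup_dist[of f x] cc_apply_eq_0[of x f] by (cases "x \<in> K") (auto simp: ccfun_on_iff)
  qed
  also have "\<dots> = measure P K * sup_dist f 0"
    using KP by (simp add: space_lf[OF P])
  finally show ?thesis .
qed

lemma functional_of_diff_radon:
  assumes "locally_finite_borel P" "locally_finite_borel Q"
  shows "(\<lambda>f. functional_of P f - functional_of Q f) \<in> radon_measures"
proof (rule radon_measuresI)
  show "linear (\<lambda>f. functional_of P f - functional_of Q f)"
    using linear_functional_of assms by (intro linear_compose_sub)
  fix K :: "'a set" assume K: "compact K"
  have "\<bar>functional_of P f - functional_of Q f\<bar> \<le> (measure P K + measure Q K) * sup_dist f 0" if "f \<in> ccfun_on K" for f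
    using functional_of_bound[OF assms(1) K that] functional_of_bound[OF assms(2) K that] by (simp add: distrib_right)
  then show "\<exists>C. \<forall>f\<in>ccfun_on K. \<bar>functional_of P f - functional_of Q f\<bar> \<le> C * sup_dist f 0"
    by blast
qed

lemma functional_of_pos_radon:
  assumes "locally_finite_borel P"
  shows "functional_of P \<in> pos_radon_measures"
proof -
  have n: "locally_finite_borel (null_measure borel)"
    by (simp add: locally_finite_borel_def)
  have "functional_of (null_measure borel) f = 0" for f :: "'a ccfun"
    using functional_of_bound[OF n compact_cc_support[of f], of f] by (simp add: ccfun_on_iff)
  then have "functional_of P \<in> radon_measures"
    using functional_of_diff_radon[OF assms n] by simp
  then show ?thesis
    unfolding pos_radon_measures_def by (blast intro: functional_of_nonneg)
qed

lemma (in lc_space) pos_radon_measuresE: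
  assumes "\<phi> \<in> pos_radon_measures"
  obtains P :: "'a measure" where "locally_finite_borel P" "\<phi> = functional_of P"
proof -
  interpret positive_functional \<phi>
    using assms lc_space_axioms by (auto simp: positive_functional_def positive_functional_axioms_def
        pos_radon_measures_def radon_measures_def)
  show thesis
    using that[OF locally_finite_riesz_measure] riesz_representation by (auto simp: functional_of_def fun_eq_iff)
qed

definition add_measure :: "'a measure \<Rightarrow> 'a measure \<Rightarrow> 'a measure" where
  "add_measure P Q = measure_of (space P) (sets P) (\<lambda>A. emeasure P A + emeasure Q A)"

lemma sets_add_measure [simp]: "sets (add_measure P Q) = sets P"
  by (simp add: add_measure_def)

lemma space_add_measure [simp]: "space (add_measure P Q) = space P"
  by (simp add: add_measure_def)

lemma emeasure_add_measure:
  assumes "sets Q = sets P" "A \<in> sets P"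
  shows "emeasure (add_measure P Q) A = emeasure P A + emeasure Q A"
  unfolding add_measure_def
proof (rule emeasure_measure_of_sigma)
  show "sigma_algebra (space P) (sets P)" ..
  show "positive (sets P) (\<lambda>A. emeasure P A + emeasure Q A)"
    by (simp add: positive_def)
  show "countably_additive (sets P) (\<lambda>A. emeasure P A + emeasure Q A)"
  proof (rule countably_additiveI)
    fix B :: "nat \<Rightarrow> _" assume B: "range B \<subseteq> sets P" "disjoint_family B" "\<Union> (range B) \<in> sets P"
    have "(\<Sum>i. emeasure P (B i) + emeasure Q (B i)) = (\<Sum>i. emeasure P (B i)) + (\<Sum>i. emeasure Q (B i))"
      by (rule suminf_add[symmetric]) auto
    also have "\<dots> = emeasure P (\<Union> (range B)) + emeasure Q (\<Union> (range B))"
      using B assms(1) by (simp add: suminf_emeasure)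
    finally show "(\<Sum>i. emeasure P (B i) + emeasure Q (B i)) = emeasure P (\<Union> (range B)) + emeasure Q (\<Union> (range B))" .
  qed
qed fact

lemma nn_integral_add_measure:
  assumes "sets Q = sets P" "f \<in> borel_measurable P"
  shows "(\<integral>\<^sup>+x. f x \<partial>add_measure P Q) = (\<integral>\<^sup>+x. f x \<partial>P) + (\<integral>\<^sup>+x. f x \<partial>Q)"
proof -
  have Q: "w \<in> borel_measurable Q" if "w \<in> borel_measurable P" for w :: "'a \<Rightarrow> ennreal"
    by (subst measurable_cong_sets[OF assms(1) refl]) (rule that)
  have S: "w \<in> borel_measurable (add_measure P Q)" if "w \<in> borel_measurable P" for w :: "'a \<Rightarrow> ennreal"
    by (subst measurable_cong_sets[OF sets_add_measure refl]) (rule that)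
  show ?thesis
    using assms(2)
  proof induction
    case (cong f g)
    have "integral\<^sup>N M f = integral\<^sup>N M g" if "space M = space P" for M
      using cong(3) that by (intro nn_integral_cong) auto
    then show ?case
      using cong(4) sets_eq_imp_space_eq[OF assms(1)] by simp
  next
    case (set A)
    then show ?case
      using assms(1) by (simp add: emeasure_add_measure)
  next
    case (mult u c)
    then show ?case
      using Q[OF mult(2)] S[OF mult(2)] by (simp add: nn_integral_cmult distrib_left)
  next
    case (add u v)
    then show ?case
      using Q[OF add(1)] S[OF add(1)] Q[OF add(3)] S[OF add(3)] by (simp add: nn_integral_add ac_simps)
  next
    case (seq U)
    have U: "(SUP i. U i) = (\<lambda>x. SUP i. U i x)"
      by (simp add: fun_eq_iff image_comp)
    have *: "(\<integral>\<^sup>+x. (SUP i. U i x) \<partial>M) = (SUP i. integral\<^sup>N M (U i))" if "\<And>i. U i \<in> borel_measurable M" for M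
      using seq(3) that by (intro nn_integral_monotone_convergence_SUP) auto
    have "incseq (\<lambda>i. integral\<^sup>N P (U i))" "incseq (\<lambda>i. integral\<^sup>N Q (U i))"
      by (intro incseq_nn_integral seq(3))+
    then show ?case
      unfolding U using *[OF seq(1)] *[OF Q[OF seq(1)]] *[OF S[OF seq(1)]] seq.IH
      by (simp add: ennreal_SUP_add)
  qed
qed

lemma lf_add_measure:
  assumes "locally_finite_borel P" "locally_finite_borel Q"
  shows "locally_finite_borel (add_measure P Q)"
  using assms by (auto simp: locally_finite_borel_def emeasure_add_measure borel_compact)

lemma lf_scale_measure:
  assumes "locally_finite_borel P" "c \<noteq> \<infinity>"
  shows "locally_finite_borel (scale_measure c P)"
  using assms by (simp add: locally_finite_borel_def ennreal_mult_less_top top.not_eq_extremum)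

text \<open>Every function \<open>f\<close> is the difference of the nonnegative functions \<open>p = max f 0\<close> and
  \<open>p - f\<close>.\<close>

lemma linear_functional_eqI:
  fixes \<phi> \<psi> :: "'a::t2_space ccfun \<Rightarrow> real"
  assumes "linear \<phi>" "linear \<psi>" and eq: "\<And>g. (\<And>x. 0 \<le> cc_apply g x) \<Longrightarrow> \<phi> g = \<psi> g"
  shows "\<phi> = \<psi>"
proof
  fix f :: "'a ccfun"
  have "continuous_on UNIV (\<lambda>t::real. max t 0)"
    by (intro continuous_intros)
  then obtain p where p: "cc_apply p = (\<lambda>x. max (cc_apply f x) 0)"
    using cc_compose[of "\<lambda>t. max t 0" f] by auto
  have "f = p - (p - f)"
    by (simp add: algebra_simps)
  moreover have "\<phi> p = \<psi> p" "\<phi> (p - f) = \<psi> (p - f)"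
    by (auto intro!: eq simp: p minus_ccfun.rep_eq)
  ultimately show "\<phi> f = \<psi> f"
    using linear_diff[OF assms(1), of p "p - f"] linear_diff[OF assms(2), of p "p - f"] by simp
qed

lemma functional_of_add_measure:
  assumes P: "locally_finite_borel P" and Q: "locally_finite_borel Q"
  shows "functional_of (add_measure P Q) f = functional_of P f + functional_of Q f"
proof -
  have "functional_of (add_measure P Q) = (\<lambda>f. functional_of P f + functional_of Q f)"
  proof (rule linear_functional_eqI)
    show "linear (functional_of (add_measure P Q))"
      by (intro linear_functional_of lf_add_measure P Q)
    show "linear (\<lambda>f. functional_of P f + functional_of Q f)"
      by (intro linear_compose_add linear_functional_of P Q)
    fix g :: "'a ccfun" assume g: "\<And>x. 0 \<le> cc_apply g x"
    have "(\<lambda>x. ennreal (cc_apply g x)) \<in> borel_measurable P"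
      using measurable_cc_apply[OF sets_lf[OF P]] by measurable
    then have "ennreal (functional_of (add_measure P Q) g) = ennreal (functional_of P g) + ennreal (functional_of Q g)"
      by (simp add: functional_of_eq_nn_integral g P Q lf_add_measure nn_integral_add_measure sets_lf)
    then show "functional_of (add_measure P Q) g = functional_of P g + functional_of Q g"
      using functional_of_nonneg[OF g] by (simp flip: ennreal_plus)
  qed
  then show ?thesis by simp
qed

lemma hahn_jordan_iff:
  "hahn_jordan \<phi> P N \<longleftrightarrow> locally_finite_borel P \<and> locally_finite_borel N \<and>
     (\<exists>S\<in>sets borel. emeasure P S = 0 \<and> emeasure N (- S) = 0) \<and>
     \<phi> = (\<lambda>f. functional_of P f - functional_of N f)"
  unfolding hahn_jordan_def functional_of_def fun_eq_iff by (rule refl)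

lemma hahn_jordanD:
  assumes "hahn_jordan \<phi> P N"
  shows "locally_finite_borel P" "locally_finite_borel N" "\<phi> = (\<lambda>f. functional_of P f - functional_of N f)"
    "\<exists>S\<in>sets borel. emeasure P S = 0 \<and> emeasure N (- S) = 0"
proof -
  note * = hahn_jordan_iff[THEN iffD1, OF assms]
  show "locally_finite_borel P"
    by (rule conjunct1[OF *])
  show "locally_finite_borel N"
    by (rule conjunct1[OF conjunct2[OF *]])
  show "\<phi> = (\<lambda>f. functional_of P f - functional_of N f)"
    by (rule conjunct2[OF conjunct2[OF conjunct2[OF *]]])
  show "\<exists>S\<in>sets borel. emeasure P S = 0 \<and> emeasure N (- S) = 0"
    by (rule conjunct1[OF conjunct2[OF conjunct2[OF *]]])
qed

context lc_space
begin

text \<open>If \<open>P - N = P' - N'\<close>, then \<open>P + N' = P' + N\<close>. Evaluating this identity where \<open>N\<close>, respectively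
  \<open>P\<close>, has no mass bounds the mutually singular pair by the other one.\<close>

lemma hahn_jordan_minimal:
  assumes hj: "hahn_jordan \<phi> P N"
    and lf': "locally_finite_borel P'" "locally_finite_borel (N' :: 'a measure)"
    and \<phi>: "\<phi> = (\<lambda>f. functional_of P' f - functional_of N' f)"
    and B: "B \<in> sets borel"
  shows "emeasure P B \<le> emeasure P' B" "emeasure N B \<le> emeasure N' B"
proof -
  note lf = hahn_jordanD(1,2)[OF hj] and eq = hahn_jordanD(3)[OF hj]
  obtain S where S: "S \<in> sets borel" "emeasure P S = 0" "emeasure N (- S) = 0"
    using hahn_jordanD(4)[OF hj] by blast
  have "functional_of P f - functional_of N f = functional_of P' f - functional_of N' f" for f
    using eq \<phi> by meson
  then have f: "functional_of P f + functional_of N' f = functional_of P' f + functional_of N f" for f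
    by (simp add: algebra_simps)
  have "add_measure P N' = add_measure P' N"
    by (intro measure_eqI_functional lf_add_measure lf lf') (simp add: f functional_of_add_measure lf lf' fun_eq_iff)
  then have sum: "emeasure P C + emeasure N' C = emeasure P' C + emeasure N C" if "C \<in> sets borel" for C
    using emeasure_add_measure[of N' P C] emeasure_add_measure[of N P' C] that by (simp add: sets_lf lf lf')
  have "emeasure P B \<le> emeasure P (B \<inter> S) + emeasure P (B - S)"
    using emeasure_subadditive[of "B \<inter> S" P "B - S"] B S by (simp add: sets_lf lf Int_Diff_Un)
  also have "emeasure P (B \<inter> S) = 0"
    using emeasure_mono[of "B \<inter> S" S P] S by (simp add: sets_lf lf)
  also have "0 + emeasure P (B - S) \<le> emeasure P' (B - S) + emeasure N (B - S)"
    using sum[of "B - S"] B S by (simp flip: sum) 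
  also have "emeasure N (B - S) = 0"
    using emeasure_mono[of "B - S" "- S" N] S B by (auto simp: sets_lf lf)
  also have "emeasure P' (B - S) + 0 \<le> emeasure P' B"
    using B by (auto simp: sets_lf lf' intro!: emeasure_mono)
  finally show "emeasure P B \<le> emeasure P' B" .
  have "emeasure N B \<le> emeasure N (B \<inter> S) + emeasure N (B - S)"
    using emeasure_subadditive[of "B \<inter> S" N "B - S"] B S by (simp add: sets_lf lf Int_Diff_Un)
  also have "emeasure N (B - S) = 0"
    by fact
  also have "emeasure N (B \<inter> S) + 0 \<le> emeasure P (B \<inter> S) + emeasure N' (B \<inter> S)"
    using sum[of "B \<inter> S"] B S by simp
  also have "emeasure P (B \<inter> S) = 0"
    by fact
  also have "0 + emeasure N' (B \<inter> S) \<le> emeasure N' B"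
    using B by (auto simp: sets_lf lf' intro!: emeasure_mono)
  finally show "emeasure N B \<le> emeasure N' B" .
qed

lemma hahn_jordan_unique:
  assumes "hahn_jordan \<phi> P N" "hahn_jordan \<phi> P' (N' :: 'a measure)"
  shows "P = P' \<and> N = N'"
proof -
  note lf = hahn_jordanD(1,2)[OF assms(1)] hahn_jordanD(1,2)[OF assms(2)]
    and \<phi> = hahn_jordanD(3)[OF assms(1)] hahn_jordanD(3)[OF assms(2)]
  show ?thesis
  proof
    show "P = P'"
    proof (rule measure_eqI)
      show "sets P = sets P'"
        by (simp add: sets_lf lf)
      fix B assume "B \<in> sets P"
      then have B: "B \<in> sets borel"
        by (simp add: sets_lf lf)
      show "emeasure P B = emeasure P' B"
        by (rule order.antisym[OF hahn_jordan_minimal(1)[OF assms(1) lf(3,4) \<phi>(2) B] hahn_jordan_minimal(1)[OF assms(2) lf(1,2) \<phi>(1) B]])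
    qed
    show "N = N'"
    proof (rule measure_eqI)
      show "sets N = sets N'"
        by (simp add: sets_lf lf)
      fix B assume "B \<in> sets N"
      then have B: "B \<in> sets borel"
        by (simp add: sets_lf lf)
      show "emeasure N B = emeasure N' B"
        by (rule order.antisym[OF hahn_jordan_minimal(2)[OF assms(1) lf(3,4) \<phi>(2) B] hahn_jordan_minimal(2)[OF assms(2) lf(1,2) \<phi>(1) B]])
    qed
  qed
qed

lemma hahn_jordan_parts:
  assumes "hahn_jordan \<phi> P (N :: 'a measure)"
  shows "pos_part \<phi> = P" "neg_part \<phi> = N"
proof -
  have "(THE PN. hahn_jordan \<phi> (fst PN) (snd PN)) = (P, N)"
  proof (rule the_equality)
    show "hahn_jordan \<phi> (fst (P, N)) (snd (P, N))"
      using assms by simp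
    fix PN assume "hahn_jordan \<phi> (fst PN) (snd PN)"
    from hahn_jordan_unique[OF this assms] show "PN = (P, N)"
      by (simp add: prod_eq_iff)
  qed
  then show "pos_part \<phi> = P" "neg_part \<phi> = N"
    by (simp_all add: pos_part_def neg_part_def)
qed

lemma functional_of_null_measure: "functional_of (null_measure (borel :: 'a measure)) f = 0"
  using functional_of_bound[OF locally_finite_null_measure compact_cc_support[of f], of f] by (simp add: ccfun_on_iff)

lemma functional_of_parts:
  assumes "locally_finite_borel (P :: 'a measure)"
  shows "pos_part (functional_of P) = P" "neg_part (functional_of P) = null_measure borel"
proof -
  have "hahn_jordan (functional_of P) P (null_measure borel)"
    unfolding hahn_jordan_iff using assms locally_finite_null_measure
    by (auto simp: functional_of_null_measure intro!: bexI[of _ "{}"])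
  then show "pos_part (functional_of P) = P" "neg_part (functional_of P) = null_measure borel"
    by (rule hahn_jordan_parts)+
qed

text \<open>Take densities \<open>f\<close> and \<open>g\<close> of \<open>P\<close> and \<open>Q\<close> with respect to \<open>P + Q\<close>.
  Truncated subtraction gives the densities \<open>f - g\<close> and \<open>g - f\<close> of the singular parts, and \<open>min f g\<close>
  that of the common part \<open>Z\<close>.\<close>

lemma hahn_jordan_exists:
  assumes P: "locally_finite_borel (P :: 'a measure)" and Q: "locally_finite_borel Q"
  obtains P' Q' Z where "locally_finite_borel P'" "locally_finite_borel Q'" "locally_finite_borel Z"
    "P = add_measure P' Z" "Q = add_measure Q' Z"
    "hahn_jordan (\<lambda>f. functional_of P f - functional_of Q f) P' Q'"
proof -
  let ?R = "add_measure P Q"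
  have R: "locally_finite_borel ?R"
    by (intro lf_add_measure P Q)
  interpret R: sigma_finite_measure ?R
    by (rule sigma_finite_lf[OF R])
  have s: "sets ?R = sets borel" "sets P = sets borel" "sets Q = sets borel"
    by (simp_all add: sets_lf P Q)
  have e: "emeasure ?R B = emeasure P B + emeasure Q B" if "B \<in> sets borel" for B
    using emeasure_add_measure[of Q P B] that by (simp add: s)
  have "absolutely_continuous ?R P" "absolutely_continuous ?R Q"
    using e by (auto simp: absolutely_continuous_def null_sets_def s)
  then obtain f g where f: "f \<in> borel_measurable ?R" "density ?R f = P" and g: "g \<in> borel_measurable ?R" "density ?R g = Q"
    using R.Radon_Nikodym[of P] R.Radon_Nikodym[of Q] s by (metis (no_types))
  \<comment> \<open>Needed for singularity: truncated subtraction gives \<open>\<infinity> - \<infinity> = \<infinity>\<close>.\<close>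
  have fin: "AE x in ?R. f x \<noteq> \<infinity>" "AE x in ?R. g x \<noteq> \<infinity>"
    using R.sigma_finite_iff_density_finite[OF f(1)] R.sigma_finite_iff_density_finite[OF g(1)]
      sigma_finite_lf[OF P] sigma_finite_lf[OF Q] f g by auto
  have [measurable]: "f \<in> borel_measurable ?R" "g \<in> borel_measurable ?R"
    by fact+
  define P' where "P' = density ?R (\<lambda>x. f x - g x)"
  define Q' where "Q' = density ?R (\<lambda>x. g x - f x)"
  define Z where "Z = density ?R (\<lambda>x. min (f x) (g x))"
  have sets': "sets P' = sets borel" "sets Q' = sets borel" "sets Z = sets borel"
    by (simp_all add: P'_def Q'_def Z_def s)
  have split: "(a - b) + min a b = a" for a b :: ennreal
  proof (cases "a \<le> b")
    case True
    then show ?thesis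
      by (cases "a = top") (auto simp: min_absorb1 diff_eq_0_ennreal less_top top_unique)
  next
    case False
    then show ?thesis
      by (simp add: min_absorb2 diff_add_cancel_ennreal)
  qed
  have density_split: "emeasure (density ?R u) B = emeasure (density ?R (\<lambda>x. u x - v x)) B + emeasure (density ?R (\<lambda>x. min (u x) (v x))) B"
    if uv: "u \<in> borel_measurable ?R" "v \<in> borel_measurable ?R" and B: "B \<in> sets ?R" for u v B
  proof -
    note [measurable] = uv B
    have "(\<integral>\<^sup>+x. u x * indicator B x \<partial>?R) = (\<integral>\<^sup>+x. (u x - v x) * indicator B x + min (u x) (v x) * indicator B x \<partial>?R)"
      by (intro nn_integral_cong) (metis split distrib_right)
    also have "\<dots> = (\<integral>\<^sup>+x. (u x - v x) * indicator B x \<partial>?R) + (\<integral>\<^sup>+x. min (u x) (v x) * indicator B x \<partial>?R)"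
      by (rule nn_integral_add) measurable
    finally have sum: "(\<integral>\<^sup>+x. u x * indicator B x \<partial>?R) =
        (\<integral>\<^sup>+x. (u x - v x) * indicator B x \<partial>?R) + (\<integral>\<^sup>+x. min (u x) (v x) * indicator B x \<partial>?R)" .
    have m: "(\<lambda>x. u x - v x) \<in> borel_measurable ?R" "(\<lambda>x. min (u x) (v x)) \<in> borel_measurable ?R"
      by measurable
    show ?thesis
      unfolding emeasure_density[OF uv(1) B] emeasure_density[OF m(1) B] emeasure_density[OF m(2) B] by (rule sum)
  qed
  have eP: "emeasure P B = emeasure P' B + emeasure Z B" if "B \<in> sets borel" for B
    using density_split[OF f(1) g(1), of B] that by (simp only: f(2) P'_def Z_def s)
  have eQ: "emeasure Q B = emeasure Q' B + emeasure Z B" if "B \<in> sets borel" for B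
    using density_split[OF g(1) f(1), of B] that by (simp only: g(2) Q'_def Z_def s min.commute[of "g _"])
  have lfP: "locally_finite_borel P'" "locally_finite_borel Z"
    using P eP by (auto simp: locally_finite_borel_def sets' borel_compact)
  have lfQ: "locally_finite_borel Q'"
    using Q eQ by (auto simp: locally_finite_borel_def sets' borel_compact)
  have PZ: "P = add_measure P' Z" and QZ: "Q = add_measure Q' Z"
    using eP eQ by (auto intro!: measure_eqI simp: s sets' emeasure_add_measure)
  have "\<exists>S\<in>sets borel. emeasure P' S = 0 \<and> emeasure Q' (- S) = 0"
  proof (rule bexI, rule conjI)
    let ?S = "{x \<in> space ?R. f x \<le> g x}"
    have S: "?S \<in> sets ?R"
      by measurable
    then show S': "?S \<in> sets borel"
      by (simp add: s)
    have S'': "- ?S \<in> sets ?R"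
      unfolding s(1) using S' by (rule borel_comp)
    have "(\<integral>\<^sup>+x. (f x - g x) * indicator ?S x \<partial>?R) = (\<integral>\<^sup>+x. 0 \<partial>?R)"
      using fin by (intro nn_integral_cong_AE, eventually_elim) (auto simp: indicator_def diff_eq_0_ennreal less_top)
    then show "emeasure P' ?S = 0"
      unfolding P'_def using S by (simp add: emeasure_density)
    have "(\<integral>\<^sup>+x. (g x - f x) * indicator (- ?S) x \<partial>?R) = (\<integral>\<^sup>+x. 0 \<partial>?R)"
      using fin by (intro nn_integral_cong_AE, eventually_elim)
        (auto simp: indicator_def space_lf[OF P] not_le less_top intro!: diff_eq_0_ennreal)
    then show "emeasure Q' (- ?S) = 0"
      unfolding Q'_def using S'' by (simp add: emeasure_density)
  qed
  moreover have "(\<lambda>f. functional_of P f - functional_of Q f) = (\<lambda>f. functional_of P' f - functional_of Q' f)"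
    by (subst PZ, subst QZ) (simp add: functional_of_add_measure lfP lfQ)
  ultimately have "hahn_jordan (\<lambda>f. functional_of P f - functional_of Q f) P' Q'"
    unfolding hahn_jordan_iff using lfP lfQ by blast
  then show thesis
    using that lfP lfQ PZ QZ by blast
qed

end

section \<open>Lower semicontinuous kernels and their energies\<close>

definition dirac :: "'a::topological_space \<Rightarrow> 'a measure" where
  "dirac x = distr (count_space (UNIV :: unit set)) borel (\<lambda>_. x)"

lemma sets_dirac [simp]: "sets (dirac x) = sets borel"
  by (simp add: dirac_def)

lemma nn_integral_dirac:
  assumes "f \<in> borel_measurable borel"
  shows "(\<integral>\<^sup>+y. f y \<partial>dirac x) = f x"
proof -
  have "(\<integral>\<^sup>+y. f y \<partial>dirac x) = (\<integral>\<^sup>+u. f x \<partial>count_space (UNIV :: unit set))"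
    unfolding dirac_def using assms by (intro nn_integral_distr) auto
  then show ?thesis
    by (simp add: nn_integral_count_space_finite)
qed

lemma locally_finite_dirac: "locally_finite_borel (dirac x)"
  unfolding locally_finite_borel_def
proof (intro conjI allI impI)
  fix K :: "'a set" assume "compact K"
  then have K: "K \<in> sets borel"
    by (rule borel_compact)
  have "emeasure (dirac x) K = (\<integral>\<^sup>+y. indicator K y \<partial>dirac x)"
    using K by simp
  also have "\<dots> = indicator K x"
    using K by (intro nn_integral_dirac) auto
  finally show "emeasure (dirac x) K < \<infinity>"
    by (simp add: indicator_def)
qed simp

lemma functional_of_dirac: "functional_of (dirac x) f = cc_apply f x"
proof -
  have "functional_of (dirac x) = (\<lambda>f. cc_apply f x)"
  proof (rule linear_functional_eqI)
    show "linear (functional_of (dirac x))"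
      by (intro linear_functional_of locally_finite_dirac)
    show "linear (\<lambda>f. cc_apply f x)"
      by (rule linearI) (simp_all add: plus_ccfun.rep_eq scaleR_ccfun.rep_eq)
    fix g :: "'a ccfun" assume g: "\<And>x. 0 \<le> cc_apply g x"
    have "(\<lambda>x. ennreal (cc_apply g x)) \<in> borel_measurable borel"
      using measurable_cc_apply[of borel g] by measurable
    then have "ennreal (functional_of (dirac x) g) = ennreal (cc_apply g x)"
      by (simp add: functional_of_eq_nn_integral[OF locally_finite_dirac g] nn_integral_dirac)
    then show "functional_of (dirac x) g = cc_apply g x"
      using functional_of_nonneg[OF g] g by simp
  qed
  then show ?thesis by simp
qed

lemma linear_functional_of_sum:
  assumes "locally_finite_borel P"
  shows "functional_of P (\<Sum>i\<in>I. c i *\<^sub>R f i) = (\<Sum>i\<in>I. c i * functional_of P (f i))"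
  by (simp add: linear_sum[OF linear_functional_of[OF assms]] linear_scale[OF linear_functional_of[OF assms]])

lemma nn_integral_cc_sum:
  assumes P: "locally_finite_borel P" and nn: "\<And>x. 0 \<le> (\<Sum>i\<in>I. c i * cc_apply (f i) x)"
  shows "(\<integral>\<^sup>+x. ennreal (\<Sum>i\<in>I. c i * cc_apply (f i) x) \<partial>P) = ennreal (\<Sum>i\<in>I. c i * functional_of P (f i))"
proof -
  have *: "cc_apply (\<Sum>i\<in>I. c i *\<^sub>R f i) x = (\<Sum>i\<in>I. c i * cc_apply (f i) x)" for x
    by (simp add: cc_apply_sum scaleR_ccfun.rep_eq)
  have "ennreal (functional_of P (\<Sum>i\<in>I. c i *\<^sub>R f i)) = (\<integral>\<^sup>+x. ennreal (cc_apply (\<Sum>i\<in>I. c i *\<^sub>R f i) x) \<partial>P)"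
    using nn by (intro functional_of_eq_nn_integral P) (simp add: *)
  then show ?thesis
    by (simp add: * linear_functional_of_sum[OF P])
qed

locale lsc_kernel = lc_space "TYPE('a)"
  for \<kappa> :: "'a::{t2_space,second_countable_topology} \<Rightarrow> 'a \<Rightarrow> ennreal" +
  assumes kernel: "symmetric_lsc_kernel \<kappa>"
begin

abbreviation energy :: "'a measure \<Rightarrow> 'a measure \<Rightarrow> ennreal" where
  "energy \<equiv> product_energy \<kappa>"

definition pot :: "'a measure \<Rightarrow> 'a \<Rightarrow> ennreal" where
  "pot P x = (\<integral>\<^sup>+y. \<kappa> x y \<partial>P)"

lemma kernel_sym: "\<kappa> x y = \<kappa> y x"
  using kernel unfolding symmetric_lsc_kernel_def by blast

lemma kernel_open: "open {p. c < \<kappa> (fst p) (snd p)}"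
  using kernel unfolding symmetric_lsc_kernel_def by blast

lemma kernel_measurable: "(\<lambda>p. \<kappa> (fst p) (snd p)) \<in> borel_measurable (borel \<Otimes>\<^sub>M borel)"
  unfolding borel_prod
  by (rule borel_measurableI_greater) (use kernel_open in \<open>auto simp: space_borel\<close>)

lemma kernel_measurable_pair:
  assumes "locally_finite_borel P" "locally_finite_borel Q"
  shows "(\<lambda>p. \<kappa> (fst p) (snd p)) \<in> borel_measurable (P \<Otimes>\<^sub>M Q)"
  using kernel_measurable measurable_cong_sets[OF sets_pair_measure_cong[OF sets_lf[OF assms(1)] sets_lf[OF assms(2)]] refl]
  by blast

lemma kernel_measurable_section: "(\<lambda>y. \<kappa> x y) \<in> borel_measurable borel"
  using measurable_compose[OF measurable_Pair1' kernel_measurable, of x] by (simp add: space_borel)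

lemma energy_iterated:
  assumes "locally_finite_borel P" "locally_finite_borel Q"
  shows "energy P Q = (\<integral>\<^sup>+x. pot Q x \<partial>P)"
proof -
  interpret sigma_finite_measure Q
    by (rule sigma_finite_lf[OF assms(2)])
  show ?thesis
    unfolding product_energy_def pot_def
    using nn_integral_fst[OF kernel_measurable_pair[OF assms]] by simp
qed

lemma pot_measurable:
  assumes "locally_finite_borel P"
  shows "pot P \<in> borel_measurable borel"
proof -
  interpret sigma_finite_measure P
    by (rule sigma_finite_lf[OF assms])
  have "(\<lambda>p. \<kappa> (fst p) (snd p)) \<in> borel_measurable (borel \<Otimes>\<^sub>M P)"
    using kernel_measurable measurable_cong_sets[OF sets_pair_measure_cong[OF refl sets_lf[OF assms]] refl] by blast
  then show ?thesis
    unfolding pot_def[abs_def] using borel_measurable_nn_integral_fst by fastforce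
qed

lemma pot_measurable': "locally_finite_borel P \<Longrightarrow> sets M = sets borel \<Longrightarrow> pot P \<in> borel_measurable M"
  using pot_measurable measurable_cong_sets by blast

lemma energy_sym:
  assumes "locally_finite_borel P" "locally_finite_borel Q"
  shows "energy P Q = energy Q P"
proof -
  interpret pair_sigma_finite P Q
    using sigma_finite_lf assms by (intro pair_sigma_finite.intro)
  have "energy P Q = (\<integral>\<^sup>+y. (\<integral>\<^sup>+x. \<kappa> x y \<partial>P) \<partial>Q)"
    unfolding product_energy_def
    using nn_integral_snd[OF kernel_measurable_pair[OF assms]] by simp
  also have "\<dots> = energy Q P"
    by (simp add: energy_iterated assms pot_def kernel_sym[of _ y for y])
  finally show ?thesis .
qed

lemma energy_add_left:
  assumes "locally_finite_borel P" "locally_finite_borel Q" "locally_finite_borel R"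
  shows "energy (add_measure P Q) R = energy P R + energy Q R"
  using assms by (simp add: energy_iterated lf_add_measure nn_integral_add_measure sets_lf pot_measurable')

lemma energy_add_right:
  assumes "locally_finite_borel P" "locally_finite_borel Q" "locally_finite_borel R"
  shows "energy R (add_measure P Q) = energy R P + energy R Q"
  using assms energy_add_left[OF assms] by (simp add: energy_sym lf_add_measure)

lemma energy_scale_left:
  assumes "locally_finite_borel P" "locally_finite_borel R" "c \<noteq> \<infinity>"
  shows "energy (scale_measure c P) R = c * energy P R"
  using assms by (simp add: energy_iterated lf_scale_measure nn_integral_scale_measure sets_lf pot_measurable')

lemma energy_scale_right:
  assumes "locally_finite_borel P" "locally_finite_borel R" "c \<noteq> \<infinity>"
  shows "energy R (scale_measure c P) = c * energy R P"
  using assms energy_scale_left[OF assms] by (simp add: energy_sym lf_scale_measure)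

lemma energy_dirac:
  assumes "locally_finite_borel P"
  shows "energy (dirac x) P = pot P x"
  using assms by (simp add: energy_iterated locally_finite_dirac nn_integral_dirac pot_measurable)

text \<open>A fixed countable family of bump functions generates, for each \<open>m\<close>, the partition
  \<open>\<Prod>\<^sub>i\<^sub><\<^sub>m (g\<^sub>i + (1 - g\<^sub>i)) = 1\<close> of unity into products indexed by \<open>S \<subseteq> {..<m}\<close>.
  The summands with \<open>S \<noteq> {}\<close> have compact support.\<close>

definition bump :: "nat \<Rightarrow> 'a ccfun" where
  "bump = (SOME g. (\<forall>i x. 0 \<le> cc_apply (g i) x \<and> cc_apply (g i) x \<le> 1) \<and>
     (\<forall>U x. open U \<longrightarrow> x \<in> U \<longrightarrow> (\<exists>i. cc_apply (g i) x = 1 \<and> cc_support (g i) \<subseteq> U)))"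

lemma bump:
  "0 \<le> cc_apply (bump i) x" "cc_apply (bump i) x \<le> 1"
  "open U \<Longrightarrow> x \<in> U \<Longrightarrow> \<exists>i. cc_apply (bump i) x = 1 \<and> cc_support (bump i) \<subseteq> U"
proof -
  obtain g :: "nat \<Rightarrow> 'a ccfun" where
    "\<And>i x. 0 \<le> cc_apply (g i) x" "\<And>i x. cc_apply (g i) x \<le> 1"
    "\<And>U x. open U \<Longrightarrow> x \<in> U \<Longrightarrow> \<exists>i. cc_apply (g i) x = 1 \<and> cc_support (g i) \<subseteq> U"
    using countable_bump_family by metis
  then have "\<exists>g :: nat \<Rightarrow> 'a ccfun. (\<forall>i x. 0 \<le> cc_apply (g i) x \<and> cc_apply (g i) x \<le> 1) \<and>
     (\<forall>U x. open U \<longrightarrow> x \<in> U \<longrightarrow> (\<exists>i. cc_apply (g i) x = 1 \<and> cc_support (g i) \<subseteq> U))"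
    by blast
  from someI_ex[OF this, folded bump_def]
  show "0 \<le> cc_apply (bump i) x" "cc_apply (bump i) x \<le> 1"
    "open U \<Longrightarrow> x \<in> U \<Longrightarrow> \<exists>i. cc_apply (bump i) x = 1 \<and> cc_support (bump i) \<subseteq> U"
    by blast+
qed

definition cell_value :: "nat \<Rightarrow> nat set \<Rightarrow> 'a \<Rightarrow> real" where
  "cell_value m S x = (\<Prod>i\<in>S. cc_apply (bump i) x) * (\<Prod>i\<in>{..<m} - S. 1 - cc_apply (bump i) x)"

definition cell :: "nat \<Rightarrow> nat set \<Rightarrow> 'a ccfun" where
  "cell m S = (SOME f. cc_apply f = cell_value m S)"

definition cells :: "nat \<Rightarrow> nat set set" where
  "cells m = Pow {..<m} - {{}}"

lemma cell_value_nonneg: "0 \<le> cell_value m S x"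
  unfolding cell_value_def by (intro mult_nonneg_nonneg prod_nonneg) (auto simp: bump)

lemma cc_apply_cell:
  assumes "S \<in> cells m"
  shows "cc_apply (cell m S) x = cell_value m S x"
proof -
  obtain i where i: "i \<in> S"
    using assms by (auto simp: cells_def)
  have fin: "finite S"
    using assms by (auto simp: cells_def intro: finite_subset)
  have "\<exists>f. cc_apply f = cell_value m S \<and> cc_support f \<subseteq> cc_support (bump i)"
  proof (rule ccfun_exists)
    show "continuous_on UNIV (cell_value m S)"
      unfolding cell_value_def[abs_def] by (intro continuous_intros continuous_cc_apply)
    show "compact (cc_support (bump i))"
      by (rule compact_cc_support)
    show "cell_value m S x = 0" if "x \<notin> cc_support (bump i)" for x
    proof -
      have "(\<Prod>i\<in>S. cc_apply (bump i) x) = 0"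
        using cc_apply_eq_0[OF that] i by (intro prod_zero fin) auto
      then show ?thesis
        by (simp add: cell_value_def)
    qed
  qed
  then have "\<exists>f. cc_apply f = cell_value m S"
    by blast
  then have "cc_apply (cell m S) = cell_value m S"
    unfolding cell_def by (rule someI_ex)
  then show ?thesis
    by simp
qed

lemma sum_cells: "(\<Sum>S\<in>cells m. cell_value m S x) = 1 - (\<Prod>i<m. 1 - cc_apply (bump i) x)"
proof -
  have "(\<Sum>S\<in>Pow {..<m}. cell_value m S x) = (\<Prod>i<m. cc_apply (bump i) x + (1 - cc_apply (bump i) x))"
    unfolding cell_value_def by (rule prod_add[symmetric]) simp
  then have "(\<Sum>S\<in>Pow {..<m}. cell_value m S x) = 1"
    by simp
  moreover have "(\<Sum>S\<in>Pow {..<m}. cell_value m S x) = cell_value m {} x + (\<Sum>S\<in>cells m. cell_value m S x)"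
    unfolding cells_def by (intro sum.remove) auto
  ultimately show ?thesis
    by (simp add: cell_value_def)
qed

lemma sum_cells_le: "(\<Sum>S\<in>cells m. cell_value m S x) \<le> 1"
  unfolding sum_cells by (simp add: bump prod_nonneg)

lemma sum_cells_eq: "i < m \<Longrightarrow> cc_apply (bump i) x = 1 \<Longrightarrow> (\<Sum>S\<in>cells m. cell_value m S x) = 1"
  unfolding sum_cells by (auto intro!: prod_zero)

lemma cell_value_eq_0:
  assumes "i < m" "cc_apply (bump i) x = 1" "cell_value m S x \<noteq> 0"
  shows "i \<in> S"
proof (rule ccontr)
  assume "i \<notin> S"
  then have "(\<Prod>i\<in>{..<m} - S. 1 - cc_apply (bump i) x) = 0"
    using assms by (intro prod_zero) auto
  then show False
    using assms by (simp add: cell_value_def)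
qed

lemma cell_value_support:
  assumes "i \<in> S" "S \<in> cells m" "cell_value m S y \<noteq> 0"
  shows "y \<in> cc_support (bump i)"
proof (rule ccontr)
  assume "y \<notin> cc_support (bump i)"
  moreover have "finite S"
    using assms by (auto simp: cells_def intro: finite_subset)
  ultimately have "(\<Prod>i\<in>S. cc_apply (bump i) y) = 0"
    using assms cc_apply_eq_0 by (intro prod_zero) auto
  then show False
    using assms by (simp add: cell_value_def)
qed

text \<open>The infimum of the kernel over a pair of cells, capped to be finite (it is \<open>\<infinity>\<close> for an empty cell). The cap
  grows with \<open>m\<close>, so it disappears in the limit.\<close>

definition cell_inf :: "nat \<Rightarrow> nat set \<Rightarrow> nat set \<Rightarrow> real" where
  "cell_inf m S T = enn2real (min (of_nat m)
     (INF p\<in>{x. cell_value m S x \<noteq> 0} \<times> {y. cell_value m T y \<noteq> 0}. \<kappa> (fst p) (snd p)))"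

definition step_kernel :: "nat \<Rightarrow> 'a \<Rightarrow> 'a \<Rightarrow> real" where
  "step_kernel m x y = (\<Sum>S\<in>cells m. \<Sum>T\<in>cells m. cell_inf m S T * cell_value m S x * cell_value m T y)"

definition step_energy :: "nat \<Rightarrow> 'a measure \<Rightarrow> 'a measure \<Rightarrow> real" where
  "step_energy m P Q =
     (\<Sum>S\<in>cells m. \<Sum>T\<in>cells m. cell_inf m S T * functional_of P (cell m S) * functional_of Q (cell m T))"

lemma sum_sum_product:
  fixes r :: real
  shows "r * (sum f A * sum g B) = (\<Sum>a\<in>A. \<Sum>b\<in>B. r * f a * g b)"
  unfolding sum_product by (simp add: sum_distrib_left mult.assoc)

lemma cell_inf_nonneg: "0 \<le> cell_inf m S T"
  by (simp add: cell_inf_def)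

lemma ennreal_cell_inf:
  "ennreal (cell_inf m S T) = min (of_nat m)
     (INF p\<in>{x. cell_value m S x \<noteq> 0} \<times> {y. cell_value m T y \<noteq> 0}. \<kappa> (fst p) (snd p))"
  unfolding cell_inf_def by (rule ennreal_enn2real) (simp add: min_less_iff_disj of_nat_less_top)

lemma cell_inf_le:
  assumes "cell_value m S x \<noteq> 0" "cell_value m T y \<noteq> 0"
  shows "ennreal (cell_inf m S T) \<le> \<kappa> x y"
  unfolding ennreal_cell_inf using assms by (intro min.coboundedI2 INF_lower2[of "(x, y)"]) auto

lemma step_kernel_nonneg: "0 \<le> step_kernel m x y"
  unfolding step_kernel_def by (intro sum_nonneg mult_nonneg_nonneg cell_inf_nonneg cell_value_nonneg)

text \<open>Since the cell values sum to at most \<open>1\<close>, the step kernel at \<open>(x, y)\<close> is at most a convex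
  combination of lower bounds of \<open>\<kappa> x y\<close>.\<close>

lemma step_kernel_le: "ennreal (step_kernel m x y) \<le> \<kappa> x y"
proof (cases "\<kappa> x y")
  case (real r)
  have "step_kernel m x y \<le> (\<Sum>S\<in>cells m. \<Sum>T\<in>cells m. r * cell_value m S x * cell_value m T y)"
    unfolding step_kernel_def
  proof (intro sum_mono)
    fix S T
    show "cell_inf m S T * cell_value m S x * cell_value m T y \<le> r * cell_value m S x * cell_value m T y"
    proof (cases "cell_value m S x = 0 \<or> cell_value m T y = 0")
      case False
      then have "cell_inf m S T \<le> r"
        using cell_inf_le[of m S x T y] real by simp
      then show ?thesis
        by (intro mult_right_mono cell_value_nonneg)
    qed auto
  qed
  also have "\<dots> = r * ((\<Sum>S\<in>cells m. cell_value m S x) * (\<Sum>T\<in>cells m. cell_value m T y))"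
    by (rule sum_sum_product[symmetric])
  also have "\<dots> \<le> r * (1 * 1)"
    using real sum_cells_le by (intro mult_left_mono mult_mono sum_nonneg cell_value_nonneg) auto
  finally show ?thesis
    using real by (simp add: ennreal_leI)
qed simp

text \<open>Let \<open>\<kappa> > c\<close> on \<open>U \<times> V \<ni> (x, y)\<close>. Once the partition involves a bump function
  which is \<open>1\<close> at \<open>x\<close> and supported in \<open>U\<close>, every cell that does not vanish at \<open>x\<close>
  is contained in \<open>U\<close> and these cells sum to \<open>1\<close> at \<open>x\<close>; likewise for \<open>y\<close> and \<open>V\<close>.\<close>

lemma step_kernel_approx:
  assumes "c < \<kappa> x y"
  shows "\<forall>\<^sub>F m in sequentially. c \<le> ennreal (step_kernel m x y)"
proof -
  obtain U V where UV: "open U" "open V" "x \<in> U" "y \<in> V" "U \<times> V \<subseteq> {p. c < \<kappa> (fst p) (snd p)}"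
  proof -
    have "(x, y) \<in> {p. c < \<kappa> (fst p) (snd p)}"
      using assms by simp
    then obtain U V where "open U" "open V" "(x, y) \<in> U \<times> V" "U \<times> V \<subseteq> {p. c < \<kappa> (fst p) (snd p)}"
      by (rule open_prod_elim[OF kernel_open])
    then show thesis
      by (intro that[of U V]) auto
  qed
  obtain i where i: "cc_apply (bump i) x = 1" "cc_support (bump i) \<subseteq> U"
    using bump(3)[OF UV(1,3)] by blast
  obtain j where j: "cc_apply (bump j) y = 1" "cc_support (bump j) \<subseteq> V"
    using bump(3)[OF UV(2,4)] by blast
  obtain r where r: "c = ennreal r" "0 \<le> r"
    using assms by (cases c) auto
  obtain k where k: "r \<le> real k"
    using real_arch_simple by blast
  have "c \<le> ennreal (step_kernel m x y)" if m: "i < m" "j < m" "k \<le> m" for m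
  proof -
    have "r = r * ((\<Sum>S\<in>cells m. cell_value m S x) * (\<Sum>T\<in>cells m. cell_value m T y))"
      using sum_cells_eq[OF m(1) i(1)] sum_cells_eq[OF m(2) j(1)] by simp
    also have "\<dots> = (\<Sum>S\<in>cells m. \<Sum>T\<in>cells m. r * cell_value m S x * cell_value m T y)"
      by (rule sum_sum_product)
    also have "\<dots> \<le> step_kernel m x y"
      unfolding step_kernel_def
    proof (intro sum_mono)
      fix S T assume ST: "S \<in> cells m" "T \<in> cells m"
      show "r * cell_value m S x * cell_value m T y \<le> cell_inf m S T * cell_value m S x * cell_value m T y"
      proof (cases "cell_value m S x = 0 \<or> cell_value m T y = 0")
        case False
        then have "i \<in> S" "j \<in> T"
          using cell_value_eq_0[OF m(1) i(1)] cell_value_eq_0[OF m(2) j(1)] by blast+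
        have "c \<le> \<kappa> (fst p) (snd p)" if "p \<in> {x. cell_value m S x \<noteq> 0} \<times> {y. cell_value m T y \<noteq> 0}" for p
        proof -
          have "fst p \<in> U" "snd p \<in> V"
            using that cell_value_support[OF \<open>i \<in> S\<close> ST(1)] cell_value_support[OF \<open>j \<in> T\<close> ST(2)] i(2) j(2) by auto
          then show ?thesis
            using UV(5) by (auto simp: mem_Times_iff subset_iff less_imp_le)
        qed
        then have "c \<le> (INF p\<in>{x. cell_value m S x \<noteq> 0} \<times> {y. cell_value m T y \<noteq> 0}. \<kappa> (fst p) (snd p))"
          by (rule INF_greatest)
        moreover have "c \<le> of_nat m"
          using r k m(3) by (simp add: ennreal_of_nat_eq_real_of_nat)
        ultimately have "c \<le> ennreal (cell_inf m S T)"
          by (simp add: ennreal_cell_inf)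
        then have "r \<le> cell_inf m S T"
          using r cell_inf_nonneg by simp
        then show ?thesis
          by (intro mult_right_mono cell_value_nonneg)
      qed auto
    qed
    finally show ?thesis
      using r by (simp add: ennreal_leI)
  qed
  then show ?thesis
    unfolding eventually_sequentially by (intro exI[of _ "Suc (i + j + k)"]) auto
qed

lemma nn_integral_step_kernel:
  assumes P: "locally_finite_borel P" and Q: "locally_finite_borel Q"
  shows "(\<integral>\<^sup>+x. (\<integral>\<^sup>+y. ennreal (step_kernel m x y) \<partial>Q) \<partial>P) = ennreal (step_energy m P Q)"
proof -
  have inner: "(\<integral>\<^sup>+y. ennreal (step_kernel m x y) \<partial>Q) =
      ennreal (\<Sum>S\<in>cells m. (\<Sum>T\<in>cells m. cell_inf m S T * functional_of Q (cell m T)) * cc_apply (cell m S) x)" for x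
  proof -
    have *: "step_kernel m x y = (\<Sum>T\<in>cells m. (\<Sum>S\<in>cells m. cell_inf m S T * cell_value m S x) * cc_apply (cell m T) y)" for y
      unfolding step_kernel_def by (subst sum.swap) (simp add: cc_apply_cell sum_distrib_right)
    have "(\<integral>\<^sup>+y. ennreal (step_kernel m x y) \<partial>Q) =
        ennreal (\<Sum>T\<in>cells m. (\<Sum>S\<in>cells m. cell_inf m S T * cell_value m S x) * functional_of Q (cell m T))"
      unfolding * by (rule nn_integral_cc_sum[OF Q]) (simp add: step_kernel_nonneg flip: *)
    also have "(\<Sum>T\<in>cells m. (\<Sum>S\<in>cells m. cell_inf m S T * cell_value m S x) * functional_of Q (cell m T)) =
        (\<Sum>S\<in>cells m. (\<Sum>T\<in>cells m. cell_inf m S T * functional_of Q (cell m T)) * cc_apply (cell m S) x)"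
      unfolding sum_distrib_right by (subst sum.swap) (intro sum.cong, auto simp: cc_apply_cell)
    finally show ?thesis .
  qed
  have fn: "0 \<le> functional_of Q (cell m T)" if "T \<in> cells m" for T
    using that by (intro functional_of_nonneg) (simp add: cc_apply_cell cell_value_nonneg)
  have "(\<integral>\<^sup>+x. (\<integral>\<^sup>+y. ennreal (step_kernel m x y) \<partial>Q) \<partial>P) =
      ennreal (\<Sum>S\<in>cells m. (\<Sum>T\<in>cells m. cell_inf m S T * functional_of Q (cell m T)) * functional_of P (cell m S))"
    unfolding inner
    by (intro nn_integral_cc_sum[OF P] sum_nonneg mult_nonneg_nonneg cell_inf_nonneg fn)
       (auto simp: cc_apply_cell cell_value_nonneg)
  also have "(\<Sum>S\<in>cells m. (\<Sum>T\<in>cells m. cell_inf m S T * functional_of Q (cell m T)) * functional_of P (cell m S)) = step_energy m P Q"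
    unfolding step_energy_def sum_distrib_right by (intro sum.cong refl) (simp add: mult_ac)
  finally show ?thesis .
qed

lemma step_energy_le:
  assumes P: "locally_finite_borel P" and Q: "locally_finite_borel Q"
  shows "ennreal (step_energy m P Q) \<le> energy P Q"
  unfolding nn_integral_step_kernel[OF P Q, symmetric] energy_iterated[OF P Q] pot_def
  by (intro nn_integral_mono step_kernel_le)

lemma step_kernel_measurable: "(\<lambda>p. ennreal (step_kernel m (fst p) (snd p))) \<in> borel_measurable (borel \<Otimes>\<^sub>M borel)"
proof -
  have "cell_value m S \<in> borel_measurable borel" for S
    unfolding cell_value_def[abs_def] 
    by (intro borel_measurable_continuous_onI continuous_intros continuous_cc_apply)
  then show ?thesis
    unfolding step_kernel_def by measurable
qed

text \<open>By Fatou's lemma, since the step kernels converge to \<open>\<kappa>\<close> pointwise.\<close>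

lemma step_energy_approx:
  assumes P: "locally_finite_borel P" and Q: "locally_finite_borel Q" and c: "c < energy P Q"
  shows "\<exists>m. c < ennreal (step_energy m P Q)"
proof (rule ccontr)
  assume "\<not> ?thesis"
  then have le: "ennreal (step_energy m P Q) \<le> c" for m
    by (auto simp: not_less)
  interpret sigma_finite_measure Q
    by (rule sigma_finite_lf[OF Q])
  have meas: "(\<lambda>p. ennreal (step_kernel m (fst p) (snd p))) \<in> borel_measurable (P \<Otimes>\<^sub>M Q)" for m
    using step_kernel_measurable measurable_cong_sets[OF sets_pair_measure_cong[OF sets_lf[OF P] sets_lf[OF Q]] refl] by blast
  have "\<kappa> x y \<le> liminf (\<lambda>m. ennreal (step_kernel m x y))" for x y
  proof (rule dense_le)
    fix d assume "d < \<kappa> x y"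
    then show "d \<le> liminf (\<lambda>m. ennreal (step_kernel m x y))"
      by (intro Liminf_bounded step_kernel_approx)
  qed
  then have "energy P Q \<le> (\<integral>\<^sup>+p. liminf (\<lambda>m. ennreal (step_kernel m (fst p) (snd p))) \<partial>(P \<Otimes>\<^sub>M Q))"
    unfolding product_energy_def by (intro nn_integral_mono) simp
  also have "\<dots> \<le> liminf (\<lambda>m. \<integral>\<^sup>+p. ennreal (step_kernel m (fst p) (snd p)) \<partial>(P \<Otimes>\<^sub>M Q))"
    by (intro nn_integral_liminf meas)
  also have "\<dots> = liminf (\<lambda>m. ennreal (step_energy m P Q))"
    using nn_integral_fst[OF meas] nn_integral_step_kernel[OF P Q] by simp
  also have "\<dots> \<le> c"
  proof -
    have "liminf (\<lambda>m. ennreal (step_energy m P Q)) \<le> liminf (\<lambda>m. c)"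
      by (intro Liminf_mono always_eventually allI le)
    then show ?thesis by (simp add: Liminf_const)
  qed
  finally show False
    using c by simp
qed

lemma step_energy_tendsto:
  assumes "\<And>f. ((\<lambda>i. functional_of (P i) f) \<longlongrightarrow> functional_of P0 f) F"
    and "\<And>f. ((\<lambda>i. functional_of (Q i) f) \<longlongrightarrow> functional_of Q0 f) F"
  shows "((\<lambda>i. step_energy m (P i) (Q i)) \<longlongrightarrow> step_energy m P0 Q0) F"
  unfolding step_energy_def by (intro tendsto_sum tendsto_mult tendsto_const assms)

text \<open>The vaguely continuous step energies have the mutual energy as their supremum.\<close>

lemma energy_vague_lsc:
  assumes F: "F \<noteq> bot"
    and lf: "\<And>i. locally_finite_borel (P i)" "\<And>i. locally_finite_borel (Q i)"
      "locally_finite_borel P0" "locally_finite_borel Q0"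
    and P: "\<And>f. ((\<lambda>i. functional_of (P i) f) \<longlongrightarrow> functional_of P0 f) F"
    and Q: "\<And>f. ((\<lambda>i. functional_of (Q i) f) \<longlongrightarrow> functional_of Q0 f) F"
    and le: "\<forall>\<^sub>F i in F. energy (P i) (Q i) \<le> c"
  shows "energy P0 Q0 \<le> c"
proof (rule ccontr)
  assume "\<not> ?thesis"
  then obtain m where "c < ennreal (step_energy m P0 Q0)"
    using step_energy_approx[OF lf(3,4)] by (auto simp: not_le)
  moreover have "((\<lambda>i. ennreal (step_energy m (P i) (Q i))) \<longlongrightarrow> ennreal (step_energy m P0 Q0)) F"
    by (intro tendsto_ennrealI step_energy_tendsto P Q)
  ultimately have "\<forall>\<^sub>F i in F. c < ennreal (step_energy m (P i) (Q i))"
    by (rule order_tendstoD(1)[rotated])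
  with le have "\<forall>\<^sub>F i in F. False"
    by eventually_elim (use step_energy_le[OF lf(1,2)] in \<open>meson leD le_less_trans order_trans\<close>)
  then show False
    using F by (simp add: trivial_limit_def)
qed

text \<open>A potential is a mutual energy with a Dirac measure, and the step energies of Dirac measures are continuous
  in the point.\<close>

lemma pot_lsc:
  assumes P: "locally_finite_borel P"
  shows "open {x. c < pot P x}"
proof -
  have cont: "continuous_on UNIV (\<lambda>x. step_energy m (dirac x) P)" for m
    unfolding step_energy_def functional_of_dirac by (intro continuous_intros continuous_cc_apply)
  have "{x. c < pot P x} = (\<Union>m. {x. c < ennreal (step_energy m (dirac x) P)})"
    using step_energy_approx[OF locally_finite_dirac P] step_energy_le[OF locally_finite_dirac P]
    by (auto simp: energy_dirac[OF P] intro: less_le_trans)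
  moreover have "open {x. c < ennreal (step_energy m (dirac x) P)}" for m
    by (intro open_Collect_less continuous_on_const continuous_on_ennreal cont)
  ultimately show ?thesis
    by auto
qed

end

section \<open>Vague compactness\<close>

context lc_space
begin

text \<open>The functionals lie in a product of compact intervals. A cluster point in this product is again linear and
  nonnegative, hence a measure. The filter \<open>F\<close> plays the role of a convergent subnet.\<close>

lemma vague_cluster_point:
  fixes P :: "nat \<Rightarrow> 'a measure"
  assumes lf: "\<And>n. locally_finite_borel (P n)"
    and bound: "\<And>K. compact K \<Longrightarrow> \<exists>C. \<forall>n. measure (P n) K \<le> C"
  shows "\<exists>P0 F. locally_finite_borel P0 \<and> F \<noteq> bot \<and> F \<le> sequentially \<and>
    ((\<lambda>n. functional_of (P n)) \<longlongrightarrow> functional_of P0) F \<and>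
    (\<forall>f. ((\<lambda>n. functional_of (P n) f) \<longlongrightarrow> functional_of P0 f) F)"
proof -
  let ?\<phi> = "\<lambda>n. functional_of (P n)"
  obtain C where C: "\<And>K n. compact K \<Longrightarrow> measure (P n) K \<le> C K"
    using bound by metis
  define B where "B f = C (cc_support f) * sup_dist f 0" for f :: "'a ccfun"
  have bd: "\<bar>?\<phi> n f\<bar> \<le> B f" for n f
  proof -
    have "\<bar>?\<phi> n f\<bar> \<le> measure (P n) (cc_support f) * sup_dist f 0"
      by (intro functional_of_bound lf compact_cc_support) (simp add: ccfun_on_iff)
    also have "\<dots> \<le> B f"
      unfolding B_def using order_trans[OF abs_ge_zero cc_apply_le_sup_dist[of f undefined]]
      by (intro mult_right_mono C compact_cc_support)
    finally show ?thesis .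
  qed
  have "compactin (product_topology (\<lambda>_. euclideanreal) UNIV) (PiE UNIV (\<lambda>f. {- B f..B f}))"
    unfolding compactin_PiE by simp
  then have cpt: "compact (PiE UNIV (\<lambda>f. {- B f..B f}))"
    by (metis compactin_euclidean_iff euclidean_product_topology)
  have in_box: "?\<phi> n \<in> PiE UNIV (\<lambda>f. {- B f..B f})" for n
    using bd[of n] by (auto simp: PiE_def abs_le_iff minus_le_iff)
  have "filtermap ?\<phi> sequentially \<noteq> bot"
    by (simp add: filtermap_bot_iff)
  moreover have "\<forall>\<^sub>F \<psi> in filtermap ?\<phi> sequentially. \<psi> \<in> PiE UNIV (\<lambda>f. {- B f..B f})"
    using in_box by (simp add: eventually_filtermap)
  ultimately obtain \<phi>0 where \<phi>0: "inf (nhds \<phi>0) (filtermap ?\<phi> sequentially) \<noteq> bot"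
    using cpt[unfolded compact_filter] by blast
  define F where "F = inf sequentially (filtercomap ?\<phi> (nhds \<phi>0))"
  have F: "F \<noteq> bot"
  proof
    assume "F = bot"
    then have "eventually (\<lambda>_. False) F"
      by simp
    then obtain Q1 Q2 where Q: "eventually Q1 sequentially" "eventually Q2 (filtercomap ?\<phi> (nhds \<phi>0))"
        "\<And>n. Q1 n \<Longrightarrow> Q2 n \<Longrightarrow> False"
      unfolding F_def eventually_inf by blast
    obtain Q' where Q': "eventually Q' (nhds \<phi>0)" "\<And>n. Q' (?\<phi> n) \<Longrightarrow> Q2 n"
      using Q(2) unfolding eventually_filtercomap by blast
    have "eventually (\<lambda>\<psi>. \<not> Q' \<psi>) (filtermap ?\<phi> sequentially)"
      unfolding eventually_filtermap using Q(1) by eventually_elim (use Q' Q(3) in blast)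
    then have "eventually (\<lambda>_. False) (inf (nhds \<phi>0) (filtermap ?\<phi> sequentially))"
      unfolding eventually_inf using Q'(1) by blast
    then show False
      using \<phi>0 by (simp add: eventually_False)
  qed
  have Fseq: "F \<le> sequentially"
    by (simp add: F_def)
  have "filterlim ?\<phi> (nhds \<phi>0) F"
    unfolding filterlim_def F_def
    by (rule order_trans[OF filtermap_mono[OF inf_le2] filtermap_filtercomap])
  then have lim\<phi>: "(?\<phi> \<longlongrightarrow> \<phi>0) F" .
  have lim: "((\<lambda>n. ?\<phi> n f) \<longlongrightarrow> \<phi>0 f) F" for f
  proof -
    have "continuous_on UNIV (\<lambda>\<psi> :: 'a ccfun \<Rightarrow> real. \<psi> f)"
      by (rule continuous_on_product_coordinates)
    from continuous_on_tendsto_compose[OF this lim\<phi>] show ?thesis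
      by simp
  qed
  have "positive_functional \<phi>0"
  proof (unfold positive_functional_def positive_functional_axioms_def, intro conjI allI impI)
    show "lc_space TYPE('a)"
      by (rule lc_space_axioms)
    show "linear \<phi>0"
    proof (rule linearI)
      fix f g :: "'a ccfun"
      have "((\<lambda>n. ?\<phi> n f + ?\<phi> n g) \<longlongrightarrow> \<phi>0 f + \<phi>0 g) F"
        by (intro tendsto_add lim)
      then show "\<phi>0 (f + g) = \<phi>0 f + \<phi>0 g"
        using tendsto_unique[OF F lim[of "f + g"]] by (simp add: linear_add[OF linear_functional_of[OF lf]])
    next
      fix c :: real and f :: "'a ccfun"
      have "((\<lambda>n. c * ?\<phi> n f) \<longlongrightarrow> c * \<phi>0 f) F"
        by (intro tendsto_mult tendsto_const lim)
      then show "\<phi>0 (c *\<^sub>R f) = c *\<^sub>R \<phi>0 f"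
        using tendsto_unique[OF F lim[of "c *\<^sub>R f"]] by (simp add: linear_scale[OF linear_functional_of[OF lf]])
    qed
    fix f :: "'a ccfun" assume "\<forall>x. 0 \<le> cc_apply f x"
    then show "0 \<le> \<phi>0 f"
      by (intro tendsto_lowerbound[OF lim _ F] always_eventually) (auto intro: functional_of_nonneg)
  qed
  then interpret positive_functional \<phi>0 .
  have "functional_of riesz_measure = \<phi>0"
    using riesz_representation by (simp add: functional_of_def fun_eq_iff)
  then show ?thesis
    using F Fseq lim lim\<phi> locally_finite_riesz_measure by (intro exI[of _ riesz_measure] exI[of _ F]) auto
qed

end

section \<open>The pre-Hilbert space of measures of finite energy\<close>

lemma nonneg_quadratic_discriminant:
  fixes a b c :: real
  assumes "\<And>t. 0 \<le> c + 2 * t * b + t\<^sup>2 * a" "0 \<le> a"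
  shows "b\<^sup>2 \<le> a * c"
proof (cases "a = 0")
  case True
  have "b = 0"
  proof (rule ccontr)
    assume "b \<noteq> 0"
    then show False
      using assms(1)[of "- (c + 1) / (2 * b)"] True by (simp add: field_simps)
  qed
  then show ?thesis
    using True by simp
next
  case False
  then have "0 \<le> a * (c + 2 * (- b / a) * b + (- b / a)\<^sup>2 * a)"
    by (intro mult_nonneg_nonneg assms(2) assms(1))
  also have "\<dots> = a * c - b\<^sup>2"
    using False by (simp add: field_simps power2_eq_square)
  finally show ?thesis by simp
qed

locale energy_kernel = lsc_kernel \<kappa>
  for \<kappa> :: "'a::{t2_space,second_countable_topology} \<Rightarrow> 'a \<Rightarrow> ennreal" +
  assumes energy_principle: "energy_principle \<kappa>"
    and consistency: "consistency_principle \<kappa>"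
    and domination: "domination_principle \<kappa>"
begin

definition fin_energy :: "'a measure \<Rightarrow> bool" where
  "fin_energy P \<longleftrightarrow> locally_finite_borel P \<and> energy P P < \<infinity>"

definition ip :: "'a measure \<Rightarrow> 'a measure \<Rightarrow> real" where
  "ip P Q = enn2real (energy P Q)"

definition sqdist :: "'a measure \<Rightarrow> 'a measure \<Rightarrow> real" where
  "sqdist P Q = ip P P + ip Q Q - 2 * ip P Q"

lemma fin_lf: "fin_energy P \<Longrightarrow> locally_finite_borel P"
  by (simp add: fin_energy_def)

lemma pot_null_measure: "pot (null_measure borel) x = 0"
  by (simp add: pot_def)

lemma energy_null_measure:
  assumes "locally_finite_borel P"
  shows "energy P (null_measure borel) = 0" "energy (null_measure borel) P = 0"
proof -
  show *: "energy P (null_measure borel) = 0"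
    by (simp add: energy_iterated[OF assms locally_finite_null_measure] pot_null_measure)
  show "energy (null_measure borel) P = 0"
    using energy_sym[OF assms locally_finite_null_measure] * by simp
qed

lemma mutual_energy_functional_of:
  assumes "locally_finite_borel P"
  shows "energy_pos \<kappa> (functional_of P) (functional_of P) = energy P P"
    "energy_neg \<kappa> (functional_of P) (functional_of P) = 0"
    "mutual_energy \<kappa> (functional_of P) (functional_of P) = enn2ereal (energy P P)"
proof -
  show p: "energy_pos \<kappa> (functional_of P) (functional_of P) = energy P P"
    by (simp add: energy_pos_def functional_of_parts[OF assms] energy_null_measure locally_finite_null_measure)
  show n: "energy_neg \<kappa> (functional_of P) (functional_of P) = 0"
    by (simp add: energy_neg_def functional_of_parts[OF assms] energy_null_measure assms)
  show "mutual_energy \<kappa> (functional_of P) (functional_of P) = enn2ereal (energy P P)"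
    by (simp add: mutual_energy_def p n zero_ennreal.rep_eq)
qed

lemma potential_functional_of:
  assumes "locally_finite_borel P"
  shows "potential \<kappa> (functional_of P) x = enn2ereal (pot P x)"
  by (simp add: potential_def functional_of_parts[OF assms] pot_def zero_ennreal.rep_eq)

lemma potential_le_iff:
  assumes "locally_finite_borel P" "locally_finite_borel Q"
  shows "potential \<kappa> (functional_of P) x \<le> potential \<kappa> (functional_of Q) x \<longleftrightarrow> pot P x \<le> pot Q x"
  by (simp add: potential_functional_of assms less_eq_ennreal.rep_eq)

lemma pos_finite_energy_iff:
  "\<phi> \<in> pos_finite_energy \<kappa> \<longleftrightarrow> (\<exists>P. fin_energy P \<and> \<phi> = functional_of P)"
proof
  assume \<phi>: "\<phi> \<in> pos_finite_energy \<kappa>"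
  then obtain P where P: "locally_finite_borel P" "\<phi> = functional_of P"
    using pos_radon_measuresE[of \<phi>] by (auto simp: pos_finite_energy_def)
  have "\<bar>enn2ereal (energy P P)\<bar> \<noteq> \<infinity>"
    using \<phi> mutual_energy_functional_of(3)[OF P(1)] by (simp add: pos_finite_energy_def finite_energy_def P(2))
  then have "energy P P < \<infinity>"
    by (cases "energy P P") (auto simp: top_ennreal.rep_eq)
  then show "\<exists>P. fin_energy P \<and> \<phi> = functional_of P"
    using P by (auto simp: fin_energy_def)
next
  assume "\<exists>P. fin_energy P \<and> \<phi> = functional_of P"
  then obtain P where P: "locally_finite_borel P" "energy P P < \<infinity>" "\<phi> = functional_of P"
    by (auto simp: fin_energy_def)
  have "\<bar>enn2ereal (energy P P)\<bar> \<noteq> \<infinity>"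
    using P(2) by (cases "energy P P") (auto simp: enn2ereal_ennreal)
  then show "\<phi> \<in> pos_finite_energy \<kappa>"
    using P functional_of_pos_radon[OF P(1)]
    by (simp add: pos_finite_energy_def finite_energy_def mutual_energy_defined_def pos_radon_measures_def
        mutual_energy_functional_of)
qed

text \<open>For \<open>P, Q\<close> of finite energy the energy principle is applied to \<open>P - Q\<close>, whose Hahn--Jordan parts
  \<open>P', Q'\<close> have finite energy. Were \<open>\<kappa>(P', Q')\<close> infinite, the energy of \<open>P - Q\<close> would be
  \<open>-\<infinity>\<close>. Restoring the common part gives the finiteness of \<open>\<kappa>(P, Q)\<close>.\<close>

lemma energy_difference:
  assumes P: "fin_energy P" and Q: "fin_energy Q"
  shows "energy P Q < \<infinity>"
    and "mutual_energy \<kappa> (\<lambda>f. functional_of P f - functional_of Q f) (\<lambda>f. functional_of P f - functional_of Q f)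
      = ereal (sqdist P Q)"
    and "0 \<le> sqdist P Q" and "sqdist P Q = 0 \<Longrightarrow> P = Q"
proof -
  let ?\<phi> = "\<lambda>f. functional_of P f - functional_of Q f"
  obtain P' Q' Z where lf: "locally_finite_borel P'" "locally_finite_borel Q'" "locally_finite_borel Z"
    and PQ: "P = add_measure P' Z" "Q = add_measure Q' Z" and hj: "hahn_jordan ?\<phi> P' Q'"
    using hahn_jordan_exists[OF fin_lf[OF P] fin_lf[OF Q]] by metis
  have PP: "energy P P = energy P' P' + 2 * energy P' Z + energy Z Z"
    unfolding PQ by (simp add: energy_add_left energy_add_right lf lf_add_measure energy_sym[OF lf(3,1)] mult_2 ac_simps)
  have QQ: "energy Q Q = energy Q' Q' + 2 * energy Q' Z + energy Z Z"
    unfolding PQ by (simp add: energy_add_left energy_add_right lf lf_add_measure energy_sym[OF lf(3,2)] mult_2 ac_simps)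
  have PQe: "energy P Q = energy P' Q' + energy P' Z + energy Q' Z + energy Z Z"
    unfolding PQ by (simp add: energy_add_left energy_add_right lf lf_add_measure energy_sym[OF lf(3,2)] ac_simps)
  have fin: "energy P' P' < top" "energy P' Z < top" "energy Z Z < top" "energy Q' Q' < top" "energy Q' Z < top"
    using P Q PP QQ by (auto simp: fin_energy_def ennreal_add_less_top ennreal_mult_less_top)
  have pos: "energy_pos \<kappa> ?\<phi> ?\<phi> = energy P' P' + energy Q' Q'"
    by (simp add: energy_pos_def hahn_jordan_parts[OF hj])
  have neg: "energy_neg \<kappa> ?\<phi> ?\<phi> = 2 * energy P' Q'"
    by (simp add: energy_neg_def hahn_jordan_parts[OF hj] energy_sym[OF lf(2,1)] mult_2)
  have "mutual_energy_defined \<kappa> ?\<phi> ?\<phi>"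
    using fin by (simp add: mutual_energy_defined_def pos)
  moreover have "?\<phi> \<in> radon_measures"
    by (intro functional_of_diff_radon fin_lf P Q)
  ultimately have ep: "0 \<le> mutual_energy \<kappa> ?\<phi> ?\<phi>" "mutual_energy \<kappa> ?\<phi> ?\<phi> = 0 \<Longrightarrow> ?\<phi> = (\<lambda>_. 0)"
    using energy_principle unfolding energy_principle_def by blast+
  obtain a where a: "energy P' P' = ennreal a" "0 \<le> a" using fin(1) by (cases "energy P' P'") auto
  obtain b where b: "energy Q' Q' = ennreal b" "0 \<le> b" using fin(4) by (cases "energy Q' Q'") auto
  obtain u where u: "energy P' Z = ennreal u" "0 \<le> u" using fin(2) by (cases "energy P' Z") auto
  obtain v where v: "energy Q' Z = ennreal v" "0 \<le> v" using fin(5) by (cases "energy Q' Z") auto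
  obtain z where z: "energy Z Z = ennreal z" "0 \<le> z" using fin(3) by (cases "energy Z Z") auto
  have "energy P' Q' \<noteq> top"
  proof
    assume "energy P' Q' = top"
    then have "mutual_energy \<kappa> ?\<phi> ?\<phi> = - \<infinity>"
      using a b by (simp add: mutual_energy_def pos neg ennreal_mult_top enn2ereal_ennreal top_ennreal.rep_eq flip: ennreal_plus)
    then show False
      using ep(1) by simp
  qed
  then obtain w where w: "energy P' Q' = ennreal w" "0 \<le> w" by (cases "energy P' Q'") auto
  have two: "(2::ennreal) = ennreal 2" by simp
  show "energy P Q < \<infinity>"
    unfolding PQe by (simp add: u v w z)
  have ips: "ip P P = a + 2 * u + z" "ip Q Q = b + 2 * v + z" "ip P Q = w + u + v + z"
    unfolding ip_def PP QQ PQe using a b u v w z by (simp_all add: two flip: ennreal_mult ennreal_plus del: ennreal_numeral)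
  have sd: "sqdist P Q = a + b - 2 * w"
    by (simp add: sqdist_def ips)
  show me: "mutual_energy \<kappa> ?\<phi> ?\<phi> = ereal (sqdist P Q)"
    unfolding mutual_energy_def pos neg sd using a b w
    by (simp add: two enn2ereal_ennreal flip: ennreal_mult ennreal_plus del: ennreal_numeral)
  show "0 \<le> sqdist P Q"
    using ep(1) me by simp
  assume "sqdist P Q = 0"
  then have "?\<phi> = (\<lambda>_. 0)"
    using ep(2) me by (simp add: zero_ereal_def)
  then have "functional_of P f - functional_of Q f = 0" for f
    by meson
  then show "P = Q"
    by (intro measure_eqI_functional fin_lf P Q) (simp add: fun_eq_iff)
qed

lemma strong_dist_functional_of:
  assumes "fin_energy P" "fin_energy Q"
  shows "strong_dist \<kappa> (functional_of P) (functional_of Q) = sqrt (sqdist P Q)"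
  by (simp add: strong_dist_def energy_norm_def energy_difference(2)[OF assms])

lemma energy_eq_ip:
  assumes "fin_energy P" "fin_energy Q"
  shows "energy P Q = ennreal (ip P Q)"
  using energy_difference(1)[OF assms] by (simp add: ip_def)

lemma ip_nonneg: "0 \<le> ip P Q"
  by (simp add: ip_def)

lemma ip_sym: "fin_energy P \<Longrightarrow> fin_energy Q \<Longrightarrow> ip P Q = ip Q P"
  by (simp add: ip_def energy_sym fin_lf)

lemma sqdist_sym: "fin_energy P \<Longrightarrow> fin_energy Q \<Longrightarrow> sqdist P Q = sqdist Q P"
  by (simp add: sqdist_def ip_sym)

lemma fin_null_measure: "fin_energy (null_measure borel)"
  by (simp add: fin_energy_def energy_null_measure locally_finite_null_measure)

lemma fin_add_measure:
  assumes "fin_energy P" "fin_energy Q"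
  shows "fin_energy (add_measure P Q)"
  using assms energy_difference(1)[OF assms] energy_difference(1)[OF assms(2,1)]
  by (simp add: fin_energy_def lf_add_measure energy_add_left energy_add_right)

lemma fin_scale_measure:
  assumes "fin_energy P"
  shows "fin_energy (scale_measure (ennreal c) P)"
  using assms by (simp add: fin_energy_def lf_scale_measure energy_scale_left energy_scale_right ennreal_mult_less_top)

lemma ip_add_left:
  assumes "fin_energy P" "fin_energy Q" "fin_energy R"
  shows "ip (add_measure P Q) R = ip P R + ip Q R"
  using assms energy_difference(1)[OF assms(1,3)] energy_difference(1)[OF assms(2,3)]
  by (simp add: ip_def energy_add_left fin_lf enn2real_plus)

lemma ip_add_right:
  assumes "fin_energy P" "fin_energy Q" "fin_energy R"
  shows "ip R (add_measure P Q) = ip R P + ip R Q"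
  using ip_add_left[OF assms] ip_sym assms fin_add_measure by metis

lemma ip_scale_left:
  assumes "fin_energy P" "fin_energy R" "0 \<le> c"
  shows "ip (scale_measure (ennreal c) P) R = c * ip P R"
  using assms by (simp add: ip_def energy_scale_left fin_lf enn2real_mult)

lemma ip_scale_right:
  assumes "fin_energy P" "fin_energy R" "0 \<le> c"
  shows "ip R (scale_measure (ennreal c) P) = c * ip R P"
  using assms by (simp add: ip_def energy_scale_right fin_lf enn2real_mult)

lemmas ip_simps = ip_add_left ip_add_right ip_scale_left ip_scale_right fin_add_measure fin_scale_measure

text \<open>The Cauchy--Schwarz inequality for \<open>M\<close> and \<open>P - Q\<close>: the square of the norm of \<open>P - Q + t M\<close>
  is a nonnegative quadratic polynomial in \<open>t\<close>. To stay within positive measures, \<open>\<bar>t\<bar> M\<close> is added to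
  \<open>P\<close> or to \<open>Q\<close> according to the sign of \<open>t\<close>.\<close>

lemma ip_diff_bound:
  assumes M: "fin_energy M" and P: "fin_energy P" and Q: "fin_energy Q"
  shows "\<bar>ip M P - ip M Q\<bar> \<le> sqrt (ip M M) * sqrt (sqdist P Q)"
proof -
  have "0 \<le> sqdist P Q + 2 * t * (ip M P - ip M Q) + t\<^sup>2 * ip M M" for t
  proof (cases "0 \<le> t")
    case True
    have "0 \<le> sqdist (add_measure P (scale_measure (ennreal t) M)) Q"
      by (intro energy_difference(3) fin_add_measure fin_scale_measure M P Q)
    also have "\<dots> = sqdist P Q + 2 * t * (ip M P - ip M Q) + t\<^sup>2 * ip M M"
      using True by (simp add: sqdist_def ip_simps M P Q ip_sym[OF P M] algebra_simps power2_eq_square)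
    finally show ?thesis .
  next
    case False
    have "0 \<le> sqdist P (add_measure Q (scale_measure (ennreal (- t)) M))"
      by (intro energy_difference(3) fin_add_measure fin_scale_measure M P Q)
    also have "\<dots> = sqdist P Q + 2 * t * (ip M P - ip M Q) + t\<^sup>2 * ip M M"
      using False by (simp add: sqdist_def ip_simps M P Q ip_sym[OF P M] ip_sym[OF Q M] algebra_simps power2_eq_square)
    finally show ?thesis .
  qed
  then have "(ip M P - ip M Q)\<^sup>2 \<le> ip M M * sqdist P Q"
    by (rule nonneg_quadratic_discriminant) (rule ip_nonneg)
  then have "sqrt ((ip M P - ip M Q)\<^sup>2) \<le> sqrt (ip M M * sqdist P Q)"
    by (rule real_sqrt_le_mono)
  then show ?thesis
    by (simp add: real_sqrt_mult)
qed

lemma ip_le_norms: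
  assumes "fin_energy P" "fin_energy Q"
  shows "ip P Q \<le> sqrt (ip P P) * sqrt (ip Q Q)"
proof -
  have "ip R (null_measure borel) = 0" if "fin_energy R" for R
    using that by (simp add: ip_def energy_null_measure fin_lf)
  then have "sqdist Q (null_measure borel) = ip Q Q" "ip P (null_measure borel) = 0"
    using assms fin_null_measure by (simp_all add: sqdist_def)
  then show ?thesis
    using ip_diff_bound[OF assms fin_null_measure] by simp
qed

lemma norm_triangle:
  assumes P: "fin_energy P" and Q: "fin_energy Q"
  shows "sqrt (ip P P) \<le> sqrt (ip Q Q) + sqrt (sqdist P Q)"
proof -
  have "(sqrt (ip P P) - sqrt (ip Q Q))\<^sup>2 \<le> sqdist P Q"
    using ip_le_norms[OF P Q] by (simp add: sqdist_def power2_diff ip_nonneg)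
  then have "sqrt ((sqrt (ip P P) - sqrt (ip Q Q))\<^sup>2) \<le> sqrt (sqdist P Q)"
    by (rule real_sqrt_le_mono)
  then show ?thesis by simp
qed

lemma pot_eq_imp_eq:
  assumes P: "fin_energy P" and Q: "fin_energy Q" and eq: "\<And>x. pot P x = pot Q x"
  shows "P = Q"
proof -
  have "pot P = pot Q"
    using eq by blast
  then have "energy R P = energy R Q" if "fin_energy R" for R
    using that P Q by (simp add: energy_iterated fin_lf)
  then have "ip P P = ip P Q" "ip Q P = ip Q Q"
    using P Q by (simp_all add: ip_def)
  then have "sqdist P Q = 0"
    using ip_sym[OF P Q] by (simp add: sqdist_def)
  then show ?thesis
    by (rule energy_difference(4)[OF P Q])
qed

end

lemma (in lc_space) null_openI:
  assumes P: "locally_finite_borel (P :: 'a measure)" and U: "open U"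
    and 0: "\<And>f. (\<And>x. 0 \<le> cc_apply f x) \<Longrightarrow> cc_support f \<subseteq> U \<Longrightarrow> functional_of P f = 0"
  shows "emeasure P U = 0"
proof -
  obtain K :: "nat \<Rightarrow> 'a set" where K: "\<And>n. compact (K n)" "(\<Union>n. K n) = U"
    using open_compact_exhaustion[OF U] by blast
  have "emeasure P (K n) = 0" for n
  proof -
    obtain f where f: "\<And>x. 0 \<le> cc_apply f x" "\<And>x. x \<in> K n \<Longrightarrow> cc_apply f x = 1" "cc_support f \<subseteq> U"
      using bump_function[OF K(1) U, of n] K(2) by blast
    have "emeasure P (K n) \<le> ennreal (functional_of P f)"
      using f by (intro emeasure_compact_le_functional P K) auto
    then show ?thesis
      using 0[OF f(1,3)] by simp
  qed
  then have "emeasure P (\<Union>n. K n) = 0"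
    using K by (intro emeasure_UN_eq_0) (auto simp: sets_lf[OF P] borel_compact)
  then show ?thesis
    using K by simp
qed

lemma functional_of_null_support:
  assumes P: "locally_finite_borel P" and "emeasure P U = 0" "U \<in> sets borel" "cc_support f \<subseteq> U"
  shows "functional_of P f = 0"
proof -
  have "AE x in P. x \<notin> U"
    using assms by (intro AE_not_in) (auto simp: null_sets_def sets_lf)
  then have "AE x in P. cc_apply f x = 0"
    by eventually_elim (use assms(4) cc_apply_eq_0 in blast)
  then have "(\<integral>x. cc_apply f x \<partial>P) = (\<integral>x. 0 \<partial>P)"
    by (intro integral_cong_AE) (auto intro: measurable_cc_apply[OF sets_lf[OF P]])
  then show ?thesis
    by (simp add: functional_of_def)
qed

section \<open>Strong completeness\<close>

context energy_kernel
begin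

text \<open>The Dirac measure at \<open>x\<close> is a nonzero measure with energy \<open>\<kappa>(x, x)\<close>.\<close>

lemma kernel_diagonal_pos: "0 < \<kappa> x x"
proof (rule ccontr)
  assume "\<not> 0 < \<kappa> x x"
  then have "energy (dirac x) (dirac x) = 0"
    by (simp add: energy_dirac[OF locally_finite_dirac] pot_def nn_integral_dirac kernel_measurable_section)
  then have fin: "fin_energy (dirac x)" and "ip (dirac x) (dirac x) = 0"
    by (simp_all add: fin_energy_def locally_finite_dirac ip_def)
  then have "sqdist (dirac x) (null_measure borel) = 0"
    using ip_diff_bound[OF fin fin fin_null_measure]
    by (simp add: sqdist_def ip_def energy_null_measure locally_finite_null_measure locally_finite_dirac)
  then have "dirac x = null_measure borel"
    by (intro energy_difference(4) fin fin_null_measure)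
  then have "cc_apply f x = 0" for f
    using functional_of_dirac[of x f] functional_of_null_measure[of f] by simp
  then show False
    using bump(3)[OF open_UNIV, of x] by simp
qed

text \<open>Near a point \<open>x\<close> the kernel stays above a constant \<open>d > 0\<close>, so \<open>d \<mu>(U)\<^sup>2 \<le> \<kappa>(\<mu>, \<mu>)\<close> for
  a neighbourhood \<open>U\<close> of \<open>x\<close>; finitely many such neighbourhoods cover a compact set.\<close>

lemma mass_bound_local:
  "\<exists>U d. open U \<and> x \<in> U \<and> (\<forall>P. fin_energy P \<longrightarrow> emeasure P U \<le> ennreal (d * sqrt (ip P P)))"
proof -
  obtain e where e: "0 < e" "e < \<kappa> x x"
    using dense[OF kernel_diagonal_pos] by blast
  then obtain d where d: "e = ennreal d" "0 < d"
    by (cases e) auto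
  have "(x, x) \<in> {p. e < \<kappa> (fst p) (snd p)}"
    using e by simp
  then obtain U V where UV: "open U" "open V" "(x, x) \<in> U \<times> V" "U \<times> V \<subseteq> {p. e < \<kappa> (fst p) (snd p)}"
    by (rule open_prod_elim[OF kernel_open])
  define W where "W = U \<inter> V"
  have W: "open W" "x \<in> W" "\<And>y z. y \<in> W \<Longrightarrow> z \<in> W \<Longrightarrow> e \<le> \<kappa> y z"
    using UV by (auto simp: W_def subset_iff less_imp_le)
  have "emeasure P W \<le> ennreal (1 / sqrt d * sqrt (ip P P))" if P: "fin_energy P" for P
  proof -
    have Wm: "W \<in> sets P"
      using W(1) by (simp add: sets_lf[OF fin_lf[OF P]])
    have "e * emeasure P W * emeasure P W = (\<integral>\<^sup>+y. (\<integral>\<^sup>+z. e * indicator W z \<partial>P) * indicator W y \<partial>P)"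
      using Wm by (simp add: nn_integral_cmult_indicator)
    also have "\<dots> \<le> (\<integral>\<^sup>+y. pot P y \<partial>P)"
    proof (rule nn_integral_mono)
      fix y
      show "(\<integral>\<^sup>+z. e * indicator W z \<partial>P) * indicator W y \<le> pot P y"
      proof (cases "y \<in> W")
        case True
        have "(\<integral>\<^sup>+z. e * indicator W z \<partial>P) \<le> pot P y"
          unfolding pot_def using W(3)[OF True] by (intro nn_integral_mono) (auto simp: indicator_def)
        then show ?thesis
          using True by simp
      qed simp
    qed
    also have "\<dots> = ennreal (ip P P)"
      using energy_eq_ip[OF P P] energy_iterated[OF fin_lf[OF P] fin_lf[OF P]] by simp
    finally have le: "e * emeasure P W * emeasure P W \<le> ennreal (ip P P)" .
    have "emeasure P W \<noteq> top"
      using le d by (auto simp: ennreal_mult_top top_unique)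
    then obtain w where w: "emeasure P W = ennreal w" "0 \<le> w"
      by (cases "emeasure P W") auto
    have "d * w * w \<le> ip P P"
      using le d w ip_nonneg by (simp add: ennreal_mult[symmetric] del: ennreal_mult)
    then have "sqrt (d * w\<^sup>2) \<le> sqrt (ip P P)"
      by (intro real_sqrt_le_mono) (simp add: power2_eq_square mult.assoc)
    then have "w \<le> 1 / sqrt d * sqrt (ip P P)"
      using d w by (simp add: real_sqrt_mult field_simps)
    then show ?thesis
      using w by (simp add: ennreal_leI)
  qed
  then show ?thesis
    using W by (intro exI[of _ W] exI[of _ "1 / sqrt d"]) blast
qed

lemma mass_bound:
  assumes "compact K"
  shows "\<exists>C\<ge>0. \<forall>P. fin_energy P \<longrightarrow> measure P K \<le> C * sqrt (ip P P)"
proof -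
  obtain U d where U: "\<And>x. open (U x)" "\<And>x. x \<in> U x"
      "\<And>x P. fin_energy P \<Longrightarrow> emeasure P (U x) \<le> ennreal (d x * sqrt (ip P P))"
    using mass_bound_local by metis
  obtain D where D: "D \<subseteq> K" "finite D" "K \<subseteq> (\<Union>x\<in>D. U x)"
    using compactE_image[OF assms, of K U] U by blast
  define C where "C = (\<Sum>x\<in>D. max 0 (d x))"
  have "measure P K \<le> C * sqrt (ip P P)" if P: "fin_energy P" for P
  proof -
    have m: "U x \<in> sets P" for x
      using U(1) by (simp add: sets_lf[OF fin_lf[OF P]])
    have "emeasure P K \<le> emeasure P (\<Union>x\<in>D. U x)"
      using D m by (intro emeasure_mono sets.finite_UN) auto
    also have "\<dots> \<le> (\<Sum>x\<in>D. emeasure P (U x))"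
      using D m by (intro emeasure_subadditive_finite) auto
    also have "\<dots> \<le> (\<Sum>x\<in>D. ennreal (max 0 (d x) * sqrt (ip P P)))"
      by (intro sum_mono order_trans[OF U(3)[OF P]] ennreal_leI mult_right_mono) (auto simp: ip_nonneg)
    also have "\<dots> = ennreal (C * sqrt (ip P P))"
      by (simp add: C_def sum_distrib_right ip_nonneg)
    finally show ?thesis
      by (simp add: measure_def enn2real_leI C_def ip_nonneg sum_nonneg)
  qed
  moreover have "0 \<le> C"
    by (simp add: C_def sum_nonneg)
  ultimately show ?thesis by blast
qed

text \<open>A strong Cauchy sequence has bounded norms, hence bounded masses on compact sets and a vague cluster point,
  which the consistency principle identifies as the strong limit.\<close>

lemma strong_completeness:
  fixes P :: "nat \<Rightarrow> 'a measure"
  assumes fin: "\<And>n. fin_energy (P n)"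
    and Cauchy: "\<And>e. 0 < e \<Longrightarrow> \<exists>N. \<forall>m\<ge>N. \<forall>n\<ge>N. sqdist (P m) (P n) < e"
  shows "\<exists>P0 F. fin_energy P0 \<and> (\<lambda>n. sqdist (P n) P0) \<longlonglongrightarrow> 0 \<and> F \<noteq> bot \<and> F \<le> sequentially \<and>
    (\<forall>f. ((\<lambda>n. functional_of (P n) f) \<longlongrightarrow> functional_of P0 f) F)"
proof -
  obtain N where N: "\<And>m n. N \<le> m \<Longrightarrow> N \<le> n \<Longrightarrow> sqdist (P m) (P n) < 1"
    using Cauchy[of 1] by auto
  define B where "B = (\<Sum>n\<le>N. sqrt (ip (P n) (P n))) + 1"
  have B: "sqrt (ip (P n) (P n)) \<le> B" for n
  proof (cases "n \<le> N")
    case True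
    then have "sqrt (ip (P n) (P n)) \<le> (\<Sum>n\<le>N. sqrt (ip (P n) (P n)))"
      by (intro member_le_sum) (auto simp: ip_nonneg)
    then show ?thesis by (simp add: B_def)
  next
    case False
    have "sqrt (sqdist (P n) (P N)) \<le> 1"
      using N[of n N] False by simp
    moreover have "sqrt (ip (P N) (P N)) \<le> (\<Sum>n\<le>N. sqrt (ip (P n) (P n)))"
      by (intro member_le_sum) (auto simp: ip_nonneg)
    ultimately show ?thesis
      using norm_triangle[OF fin[of n] fin[of N]] unfolding B_def by linarith
  qed
  have "\<exists>C. \<forall>n. measure (P n) K \<le> C" if K: "compact K" for K
  proof -
    obtain C where C: "0 \<le> C" "\<And>P. fin_energy P \<Longrightarrow> measure P K \<le> C * sqrt (ip P P)"
      using mass_bound[OF K] by blast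
    have "measure (P n) K \<le> C * B" for n
      using C(2)[OF fin[of n]] mult_left_mono[OF B[of n] C(1)] by linarith
    then show ?thesis by blast
  qed
  then obtain P0 F where P0: "locally_finite_borel P0" and F: "F \<noteq> bot" "F \<le> sequentially"
    and lim\<phi>: "((\<lambda>n. functional_of (P n)) \<longlongrightarrow> functional_of P0) F"
    and lim: "\<forall>f. ((\<lambda>n. functional_of (P n) f) \<longlongrightarrow> functional_of P0 f) F"
    using vague_cluster_point[of P] fin_lf[OF fin] by metis
  let ?\<phi> = "\<lambda>n. functional_of (P n)"
  let ?G = "filtermap ?\<phi> sequentially"
  have G: "?G \<noteq> bot"
    by (simp add: filtermap_bot_iff)
  have G_fin: "\<forall>\<^sub>F \<mu> in ?G. \<mu> \<in> pos_finite_energy \<kappa>"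
    unfolding eventually_filtermap pos_finite_energy_iff using fin by (intro always_eventually allI) blast
  have G_Cauchy: "\<forall>\<epsilon>>0. \<forall>\<^sub>F (\<mu>, \<nu>) in ?G \<times>\<^sub>F ?G. strong_dist \<kappa> \<mu> \<nu> < \<epsilon>"
  proof (intro allI impI)
    fix \<epsilon> :: real assume \<epsilon>: "0 < \<epsilon>"
    obtain N where N: "\<And>m n. N \<le> m \<Longrightarrow> N \<le> n \<Longrightarrow> sqdist (P m) (P n) < \<epsilon>\<^sup>2"
      using Cauchy[of "\<epsilon>\<^sup>2"] \<epsilon> by auto
    have "\<forall>\<^sub>F \<mu> in ?G. \<mu> \<in> ?\<phi> ` {N..}"
      unfolding eventually_filtermap by (rule eventually_sequentiallyI[of N]) auto
    moreover have "strong_dist \<kappa> \<mu> \<nu> < \<epsilon>" if mem: "\<mu> \<in> ?\<phi> ` {N..}" "\<nu> \<in> ?\<phi> ` {N..}" for \<mu> \<nu>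
    proof -
      obtain m where m: "N \<le> m" "\<mu> = ?\<phi> m"
        using mem(1) by (elim imageE) simp
      obtain n where n: "N \<le> n" "\<nu> = ?\<phi> n"
        using mem(2) by (elim imageE) simp
      have "sqrt (sqdist (P m) (P n)) < sqrt (\<epsilon>\<^sup>2)"
        by (rule real_sqrt_less_mono[OF N[OF m(1) n(1)]])
      then show ?thesis
        using \<epsilon> by (simp add: m(2) n(2) strong_dist_functional_of fin)
    qed
    ultimately show "\<forall>\<^sub>F (\<mu>, \<nu>) in ?G \<times>\<^sub>F ?G. strong_dist \<kappa> \<mu> \<nu> < \<epsilon>"
      unfolding eventually_prod_filter by blast
  qed
  have cluster: "inf ?G (nhds (functional_of P0)) \<noteq> bot"
  proof
    assume "inf ?G (nhds (functional_of P0)) = bot"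
    moreover have "filtermap ?\<phi> F \<le> inf ?G (nhds (functional_of P0))"
      using filtermap_mono[OF F(2), of ?\<phi>] lim\<phi> by (simp add: filterlim_def)
    ultimately show False
      using F(1) by (simp add: filtermap_bot_iff bot_unique)
  qed
  have "functional_of P0 \<in> radon_measures"
    using functional_of_pos_radon[OF P0] by (simp add: pos_radon_measures_def)
  then have res: "functional_of P0 \<in> finite_energy \<kappa>" "((\<lambda>\<mu>. strong_dist \<kappa> \<mu> (functional_of P0)) \<longlongrightarrow> 0) ?G"
    using consistency G G_fin G_Cauchy cluster unfolding consistency_principle_def by blast+
  have "functional_of P0 \<in> pos_finite_energy \<kappa>"
    using res(1) functional_of_pos_radon[OF P0] by (simp add: pos_finite_energy_def)
  then obtain P1 where P1: "fin_energy P1" "functional_of P0 = functional_of P1"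
    using pos_finite_energy_iff by blast
  then have fin0: "fin_energy P0"
    using measure_eqI_functional[OF P0 fin_lf[OF P1(1)]] by simp
  have "(\<lambda>n. strong_dist \<kappa> (?\<phi> n) (functional_of P0)) \<longlonglongrightarrow> 0"
    using res(2) by (simp add: filterlim_filtermap)
  then have "(\<lambda>n. sqrt (sqdist (P n) P0)) \<longlonglongrightarrow> 0"
    by (simp add: strong_dist_functional_of fin fin0)
  then have "(\<lambda>n. (sqrt (sqdist (P n) P0))\<^sup>2) \<longlonglongrightarrow> 0\<^sup>2"
    by (rule tendsto_power)
  then have "(\<lambda>n. sqdist (P n) P0) \<longlonglongrightarrow> 0"
    using energy_difference(3)[OF fin fin0] by simp
  then show ?thesis
    using fin0 F lim by blast
qed

lemma strong_limits:
  assumes P: "\<And>n. fin_energy (P n)" and P0: "fin_energy P0" and lim: "(\<lambda>n. sqdist (P n) P0) \<longlonglongrightarrow> 0"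
  shows "fin_energy M \<Longrightarrow> (\<lambda>n. ip M (P n)) \<longlonglongrightarrow> ip M P0"
    and "(\<lambda>n. ip (P n) (P n)) \<longlonglongrightarrow> ip P0 P0"
proof -
  have d0: "(\<lambda>n. sqrt (sqdist (P n) P0)) \<longlonglongrightarrow> 0"
    using tendsto_real_sqrt[OF lim] by simp
  show "(\<lambda>n. ip M (P n)) \<longlonglongrightarrow> ip M P0" if M: "fin_energy M"
  proof (rule LIM_zero_cancel, rule Lim_null_comparison)
    show "\<forall>\<^sub>F n in sequentially. norm (ip M (P n) - ip M P0) \<le> sqrt (ip M M) * sqrt (sqdist (P n) P0)"
      using ip_diff_bound[OF M P P0] by (simp add: always_eventually)
    show "(\<lambda>n. sqrt (ip M M) * sqrt (sqdist (P n) P0)) \<longlonglongrightarrow> 0"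
      using tendsto_mult[OF tendsto_const d0] by simp
  qed
  have "(\<lambda>n. sqrt (ip (P n) (P n))) \<longlonglongrightarrow> sqrt (ip P0 P0)"
  proof (rule LIM_zero_cancel, rule Lim_null_comparison[OF _ d0])
    have "\<bar>sqrt (ip (P n) (P n)) - sqrt (ip P0 P0)\<bar> \<le> sqrt (sqdist (P n) P0)" for n
      using norm_triangle[OF P P0, of n] norm_triangle[OF P0 P, of n] sqdist_sym[OF P P0, of n] by simp
    then show "\<forall>\<^sub>F n in sequentially. norm (sqrt (ip (P n) (P n)) - sqrt (ip P0 P0)) \<le> sqrt (sqdist (P n) P0)"
      by (simp add: always_eventually)
  qed
  then have "(\<lambda>n. (sqrt (ip (P n) (P n)))\<^sup>2) \<longlonglongrightarrow> (sqrt (ip P0 P0))\<^sup>2"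
    by (rule tendsto_power)
  then show "(\<lambda>n. ip (P n) (P n)) \<longlonglongrightarrow> ip P0 P0"
    by (simp add: ip_nonneg)
qed

section \<open>Projections onto the cones of measures carried by a compact set\<close>

definition fin_on :: "'a set \<Rightarrow> 'a measure \<Rightarrow> bool" where
  "fin_on K P \<longleftrightarrow> fin_energy P \<and> emeasure P (- K) = 0"

lemma fin_on_fin: "fin_on K P \<Longrightarrow> fin_energy P"
  by (simp add: fin_on_def)

lemma fin_on_add_measure:
  assumes "closed K" "fin_on K P" "fin_on K Q"
  shows "fin_on K (add_measure P Q)"
proof -
  have "- K \<in> sets borel"
    using assms(1) by (simp add: borel_comp)
  then show ?thesis
    using assms by (simp add: fin_on_def fin_add_measure emeasure_add_measure sets_lf fin_lf)
qed

lemma fin_on_scale_measure: "fin_on K P \<Longrightarrow> fin_on K (scale_measure (ennreal c) P)"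
  by (simp add: fin_on_def fin_scale_measure)

lemma fin_on_mono:
  assumes "fin_on K P" "K \<subseteq> L" "closed K" "closed L"
  shows "fin_on L P"
proof -
  have "emeasure P (- L) \<le> emeasure P (- K)"
    using assms by (intro emeasure_mono) (auto simp: fin_on_def sets_lf fin_lf borel_comp)
  then show ?thesis
    using assms(1) by (simp add: fin_on_def)
qed

lemma fin_on_vague_limit:
  assumes K: "closed K" and P: "\<And>n. fin_on K (P n)" and P0: "fin_energy P0" and F: "F \<noteq> bot"
    and lim: "\<And>f. ((\<lambda>n. functional_of (P n) f) \<longlongrightarrow> functional_of P0 f) F"
  shows "fin_on K P0"
proof -
  have "functional_of P0 f = 0" if "cc_support f \<subseteq> - K" for f
  proof -
    have "functional_of (P n) f = 0" for n
      using P[of n] K that by (intro functional_of_null_support[of _ "- K"]) (auto simp: fin_on_def fin_lf borel_comp)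
    then have "((\<lambda>n. functional_of (P n) f) \<longlongrightarrow> 0) F"
      by simp
    then show ?thesis
      by (rule tendsto_unique[OF F lim])
  qed
  then have "emeasure P0 (- K) = 0"
    using K by (intro null_openI fin_lf[OF P0]) auto
  then show ?thesis
    using P0 by (simp add: fin_on_def)
qed

text \<open>Minimise \<open>J(\<nu>) = \<parallel>\<nu>\<parallel>\<^sup>2 - 2 \<kappa>(M, \<nu>)\<close> over the cone. By the parallelogram identity a
  minimising sequence is strongly Cauchy; its limit stays in the cone because a vague limit of measures
  carried by a closed set is carried by it. The two conclusions are the first-order conditions
  for moving from \<open>\<nu>\<close> towards \<open>\<xi>\<close> and along the ray of \<open>\<nu>\<close>.\<close>

lemma cone_projection:
  assumes K: "closed K" and M: "fin_energy M"
  shows "\<exists>\<nu>. fin_on K \<nu> \<and> (\<forall>\<xi>. fin_on K \<xi> \<longrightarrow> ip M \<xi> \<le> ip \<nu> \<xi>) \<and> ip M \<nu> = ip \<nu> \<nu>"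
proof -
  define J where "J P = ip P P - 2 * ip M P" for P
  have lower: "- ip M M \<le> J P" if "fin_on K P" for P
    using energy_difference(3)[OF M fin_on_fin[OF that]] by (simp add: J_def sqdist_def)
  have null: "fin_on K (null_measure borel)"
    by (simp add: fin_on_def fin_null_measure)
  define j where "j = Inf (J ` {P. fin_on K P})"
  have bdd: "bdd_below (J ` {P. fin_on K P})"
    using lower by (auto intro!: bdd_belowI[of _ "- ip M M"])
  have j: "j \<le> J P" if "fin_on K P" for P
    unfolding j_def using bdd that by (intro cInf_lower) auto
  define r where "r n = 1 / real (Suc n)" for n
  have r: "0 < r n" "n \<le> m \<Longrightarrow> r m \<le> r n" for m n
    by (auto simp: r_def frac_le)
  have "\<exists>P. fin_on K P \<and> J P < j + r n" for n
  proof -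
    have "Inf (J ` {P. fin_on K P}) < j + r n"
      using r by (simp add: j_def)
    then show ?thesis
      using null bdd by (subst (asm) cInf_less_iff) auto
  qed
  then obtain P where P: "\<And>n. fin_on K (P n)" "\<And>n. J (P n) < j + r n"
    by metis
  note finP = fin_on_fin[OF P(1)]
  have parallelogram: "sqdist A B \<le> 2 * (J A - j) + 2 * (J B - j)" if A: "fin_on K A" and B: "fin_on K B" for A B
  proof -
    let ?C = "scale_measure (ennreal (1/2)) (add_measure A B)"
    have "j \<le> J ?C"
      by (intro j fin_on_scale_measure fin_on_add_measure K A B)
    moreover have "4 * J ?C = 2 * J A + 2 * J B - sqdist A B"
      using fin_on_fin[OF A] fin_on_fin[OF B] M
      by (simp add: J_def sqdist_def ip_add_left ip_add_right ip_scale_left ip_scale_right fin_add_measure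
          fin_scale_measure ip_sym[of B A] field_simps del: ennreal_half)
    ultimately show ?thesis by simp
  qed
  have "\<exists>N. \<forall>m\<ge>N. \<forall>n\<ge>N. sqdist (P m) (P n) < e" if e: "0 < e" for e
  proof -
    obtain N where N: "r N < e / 4"
      using reals_Archimedean[of "e / 4"] e by (auto simp: inverse_eq_divide r_def)
    have "sqdist (P m) (P n) < e" if "N \<le> m" "N \<le> n" for m n
    proof -
      have "J (P m) - j < e / 4" "J (P n) - j < e / 4"
        using P(2)[of m] P(2)[of n] N r(2)[OF that(1)] r(2)[OF that(2)] by linarith+
      then show ?thesis
        using parallelogram[OF P(1)[of m] P(1)[of n]] by argo
    qed
    then show ?thesis by blast
  qed
  then obtain \<nu> F where \<nu>: "fin_energy \<nu>" "(\<lambda>n. sqdist (P n) \<nu>) \<longlonglongrightarrow> 0" and F: "F \<noteq> bot"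
      "\<And>f. ((\<lambda>n. functional_of (P n) f) \<longlongrightarrow> functional_of \<nu> f) F"
    using strong_completeness[of P, OF finP] by blast
  have \<nu>K: "fin_on K \<nu>"
    by (rule fin_on_vague_limit[OF K P(1) \<nu>(1) F])
  have "(\<lambda>n. J (P n)) \<longlonglongrightarrow> J \<nu>"
    unfolding J_def by (intro tendsto_diff tendsto_mult tendsto_const strong_limits[OF finP \<nu>(1,2)] M)
  moreover have "(\<lambda>n. j + r n) \<longlonglongrightarrow> j + 0"
    unfolding r_def by (intro tendsto_add tendsto_const LIMSEQ_Suc[OF lim_1_over_n])
  ultimately have "J \<nu> \<le> j + 0"
    using P(2) by (intro LIMSEQ_le) (auto intro: less_imp_le)
  then have min: "J \<nu> \<le> J \<xi>" if "fin_on K \<xi>" for \<xi>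
    using j[OF that] by simp
  have var: "ip M \<xi> \<le> ip \<nu> \<xi>" if \<xi>: "fin_on K \<xi>" for \<xi>
  proof (rule ccontr)
    assume "\<not> ip M \<xi> \<le> ip \<nu> \<xi>"
    define \<delta> where "\<delta> = ip M \<xi> - ip \<nu> \<xi>"
    have \<delta>: "0 < \<delta>"
      using \<open>\<not> ip M \<xi> \<le> ip \<nu> \<xi>\<close> by (simp add: \<delta>_def)
    \<comment> \<open>A step so small that the quadratic term does not outweigh the gain \<open>2 t \<delta>\<close>.\<close>
    define t where "t = \<delta> / (ip \<xi> \<xi> + 1)"
    have t: "0 < t" "t * (ip \<xi> \<xi> + 1) = \<delta>"
      using \<delta> ip_nonneg[of \<xi> \<xi>] by (auto simp: t_def)
    have "J \<nu> \<le> J (add_measure \<nu> (scale_measure (ennreal t) \<xi>))"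
      by (intro min fin_on_add_measure fin_on_scale_measure K \<nu>K \<xi>)
    also have "\<dots> = J \<nu> + t * (t * ip \<xi> \<xi> - 2 * \<delta>)"
      using t fin_on_fin[OF \<xi>] \<nu>(1) M by (simp add: J_def \<delta>_def ip_simps ip_sym[of \<xi> \<nu>] algebra_simps)
    finally have "0 \<le> t * (t * ip \<xi> \<xi> - 2 * \<delta>)"
      by simp
    then have "0 \<le> t * ip \<xi> \<xi> - 2 * \<delta>"
      using t(1) by (simp add: zero_le_mult_iff)
    then show False
      using t \<delta> by (simp add: distrib_left)
  qed
  have "ip \<nu> \<nu> \<le> ip M \<nu>"
  proof (rule ccontr)
    assume "\<not> ip \<nu> \<nu> \<le> ip M \<nu>"
    define \<delta> where "\<delta> = ip \<nu> \<nu> - ip M \<nu>"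
    have \<delta>: "0 < \<delta>" "\<delta> \<le> ip \<nu> \<nu>"
      using \<open>\<not> ip \<nu> \<nu> \<le> ip M \<nu>\<close> ip_nonneg[of M \<nu>] by (simp_all add: \<delta>_def)
    define t where "t = \<delta> / ip \<nu> \<nu>"
    have t: "0 < t" "t \<le> 1" "t * ip \<nu> \<nu> = \<delta>"
      using \<delta> by (auto simp: t_def)
    have "J \<nu> \<le> J (scale_measure (ennreal (1 - t)) \<nu>)"
      by (intro min fin_on_scale_measure \<nu>K)
    also have "\<dots> = (1 - t)\<^sup>2 * ip \<nu> \<nu> - 2 * (1 - t) * ip M \<nu>"
      using t \<nu>(1) M by (simp add: J_def ip_simps power2_eq_square)
    also have "\<dots> = J \<nu> + t * (t * ip \<nu> \<nu> - 2 * \<delta>)"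
      by (simp add: J_def \<delta>_def power2_eq_square algebra_simps)
    finally have "0 \<le> t * (t * ip \<nu> \<nu> - 2 * \<delta>)"
      by simp
    then have "0 \<le> t * ip \<nu> \<nu> - 2 * \<delta>"
      using t(1) by (simp add: zero_le_mult_iff)
    then show False
      using t(3) \<delta>(1) by simp
  qed
  then show ?thesis
    using var \<nu>K by (intro exI[of _ \<nu>]) (auto intro: antisym)
qed

text \<open>For an increasing sequence of sets the norms of the projections \<open>\<nu> n\<close> increase and stay below
  \<open>\<parallel>M\<parallel>\<close>, and \<open>\<parallel>\<nu> n - \<nu> m\<parallel>\<^sup>2 \<le> \<parallel>\<nu> m\<parallel>\<^sup>2 - \<parallel>\<nu> n\<parallel>\<^sup>2\<close> for \<open>n \<le> m\<close>, so they
  converge strongly.\<close>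

lemma projection_limit:
  fixes K :: "nat \<Rightarrow> 'a set"
  assumes K: "\<And>n. closed (K n)" "incseq K" and M: "fin_energy M"
    and \<nu>: "\<And>n. fin_on (K n) (\<nu> n)" "\<And>n \<xi>. fin_on (K n) \<xi> \<Longrightarrow> ip M \<xi> \<le> ip (\<nu> n) \<xi>"
      "\<And>n. ip M (\<nu> n) = ip (\<nu> n) (\<nu> n)"
  shows "\<exists>\<nu>0 F. fin_energy \<nu>0 \<and> F \<noteq> bot \<and> (\<forall>f. ((\<lambda>n. functional_of (\<nu> n) f) \<longlongrightarrow> functional_of \<nu>0 f) F) \<and>
    (\<forall>n \<xi>. fin_on (K n) \<xi> \<longrightarrow> ip M \<xi> \<le> ip \<nu>0 \<xi>)"
proof -
  note fin = fin_on_fin[OF \<nu>(1)]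
  have mono: "fin_on (K m) (\<nu> n)" if "n \<le> m" for m n
    using fin_on_mono[OF \<nu>(1)] K incseqD[OF K(2) that] by blast
  have dist: "sqdist (\<nu> n) (\<nu> m) \<le> ip (\<nu> m) (\<nu> m) - ip (\<nu> n) (\<nu> n)" if "n \<le> m" for m n
    using \<nu>(2)[OF mono[OF that]] \<nu>(3)[of n] ip_sym[OF fin fin, of n m] by (simp add: sqdist_def)
  have inc: "incseq (\<lambda>n. ip (\<nu> n) (\<nu> n))"
    using dist energy_difference(3)[OF fin fin] by (intro monoI) (metis diff_ge_0_iff_ge order_trans)
  have "ip (\<nu> n) (\<nu> n) \<le> ip M M" for n
    using energy_difference(3)[OF M fin, of n] \<nu>(3)[of n] by (simp add: sqdist_def)
  then obtain L where "(\<lambda>n. ip (\<nu> n) (\<nu> n)) \<longlonglongrightarrow> L"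
    using incseq_convergent[OF inc, of "ip M M"] by blast
  then have cau: "Cauchy (\<lambda>n. ip (\<nu> n) (\<nu> n))"
    by (rule LIMSEQ_imp_Cauchy)
  have "\<exists>N. \<forall>m\<ge>N. \<forall>n\<ge>N. sqdist (\<nu> m) (\<nu> n) < e" if e: "0 < e" for e
  proof -
    obtain N where N: "\<And>m n. N \<le> m \<Longrightarrow> N \<le> n \<Longrightarrow> \<bar>ip (\<nu> m) (\<nu> m) - ip (\<nu> n) (\<nu> n)\<bar> < e"
      using cau e unfolding Cauchy_def dist_real_def by blast
    have "sqdist (\<nu> m) (\<nu> n) < e" if "N \<le> m" "N \<le> n" for m n
      using N[OF that] dist[of m n] dist[of n m] sqdist_sym[OF fin fin, of m n] by (cases "m \<le> n") auto
    then show ?thesis by blast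
  qed
  then obtain \<nu>0 F where \<nu>0: "fin_energy \<nu>0" "(\<lambda>n. sqdist (\<nu> n) \<nu>0) \<longlonglongrightarrow> 0" and F: "F \<noteq> bot"
      "\<forall>f. ((\<lambda>n. functional_of (\<nu> n) f) \<longlongrightarrow> functional_of \<nu>0 f) F"
    using strong_completeness[of \<nu>, OF fin] by blast
  have "ip M \<xi> \<le> ip \<nu>0 \<xi>" if \<xi>: "fin_on (K n) \<xi>" for n \<xi>
  proof -
    have "(\<lambda>m. ip \<xi> (\<nu> m)) \<longlonglongrightarrow> ip \<xi> \<nu>0"
      by (rule strong_limits(1)[OF fin \<nu>0 fin_on_fin[OF \<xi>]])
    moreover have "ip M \<xi> \<le> ip \<xi> (\<nu> m)" if "n \<le> m" for m
    proof -
      have "fin_on (K m) \<xi>"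
        using fin_on_mono[OF \<xi>] K incseqD[OF K(2) that] by blast
      then show ?thesis
        using \<nu>(2) ip_sym[OF fin fin_on_fin[OF \<xi>]] by metis
    qed
    ultimately have "ip M \<xi> \<le> ip \<xi> \<nu>0"
      by (intro LIMSEQ_le_const) blast+
    then show ?thesis
      using ip_sym[OF \<nu>0(1) fin_on_fin[OF \<xi>]] by simp
  qed
  then show ?thesis
    using \<nu>0(1) F by blast
qed

end

section \<open>Strong separability\<close>

context energy_kernel
begin

lemma step_energy_close:
  assumes P: "fin_energy P" and d: "0 < d"
  shows "\<exists>m. ip P P - d < step_energy m P P"
proof (cases "ip P P < d")
  case True
  then have "ip P P - d < step_energy 0 P P"
    by (simp add: step_energy_def cells_def)
  then show ?thesis ..
next
  case False
  have "ennreal (ip P P - d) < energy P P"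
    using False d by (simp add: energy_eq_ip[OF P P] ennreal_less_iff)
  then obtain m where "ennreal (ip P P - d) < ennreal (step_energy m P P)"
    using step_energy_approx[OF fin_lf[OF P] fin_lf[OF P]] by blast
  then have "ip P P - d < step_energy m P P"
    using False by (simp add: ennreal_less_iff)
  then show ?thesis ..
qed

text \<open>If the energies and the countably many cell integrals of \<open>P n\<close> converge to those of \<open>P\<close>, then
  \<open>\<kappa>(P n, P)\<close> is asymptotically at least \<open>\<parallel>P\<parallel>\<^sup>2\<close> by lower semicontinuity, so
  \<open>\<parallel>P n - P\<parallel>\<^sup>2 = \<parallel>P n\<parallel>\<^sup>2 + \<parallel>P\<parallel>\<^sup>2 - 2 \<kappa>(P n, P)\<close> tends to \<open>0\<close>.\<close>

lemma strong_convergence_criterion: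
  assumes fin: "\<And>n. fin_energy (P n)" and P0: "fin_energy P0"
    and norms: "(\<lambda>n. ip (P n) (P n)) \<longlonglongrightarrow> ip P0 P0"
    and vague: "\<And>m S. S \<in> cells m \<Longrightarrow> (\<lambda>n. functional_of (P n) (cell m S)) \<longlonglongrightarrow> functional_of P0 (cell m S)"
  shows "(\<lambda>n. sqdist (P n) P0) \<longlonglongrightarrow> 0"
proof (rule LIMSEQ_I)
  fix e :: real assume e: "0 < e"
  \<comment> \<open>An error of \<open>d\<close> in the norms and one of \<open>d\<close> in the mutual energy, which counts twice.\<close>
  define d where "d = e / 3"
  have d: "0 < d" "3 * d = e"
    using e by (simp_all add: d_def)
  obtain m where m: "ip P0 P0 - d < step_energy m P0 P0"
    using step_energy_close[OF P0 d(1)] by blast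
  have "(\<lambda>n. step_energy m (P n) P0) \<longlonglongrightarrow> step_energy m P0 P0"
    unfolding step_energy_def by (intro tendsto_sum tendsto_mult tendsto_const vague)
  then have "\<forall>\<^sub>F n in sequentially. ip P0 P0 - d < step_energy m (P n) P0"
    using m by (rule order_tendstoD(1))
  moreover have "\<forall>\<^sub>F n in sequentially. ip (P n) (P n) < ip P0 P0 + d"
    using d by (intro order_tendstoD(2)[OF norms]) simp
  ultimately have "\<forall>\<^sub>F n in sequentially. norm (sqdist (P n) P0 - 0) < e"
  proof eventually_elim
    case (elim n)
    have "ennreal (step_energy m (P n) P0) \<le> ennreal (ip (P n) P0)"
      using step_energy_le[OF fin_lf[OF fin] fin_lf[OF P0]] energy_eq_ip[OF fin P0] by simp
    then have "step_energy m (P n) P0 \<le> ip (P n) P0"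
      using ip_nonneg[of "P n" P0] by simp
    then have "sqdist (P n) P0 < e"
      using elim d unfolding sqdist_def by linarith
    then show ?case
      using energy_difference(3)[OF fin P0, of n] by simp
  qed
  then show "\<exists>N. \<forall>n\<ge>N. norm (sqdist (P n) P0 - 0) < e"
    by (simp add: eventually_sequentially)
qed

text \<open>The energy and the cell integrals map \<open>S\<close> into a second countable metrizable space. A finite set of
  indices is coded by a number to make the family of cells countable.\<close>

lemma strong_separability:
  assumes S: "\<And>P. P \<in> S \<Longrightarrow> fin_energy P"
  shows "\<exists>D\<subseteq>S. countable D \<and> (\<forall>P\<in>S. \<exists>p. (\<forall>n. p n \<in> D) \<and> (\<lambda>n. sqdist (p n) P) \<longlonglongrightarrow> 0)"
proof -
  define \<Phi> :: "'a measure \<Rightarrow> real \<times> (nat \<times> nat \<Rightarrow> real)" where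
    "\<Phi> P = (ip P P, \<lambda>(m, k). functional_of P (cell m (set_decode k)))" for P
  obtain T where T: "countable T" "T \<subseteq> \<Phi> ` S" "\<Phi> ` S \<subseteq> closure T"
    using separable[of "\<Phi> ` S"] by blast
  define D where "D = inv_into S \<Phi> ` T"
  have inv: "inv_into S \<Phi> t \<in> S" "\<Phi> (inv_into S \<Phi> t) = t" if "t \<in> T" for t
    by (rule inv_into_into[OF subsetD[OF T(2) that]], rule f_inv_into_f[OF subsetD[OF T(2) that]])
  have "\<exists>p. (\<forall>n. p n \<in> D) \<and> (\<lambda>n. sqdist (p n) P) \<longlonglongrightarrow> 0" if P: "P \<in> S" for P
  proof -
    obtain y where y: "\<And>n. y n \<in> T" "y \<longlonglongrightarrow> \<Phi> P"
      using closure_sequential[THEN iffD1, OF subsetD[OF T(3) imageI[OF P]]] by metis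
    define p where "p n = inv_into S \<Phi> (y n)" for n
    have pD: "p n \<in> D" for n
      using y(1) by (simp add: p_def D_def)
    have fin: "fin_energy (p n)" for n
      unfolding p_def by (intro S inv y)
    have lim: "(\<lambda>n. \<Phi> (p n)) \<longlonglongrightarrow> \<Phi> P"
      using y(2) inv(2)[OF y(1)] by (simp add: p_def)
    have "(\<lambda>n. sqdist (p n) P) \<longlonglongrightarrow> 0"
    proof (rule strong_convergence_criterion[OF fin S[OF P]])
      show "(\<lambda>n. ip (p n) (p n)) \<longlonglongrightarrow> ip P P"
        using tendsto_fst[OF lim] by (simp add: \<Phi>_def)
      fix m S assume "S \<in> cells m"
      then have fS: "finite S"
        by (auto simp: cells_def intro: finite_subset)
      have c: "continuous_on UNIV (\<lambda>\<psi> :: nat \<times> nat \<Rightarrow> real. \<psi> (m, set_encode S))"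
        by (rule continuous_on_product_coordinates)
      from continuous_on_tendsto_compose[OF c tendsto_snd[OF lim]]
      show "(\<lambda>n. functional_of (p n) (cell m S)) \<longlonglongrightarrow> functional_of P (cell m S)"
        by (simp add: \<Phi>_def fS)
    qed
    then show ?thesis
      using pD by blast
  qed
  moreover have "D \<subseteq> S" "countable D"
    using inv T(1) by (auto simp: D_def)
  ultimately show ?thesis by blast
qed

section \<open>Sets of inner capacity zero\<close>

lemma restrict_measure:
  assumes P: "locally_finite_borel P" and B: "B \<in> sets borel"
  defines "R \<equiv> density P (indicator B)"
  shows "locally_finite_borel R" "\<And>C. C \<in> sets borel \<Longrightarrow> emeasure R C = emeasure P (B \<inter> C)"
    "\<And>f. f \<in> borel_measurable borel \<Longrightarrow> (\<integral>\<^sup>+x. f x \<partial>R) = (\<integral>\<^sup>+x. f x * indicator B x \<partial>P)"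
    "pot R x \<le> pot P x" "energy R R \<le> energy P P"
proof -
  have BP: "B \<in> sets P"
    using B by (simp add: sets_lf[OF P])
  have sR: "sets R = sets borel"
    by (simp add: R_def sets_lf[OF P])
  show e: "emeasure R C = emeasure P (B \<inter> C)" if "C \<in> sets borel" for C
    unfolding R_def using that BP sets_lf[OF P]
    by (subst emeasure_density) (auto simp flip: indicator_inter_arith)
  show nn: "(\<integral>\<^sup>+x. f x \<partial>R) = (\<integral>\<^sup>+x. f x * indicator B x \<partial>P)" if "f \<in> borel_measurable borel" for f
  proof -
    have "f \<in> borel_measurable P"
      by (subst measurable_cong_sets[OF sets_lf[OF P] refl]) (rule that)
    then show ?thesis
      unfolding R_def using BP by (subst nn_integral_density) (auto simp: mult.commute)
  qed
  show lfR: "locally_finite_borel R"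
    unfolding locally_finite_borel_def
  proof (intro conjI allI impI sR)
    fix K :: "'a set" assume K: "compact K"
    then have "emeasure R K \<le> emeasure P K"
      by (simp add: e borel_compact sets_lf[OF P] emeasure_mono)
    then show "emeasure R K < \<infinity>"
      using emeasure_compact_finite[OF P K] by (rule le_less_trans)
  qed
  show le: "pot R x \<le> pot P x" for x
    unfolding pot_def nn[OF kernel_measurable_section] by (intro nn_integral_mono) (simp add: indicator_def)
  have "energy R R = (\<integral>\<^sup>+x. pot R x * indicator B x \<partial>P)"
    by (simp add: energy_iterated lfR nn pot_measurable)
  also have "\<dots> \<le> (\<integral>\<^sup>+x. pot P x \<partial>P)"
    using le by (intro nn_integral_mono) (simp add: indicator_def)
  finally show "energy R R \<le> energy P P"
    by (simp add: energy_iterated P)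
qed

lemma fin_restrict_measure:
  assumes "fin_energy P" "B \<in> sets borel"
  shows "fin_energy (density P (indicator B))"
  using restrict_measure[OF fin_lf[OF assms(1)] assms(2)] assms(1) by (auto simp: fin_energy_def intro: le_less_trans)

lemma fin_on_restrict_measure:
  assumes "fin_energy P" "closed B"
  shows "fin_on B (density P (indicator B))"
  using restrict_measure(2)[OF fin_lf[OF assms(1)], of B "- B"] fin_restrict_measure[OF assms(1), of B] assms(2)
  by (simp add: fin_on_def borel_comp)

lemma concentrated_on_functional_of:
  assumes P: "locally_finite_borel (P :: 'a measure)"
  shows "concentrated_on (functional_of P) A \<longleftrightarrow> (\<exists>B\<in>sets borel. B \<subseteq> A \<and> emeasure P (- B) = 0)"
proof
  assume *: "concentrated_on (functional_of P) A"
  obtain L :: "nat \<Rightarrow> 'a set" where L: "\<And>n. compact (L n)" "(\<Union>n. L n) = UNIV"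
    using open_compact_exhaustion[OF open_UNIV] by blast
  have "\<exists>N\<in>null_sets P. - A \<inter> L n \<subseteq> N" for n
    using * L(1) unfolding concentrated_on_def functional_of_parts[OF P] by blast
  then obtain N where N: "\<And>n. N n \<in> null_sets P" "\<And>n. - A \<inter> L n \<subseteq> N n"
    by metis
  have "(\<Union>n. N n) \<in> null_sets P"
    using N(1) by (rule null_sets_UN)
  then have UN: "(\<Union>n. N n) \<in> sets borel" "emeasure P (\<Union>n. N n) = 0"
    by (auto simp: null_sets_def sets_lf[OF P])
  have "- A \<subseteq> (\<Union>n. N n)"
  proof
    fix x assume x: "x \<in> - A"
    obtain n where "x \<in> L n"
      using L(2) by (metis UNIV_I UN_E)
    then show "x \<in> (\<Union>n. N n)"
      using N(2)[of n] x by (intro UN_I[of n]) auto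
  qed
  then have "- (\<Union>n. N n) \<subseteq> A"
    by blast
  then show "\<exists>B\<in>sets borel. B \<subseteq> A \<and> emeasure P (- B) = 0"
    using borel_comp[OF UN(1)] UN(2) by (intro bexI[of _ "- (\<Union>n. N n)"] conjI) (simp_all only: double_compl)
next
  assume "\<exists>B\<in>sets borel. B \<subseteq> A \<and> emeasure P (- B) = 0"
  then obtain B where B: "B \<in> sets borel" "B \<subseteq> A" "emeasure P (- B) = 0"
    by blast
  then have "- B \<in> null_sets P"
    by (simp add: null_sets_def sets_lf[OF P] borel_comp)
  then show "concentrated_on (functional_of P) A"
    unfolding concentrated_on_def functional_of_parts[OF P] using B(2) by blast
qed

definition unit_measures :: "'a set \<Rightarrow> 'a measure set" where
  "unit_measures A = {P. fin_energy P \<and> emeasure P UNIV = 1 \<and> (\<exists>B\<in>sets borel. B \<subseteq> A \<and> emeasure P (- B) = 0)}"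

lemma inner_capacity_eq: "inner_capacity \<kappa> A = inverse (INF P\<in>unit_measures A. enn2ereal (energy P P))"
proof -
  have "{\<mu> \<in> pos_finite_energy \<kappa>. concentrated_on \<mu> A \<and> emeasure (pos_part \<mu>) UNIV = 1} = functional_of ` unit_measures A"
  proof -
    have "concentrated_on (functional_of P) A \<and> emeasure (pos_part (functional_of P)) UNIV = 1 \<longleftrightarrow> P \<in> unit_measures A"
      if "fin_energy P" for P
      using that by (simp add: unit_measures_def concentrated_on_functional_of fin_lf functional_of_parts conj_commute)
    moreover have "fin_energy P" if "P \<in> unit_measures A" for P
      using that by (simp add: unit_measures_def)
    ultimately show ?thesis
      unfolding set_eq_iff pos_finite_energy_iff image_iff mem_Collect_eq by metis
  qed
  moreover have "(INF \<mu>\<in>functional_of ` unit_measures A. mutual_energy \<kappa> \<mu> \<mu>) = (INF P\<in>unit_measures A. enn2ereal (energy P P))"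
    unfolding image_comp by (intro INF_cong refl) (auto simp: unit_measures_def mutual_energy_functional_of fin_lf)
  ultimately show ?thesis
    by (simp add: inner_capacity_def)
qed

definition inner_null :: "'a set \<Rightarrow> bool" where
  "inner_null N \<longleftrightarrow> (\<forall>P B. fin_energy P \<longrightarrow> B \<in> sets borel \<longrightarrow> B \<subseteq> N \<longrightarrow> emeasure P B = 0)"

lemma inner_null_subset: "inner_null N \<Longrightarrow> M \<subseteq> N \<Longrightarrow> inner_null M"
  unfolding inner_null_def by blast

text \<open>By inner regularity; the mass of a compact set is finite and can be normalised.\<close>

lemma compact_subset_charged:
  assumes P: "locally_finite_borel (P :: 'a measure)" and B: "B \<in> sets borel" and pos: "emeasure P B \<noteq> 0"
  shows "\<exists>K. compact K \<and> K \<subseteq> B \<and> emeasure P K \<noteq> 0"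
proof (rule ccontr)
  assume *: "\<not> ?thesis"
  obtain K :: "nat \<Rightarrow> 'a set" where K: "\<And>n. compact (K n)" "\<And>n. K n \<subseteq> B" "emeasure P (B - (\<Union>n. K n)) = 0"
    using inner_regular_lf[OF P B] by blast
  have Km: "K n \<in> sets P" for n
    using K(1) by (simp add: sets_lf[OF P] borel_compact)
  have "emeasure P (\<Union>n. K n) = 0"
    using * K Km by (intro emeasure_UN_eq_0) auto
  moreover have "B = (B - (\<Union>n. K n)) \<union> (\<Union>n. K n)"
    using K(2) by blast
  moreover have "emeasure P ((B - (\<Union>n. K n)) \<union> (\<Union>n. K n)) \<le> emeasure P (B - (\<Union>n. K n)) + emeasure P (\<Union>n. K n)"
    using Km B by (intro emeasure_subadditive) (auto simp: sets_lf[OF P])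
  ultimately show False
    using K(3) pos by simp
qed

lemma unit_measure_of:
  assumes P: "fin_energy P" and B: "B \<in> sets borel" "B \<subseteq> A" and m: "emeasure P B = ennreal m" "0 < m"
  shows "scale_measure (ennreal (1 / m)) (density P (indicator B)) \<in> unit_measures A"
proof -
  let ?R = "density P (indicator B)"
  note r = restrict_measure(2)[OF fin_lf[OF P] B(1)]
  have "fin_energy (scale_measure (ennreal (1 / m)) ?R)"
    by (intro fin_scale_measure fin_restrict_measure P B)
  moreover have "emeasure ?R UNIV = ennreal m" "emeasure ?R (- B) = 0"
    using r[of UNIV] r[of "- B"] m B by (simp_all add: borel_comp)
  moreover have "ennreal (1 / m) * ennreal m = 1"
    using m(2) by (simp flip: ennreal_mult)
  ultimately show ?thesis
    using B by (auto simp: unit_measures_def)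
qed

lemma inner_capacity_zero_iff: "inner_capacity \<kappa> N = 0 \<longleftrightarrow> inner_null N"
proof
  assume "inner_capacity \<kappa> N = 0"
  then have inf: "\<bar>INF P\<in>unit_measures N. enn2ereal (energy P P)\<bar> = \<infinity>"
    unfolding inner_capacity_eq by (auto simp: ereal_inverse_eq_0)
  have empty: "unit_measures N = {}"
  proof (rule ccontr)
    assume "unit_measures N \<noteq> {}"
    then obtain P where P: "P \<in> unit_measures N"
      by blast
    have "(INF P\<in>unit_measures N. enn2ereal (energy P P)) \<le> enn2ereal (energy P P)"
      using P by (rule INF_lower)
    moreover have "0 \<le> (INF P\<in>unit_measures N. enn2ereal (energy P P))"
      by (intro INF_greatest) simp
    moreover have "enn2ereal (energy P P) < \<infinity>"
      using P by (cases "energy P P") (auto simp: unit_measures_def fin_energy_def enn2ereal_ennreal)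
    ultimately show False
      using inf by auto
  qed
  show "inner_null N"
    unfolding inner_null_def
  proof (intro allI impI)
    fix P B assume P: "fin_energy P" and B: "B \<in> sets borel" "B \<subseteq> N"
    show "emeasure P B = 0"
    proof (rule ccontr)
      assume "emeasure P B \<noteq> 0"
      then obtain K where K: "compact K" "K \<subseteq> B" "emeasure P K \<noteq> 0"
        using compact_subset_charged[OF fin_lf[OF P] B(1)] by blast
      obtain m where m: "emeasure P K = ennreal m" "0 < m"
        using emeasure_compact_finite[OF fin_lf[OF P] K(1)] K(3) by (cases "emeasure P K") (auto simp: ennreal_0[symmetric] simp del: ennreal_0 intro: le_neq_trans)
      have "scale_measure (ennreal (1 / m)) (density P (indicator K)) \<in> unit_measures N"
        using K B m by (intro unit_measure_of P) (auto simp: borel_compact)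
      then show False
        using empty by blast
    qed
  qed
next
  assume N: "inner_null N"
  have "unit_measures N = {}"
  proof (rule ccontr)
    assume "unit_measures N \<noteq> {}"
    then obtain P B where P: "fin_energy P" "emeasure P UNIV = 1" "B \<in> sets borel" "B \<subseteq> N" "emeasure P (- B) = 0"
      by (auto simp: unit_measures_def)
    have "emeasure P B = 0"
      using N P unfolding inner_null_def by blast
    moreover have "emeasure P UNIV \<le> emeasure P B + emeasure P (- B)"
      using emeasure_subadditive[of B P "- B"] P(1,3) by (simp add: sets_lf fin_lf borel_comp)
    ultimately show False
      using P by simp
  qed
  then show "inner_capacity \<kappa> N = 0"
    by (simp add: inner_capacity_eq top_ereal_def)
qed

lemma nearly_everywhere_iff: "nearly_everywhere \<kappa> A p \<longleftrightarrow> inner_null {x \<in> A. \<not> p x}"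
proof
  assume "nearly_everywhere \<kappa> A p"
  then obtain N where "N \<subseteq> A" "inner_null N" "\<forall>x\<in>A - N. p x"
    by (auto simp: nearly_everywhere_def inner_capacity_zero_iff)
  then show "inner_null {x \<in> A. \<not> p x}"
    by (elim inner_null_subset) blast
next
  assume "inner_null {x \<in> A. \<not> p x}"
  then show "nearly_everywhere \<kappa> A p"
    unfolding nearly_everywhere_def inner_capacity_zero_iff by (intro exI[of _ "{x \<in> A. \<not> p x}"]) auto
qed

end

context energy_kernel
begin

section \<open>Inner balayage\<close>

text \<open>Testing the variational inequality with restrictions of a finite-energy measure to compact subsets of
  \<open>{x \<in> A. pot \<nu> x < pot M x}\<close> shows that such restrictions vanish.\<close>

lemma exceptional_set_inner_null:
  assumes M: "fin_energy M" and \<nu>: "fin_energy \<nu>"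
    and var: "\<And>\<xi> K. compact K \<Longrightarrow> K \<subseteq> A \<Longrightarrow> fin_on K \<xi> \<Longrightarrow> ip M \<xi> \<le> ip \<nu> \<xi>"
  shows "inner_null {x \<in> A. pot \<nu> x < pot M x}"
  unfolding inner_null_def
proof (intro allI impI)
  fix P B assume P: "fin_energy P" and B: "B \<in> sets borel" "B \<subseteq> {x \<in> A. pot \<nu> x < pot M x}"
  show "emeasure P B = 0"
  proof (rule ccontr)
    assume "emeasure P B \<noteq> 0"
    then obtain K where K: "compact K" "K \<subseteq> B" "emeasure P K \<noteq> 0"
      using compact_subset_charged[OF fin_lf[OF P] B(1)] by metis
    let ?R = "density P (indicator K)"
    have Kb: "K \<in> sets borel"
      using K(1) by (rule borel_compact)
    have R: "fin_on K ?R"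
      by (intro fin_on_restrict_measure P compact_imp_closed K)
    note lf = fin_lf[OF fin_on_fin[OF R]]
    have Rsets: "K \<in> sets ?R" "- K \<in> sets ?R"
      unfolding sets_lf[OF lf] using Kb by (simp_all add: borel_comp)
    have "ip M ?R \<le> ip \<nu> ?R"
      using K B(2) by (intro var[OF K(1) _ R]) blast
    then have le: "(\<integral>\<^sup>+x. pot M x \<partial>?R) \<le> (\<integral>\<^sup>+x. pot \<nu> x \<partial>?R)"
      using energy_eq_ip[OF fin_on_fin[OF R] M] energy_eq_ip[OF fin_on_fin[OF R] \<nu>]
        ip_sym[OF fin_on_fin[OF R] M] ip_sym[OF fin_on_fin[OF R] \<nu>]
      by (simp add: energy_iterated[OF lf] fin_lf M \<nu> ennreal_leI)
    have "AE x in ?R. x \<notin> - K"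
      using R Rsets by (intro AE_not_in) (auto simp: null_sets_def fin_on_def)
    then have AE_lt: "AE x in ?R. pot \<nu> x < pot M x"
      by eventually_elim (use K(2) B(2) in blast)
    then have AE_le: "AE x in ?R. pot \<nu> x \<le> pot M x"
      by eventually_elim simp
    have "\<not> (AE x in ?R. pot M x \<le> pot \<nu> x)"
    proof
      assume "AE x in ?R. pot M x \<le> pot \<nu> x"
      with AE_lt have "AE x in ?R. False"
        by eventually_elim simp
      then have "emeasure ?R (space ?R) = 0"
        using AE_iff_measurable[of "space ?R" ?R "\<lambda>_. False"] by simp
      moreover have "emeasure ?R UNIV = emeasure P K"
        using restrict_measure(2)[OF fin_lf[OF P] Kb, of UNIV] by simp
      ultimately show False
        using K(3) by (simp add: space_lf[OF fin_lf[OF P]])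
    qed
    moreover have "(\<integral>\<^sup>+x. pot \<nu> x \<partial>?R) \<noteq> \<infinity>"
      using energy_difference(1)[OF fin_on_fin[OF R] \<nu>] by (simp add: energy_iterated[OF lf] fin_lf \<nu>)
    ultimately have "(\<integral>\<^sup>+x. pot \<nu> x \<partial>?R) < (\<integral>\<^sup>+x. pot M x \<partial>?R)"
      using AE_le by (intro nn_integral_less pot_measurable' fin_lf M \<nu> sets_lf lf)
    with le show False
      by simp
  qed
qed

lemma domination_pot:
  assumes P: "fin_energy P" and Q: "fin_energy Q" and le: "AE x in P. pot P x \<le> pot Q x"
  shows "pot P x \<le> pot Q x"
proof -
  have "functional_of P \<in> pos_finite_energy \<kappa>" "functional_of Q \<in> pos_finite_energy \<kappa>"
    using P Q pos_finite_energy_iff by blast+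
  moreover have "AE x in pos_part (functional_of P). potential \<kappa> (functional_of P) x \<le> potential \<kappa> (functional_of Q) x"
    unfolding functional_of_parts(1)[OF fin_lf[OF P]] potential_le_iff[OF fin_lf[OF P] fin_lf[OF Q]] by (rule le)
  ultimately have "potential \<kappa> (functional_of P) x \<le> potential \<kappa> (functional_of Q) x"
    using domination unfolding domination_principle_def by blast
  then show ?thesis
    by (simp add: fin_lf P Q potential_le_iff)
qed

lemma exceptional_set_measurable:
  assumes "fin_energy M" "fin_energy R" "closed K"
  shows "{x \<in> K. pot R x < pot M x} \<in> sets borel"
proof -
  have [measurable]: "pot R \<in> borel_measurable borel" "pot M \<in> borel_measurable borel" "K \<in> sets borel"
    using assms by (simp_all add: pot_measurable fin_lf)
  have "{x \<in> space borel. x \<in> K \<and> pot R x < pot M x} \<in> sets borel"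
    by measurable
  then show ?thesis
    by simp
qed

text \<open>The projection \<open>\<nu>\<close> of \<open>M\<close> onto the measures carried by \<open>K\<close> has \<open>pot \<nu> = pot M\<close>
  almost everywhere for \<open>\<nu>\<close> itself: \<open>\<ge>\<close> holds off an inner null subset of \<open>K\<close>, and both sides have the
  same finite \<open>\<nu>\<close>-integral.\<close>

lemma projection_pot_le:
  assumes K: "closed K" and M: "fin_energy M" and \<nu>: "fin_on K \<nu>"
    and var: "\<And>\<xi>. fin_on K \<xi> \<Longrightarrow> ip M \<xi> \<le> ip \<nu> \<xi>" and eq: "ip M \<nu> = ip \<nu> \<nu>"
    and R: "fin_energy R" and null: "inner_null {x \<in> K. pot R x < pot M x}"
  shows "pot \<nu> x \<le> pot R x"
proof (rule domination_pot[OF fin_on_fin[OF \<nu>] R])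
  note fin = fin_on_fin[OF \<nu>]
  have AE_ge: "AE x in \<nu>. pot M x \<le> pot T x" if T: "fin_energy T" and null: "inner_null {x \<in> K. pot T x < pot M x}" for T
  proof -
    have B: "{x \<in> K. pot T x < pot M x} \<in> sets borel"
      by (rule exceptional_set_measurable[OF M T K])
    have "emeasure \<nu> {x \<in> K. pot T x < pot M x} = 0"
      using null fin B unfolding inner_null_def by blast
    then have "AE x in \<nu>. x \<notin> {x \<in> K. pot T x < pot M x}"
      using B by (intro AE_not_in) (auto simp: null_sets_def sets_lf fin_lf[OF fin])
    moreover have "AE x in \<nu>. x \<notin> - K"
      using \<nu> K by (intro AE_not_in) (auto simp: null_sets_def fin_on_def sets_lf fin_lf borel_comp)
    ultimately show ?thesis
      by eventually_elim auto
  qed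
  have "inner_null {x \<in> K. pot \<nu> x < pot M x}"
  proof (rule exceptional_set_inner_null[OF M fin])
    fix \<xi> L assume "compact L" "L \<subseteq> K" "fin_on L \<xi>"
    then show "ip M \<xi> \<le> ip \<nu> \<xi>"
      using K by (intro var) (blast intro: fin_on_mono compact_imp_closed)
  qed
  then have ge: "AE x in \<nu>. pot M x \<le> pot \<nu> x"
    by (rule AE_ge[OF fin])
  have "AE x in \<nu>. pot \<nu> x \<le> pot M x"
  proof (rule ccontr)
    assume not: "\<not> (AE x in \<nu>. pot \<nu> x \<le> pot M x)"
    have "(\<integral>\<^sup>+x. pot M x \<partial>\<nu>) \<noteq> \<infinity>"
      using energy_difference(1)[OF fin M] by (simp add: energy_iterated fin_lf fin M)
    then have "(\<integral>\<^sup>+x. pot M x \<partial>\<nu>) < (\<integral>\<^sup>+x. pot \<nu> x \<partial>\<nu>)"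
      using ge not by (intro nn_integral_less pot_measurable' fin_lf M fin sets_lf)
    then have "energy \<nu> M < energy \<nu> \<nu>"
      by (simp add: energy_iterated fin_lf fin M)
    then show False
      using eq energy_eq_ip[OF fin M] energy_eq_ip[OF fin fin] ip_sym[OF fin M] by simp
  qed
  with AE_ge[OF R null] show "AE x in \<nu>. pot \<nu> x \<le> pot R x"
    by eventually_elim (rule order_trans)
qed

definition balayage_candidates :: "'a set \<Rightarrow> 'a measure \<Rightarrow> 'a measure set" where
  "balayage_candidates A M = {R. fin_energy R \<and> inner_null {x \<in> A. pot R x < pot M x}}"

lemma nearly_everywhere_potential_iff:
  assumes "fin_energy M" "fin_energy R"
  shows "nearly_everywhere \<kappa> A (\<lambda>x. potential \<kappa> (functional_of M) x \<le> potential \<kappa> (functional_of R) x) \<longleftrightarrow>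
    R \<in> balayage_candidates A M"
  using assms by (simp add: nearly_everywhere_iff potential_le_iff fin_lf balayage_candidates_def not_le)

lemma unique_minimizerI:
  assumes mem: "functional_of \<nu> \<in> \<Lambda>" and \<nu>: "fin_energy \<nu>" and sub: "\<Lambda> \<subseteq> pos_finite_energy \<kappa>"
    and min: "\<And>R x. fin_energy R \<Longrightarrow> functional_of R \<in> \<Lambda> \<Longrightarrow> pot \<nu> x \<le> pot R x"
  shows "is_unique_minimizer \<kappa> \<Lambda> (functional_of \<nu>)"
proof -
  have min': "potential \<kappa> (functional_of \<nu>) x \<le> potential \<kappa> \<xi> x" if \<xi>: "\<xi> \<in> \<Lambda>" for \<xi> x
  proof -
    obtain R where R: "fin_energy R" "\<xi> = functional_of R"
      using subsetD[OF sub \<xi>] pos_finite_energy_iff by metis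
    then show ?thesis
      using min[OF R(1)] \<xi> by (simp add: potential_le_iff fin_lf \<nu>)
  qed
  have "\<nu>' = functional_of \<nu>"
    if \<nu>': "\<nu>' \<in> \<Lambda>" "\<And>\<xi> x. \<xi> \<in> \<Lambda> \<Longrightarrow> potential \<kappa> \<nu>' x \<le> potential \<kappa> \<xi> x" for \<nu>'
  proof -
    obtain R where R: "fin_energy R" "\<nu>' = functional_of R"
      using subsetD[OF sub \<nu>'(1)] pos_finite_energy_iff by metis
    have "pot R x = pot \<nu> x" for x
    proof (rule antisym)
      show "pot R x \<le> pot \<nu> x"
        using \<nu>'(2)[OF mem] by (simp add: R potential_le_iff fin_lf \<nu>)
      show "pot \<nu> x \<le> pot R x"
        using min[OF R(1)] \<nu>'(1) R(2) by simp
    qed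
    then show ?thesis
      using pot_eq_imp_eq[OF R(1) \<nu>] R(2) by simp
  qed
  then show ?thesis
    unfolding is_unique_minimizer_def using mem min' by metis
qed

text \<open>Countably many compactly carried measures are strongly dense among all of them; the compact sets that
  carry them exhaust \<open>A\<close> as far as the variational inequality is concerned.\<close>

lemma dense_compact_sequence:
  fixes A :: "'a set"
  shows "\<exists>K :: nat \<Rightarrow> 'a set. incseq K \<and> (\<forall>n. compact (K n) \<and> K n \<subseteq> A) \<and>
    (\<forall>C \<xi>. compact C \<longrightarrow> C \<subseteq> A \<longrightarrow> fin_on C \<xi> \<longrightarrow>
      (\<exists>p. (\<forall>i. \<exists>n. fin_on (K n) (p i)) \<and> (\<lambda>i. sqdist (p i) \<xi>) \<longlonglongrightarrow> 0))"
proof -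
  define S where "S = {P. \<exists>C. compact C \<and> C \<subseteq> A \<and> fin_on C P}"
  have S_fin: "fin_energy P" if "P \<in> S" for P
    using that by (auto simp: S_def fin_on_def)
  obtain D where D: "D \<subseteq> S" "countable D" "\<And>P. P \<in> S \<Longrightarrow> \<exists>p. (\<forall>n. p n \<in> D) \<and> (\<lambda>n. sqdist (p n) P) \<longlonglongrightarrow> 0"
    using strong_separability[of S, OF S_fin] by metis
  have "null_measure borel \<in> S"
    unfolding S_def fin_on_def using fin_null_measure by (auto intro!: exI[of _ "{}"])
  then have "D \<noteq> {}"
    using D(3) by blast
  have "\<forall>P\<in>D. \<exists>C. compact C \<and> C \<subseteq> A \<and> fin_on C P"
    using D(1) by (auto simp: S_def)
  then obtain C where C: "\<And>P. P \<in> D \<Longrightarrow> compact (C P) \<and> C P \<subseteq> A \<and> fin_on (C P) P"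
    by metis
  let ?d = "from_nat_into D"
  have d: "?d i \<in> D" for i
    using \<open>D \<noteq> {}\<close> by (rule from_nat_into)
  define K where "K n = (\<Union>i\<le>n. C (?d i))" for n
  have K: "compact (K n)" "K n \<subseteq> A" for n
    using C[OF d] by (auto simp: K_def intro!: compact_UN)
  have "incseq K"
    unfolding K_def by (intro monoI UN_mono) auto
  moreover have "\<exists>n. fin_on (K n) P" if P: "P \<in> D" for P
  proof -
    obtain n where n: "P = ?d n"
      using from_nat_into_surj[OF D(2) P] by metis
    have "C P \<subseteq> K n"
      unfolding K_def n by blast
    then have "fin_on (K n) P"
      using C[OF P] K(1)[of n] fin_on_mono[of "C P" P "K n"] by (blast intro: compact_imp_closed)
    then show ?thesis ..
  qed
  moreover have "\<exists>p. (\<forall>i. p i \<in> D) \<and> (\<lambda>i. sqdist (p i) \<xi>) \<longlonglongrightarrow> 0" if "compact C" "C \<subseteq> A" "fin_on C \<xi>" for C \<xi>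
    using that by (intro D(3)) (auto simp: S_def)
  ultimately show ?thesis
    using K by (intro exI[of _ K]) metis
qed

text \<open>\<open>\<nu>\<close> is the strong limit of the projections \<open>\<nu> n\<close> of \<open>M\<close> onto the measures carried by
  \<open>K n\<close>. The variational inequality passes to the limit and, by density, to all measures carried by compact
  subsets of \<open>A\<close>; so \<open>\<nu>\<close> is a candidate for \<open>A\<close>. Minimality holds for each \<open>\<nu> n\<close> and is
  inherited by \<open>\<nu>\<close>, because potentials are lower semicontinuous under vague convergence.\<close>

lemma inner_balayage_exists:
  fixes K :: "nat \<Rightarrow> 'a set"
  assumes K: "incseq K" "\<And>n. compact (K n)" "\<And>n. K n \<subseteq> A"
    and dense: "\<And>C \<xi>. compact C \<Longrightarrow> C \<subseteq> A \<Longrightarrow> fin_on C \<xi> \<Longrightarrow>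
      \<exists>p. (\<forall>i. \<exists>n. fin_on (K n) (p i)) \<and> (\<lambda>i. sqdist (p i) \<xi>) \<longlonglongrightarrow> 0"
    and M: "fin_energy M"
  shows "\<exists>\<nu>\<in>balayage_candidates A M. \<forall>R\<in>balayage_candidates (\<Union>n. K n) M. \<forall>x. pot \<nu> x \<le> pot R x"
proof -
  note Kc = compact_imp_closed[OF K(2)]
  obtain \<nu> where \<nu>: "\<And>n. fin_on (K n) (\<nu> n)" "\<And>n \<xi>. fin_on (K n) \<xi> \<Longrightarrow> ip M \<xi> \<le> ip (\<nu> n) \<xi>"
      "\<And>n. ip M (\<nu> n) = ip (\<nu> n) (\<nu> n)"
    using cone_projection[OF Kc M] by metis
  obtain \<nu>0 F where \<nu>0: "fin_energy \<nu>0" and F: "F \<noteq> bot"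
    and lim: "\<And>f. ((\<lambda>n. functional_of (\<nu> n) f) \<longlongrightarrow> functional_of \<nu>0 f) F"
    and var: "\<And>n \<xi>. fin_on (K n) \<xi> \<Longrightarrow> ip M \<xi> \<le> ip \<nu>0 \<xi>"
    using projection_limit[OF Kc K(1) M \<nu>] by metis
  have "inner_null {x \<in> A. pot \<nu>0 x < pot M x}"
  proof (rule exceptional_set_inner_null[OF M \<nu>0])
    fix \<xi> C assume C: "compact C" "C \<subseteq> A" "fin_on C \<xi>"
    obtain p where p: "\<And>i. \<exists>n. fin_on (K n) (p i)" "(\<lambda>i. sqdist (p i) \<xi>) \<longlonglongrightarrow> 0"
      using dense[OF C] by metis
    have fin: "fin_energy (p i)" for i
      using p(1)[of i] fin_on_fin by blast
    have "ip M (p i) \<le> ip \<nu>0 (p i)" for i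
      using p(1)[of i] var by blast
    then show "ip M \<xi> \<le> ip \<nu>0 \<xi>"
      using strong_limits(1)[OF fin fin_on_fin[OF C(3)] p(2) M] strong_limits(1)[OF fin fin_on_fin[OF C(3)] p(2) \<nu>0]
      by (intro LIMSEQ_le[of "\<lambda>i. ip M (p i)" _ "\<lambda>i. ip \<nu>0 (p i)"]) auto
  qed
  then have "\<nu>0 \<in> balayage_candidates A M"
    using \<nu>0 by (simp add: balayage_candidates_def)
  moreover have "pot \<nu>0 x \<le> pot R x" if R: "R \<in> balayage_candidates (\<Union>n. K n) M" for R x
  proof -
    have finR: "fin_energy R" and null: "inner_null {x \<in> (\<Union>n. K n). pot R x < pot M x}"
      using R by (auto simp: balayage_candidates_def)
    have "pot (\<nu> n) x \<le> pot R x" for n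
    proof (rule projection_pot_le[OF Kc M \<nu>(1) \<nu>(2) \<nu>(3) finR])
      show "inner_null {x \<in> K n. pot R x < pot M x}"
        by (rule inner_null_subset[OF null]) blast
    qed
    then have "\<forall>\<^sub>F n in F. energy (dirac x) (\<nu> n) \<le> pot R x"
      by (intro always_eventually allI) (simp add: energy_dirac fin_lf fin_on_fin[OF \<nu>(1)])
    then have "energy (dirac x) \<nu>0 \<le> pot R x"
      by (intro energy_vague_lsc[OF F, of "\<lambda>_. dirac x" \<nu>] lim tendsto_const locally_finite_dirac
          fin_lf fin_on_fin[OF \<nu>(1)] \<nu>0)
    then show ?thesis
      by (simp add: energy_dirac fin_lf \<nu>0)
  qed
  ultimately show ?thesis
    by blast
qed

end

context energy_kernel
begin

section \<open>Outer capacity of countable unions of compact sets\<close>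

lemma unit_measures_mono: "A \<subseteq> B \<Longrightarrow> unit_measures A \<subseteq> unit_measures B"
  unfolding unit_measures_def by blast

lemma INF_energy_nonneg: "0 \<le> (INF P\<in>unit_measures A. enn2ereal (energy P P))"
  by (intro INF_greatest) simp

lemma inner_capacity_mono: "A \<subseteq> B \<Longrightarrow> inner_capacity \<kappa> A \<le> inner_capacity \<kappa> B"
  unfolding inner_capacity_eq
  by (intro ereal_inverse_antimono INF_energy_nonneg INF_superset_mono unit_measures_mono) auto

lemma inner_capacity_nonneg: "0 \<le> inner_capacity \<kappa> A"
  unfolding inner_capacity_eq by (simp add: ereal_inverse_nonneg_iff INF_energy_nonneg)

lemma inner_le_outer_capacity: "inner_capacity \<kappa> A \<le> outer_capacity \<kappa> A"
  unfolding outer_capacity_def by (intro INF_greatest inner_capacity_mono) auto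

lemma outer_null_imp_inner_null: "outer_capacity \<kappa> N = 0 \<Longrightarrow> inner_null N"
  using inner_le_outer_capacity[of N] inner_capacity_nonneg[of N] by (simp add: inner_capacity_zero_iff[symmetric])

lemma quasi_imp_nearly: "quasi_everywhere \<kappa> A p \<Longrightarrow> nearly_everywhere \<kappa> A p"
  unfolding quasi_everywhere_def nearly_everywhere_def inner_capacity_zero_iff
  using outer_null_imp_inner_null by blast

lemma inner_capacity_le_iff:
  assumes "0 < c"
  shows "inner_capacity \<kappa> A \<le> ereal c \<longleftrightarrow> (\<forall>P\<in>unit_measures A. 1 / c \<le> ip P P)"
proof -
  let ?I = "INF P\<in>unit_measures A. enn2ereal (energy P P)"
  have e: "enn2ereal (energy P P) = ereal (ip P P)" if "P \<in> unit_measures A" for P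
    using that energy_eq_ip[of P P] by (auto simp: unit_measures_def enn2ereal_ennreal ip_nonneg)
  have "inner_capacity \<kappa> A \<le> ereal c \<longleftrightarrow> ereal (1 / c) \<le> ?I"
  proof (cases ?I)
    case (real r)
    then have "0 \<le> r"
      using INF_energy_nonneg[of A] by simp
    then show ?thesis
      unfolding inner_capacity_eq real using assms by (cases "r = 0") (auto simp: field_simps)
  next
    case PInf
    then show ?thesis
      unfolding inner_capacity_eq using assms by simp
  next
    case MInf
    then show ?thesis
      using INF_energy_nonneg[of A] by simp
  qed
  also have "\<dots> \<longleftrightarrow> (\<forall>P\<in>unit_measures A. 1 / c \<le> ip P P)"
    by (simp add: le_INF_iff e)
  finally show ?thesis .
qed

text \<open>Did the capacities of all neighbourhoods of \<open>K\<close> exceed \<open>\<epsilon>\<close>, unit measures of energy below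
  \<open>1 / \<epsilon>\<close> on neighbourhoods shrinking to \<open>K\<close> would have a vague cluster point. By compactness no mass
  escapes, so it is a unit measure on \<open>K\<close>, of finite energy by lower semicontinuity.\<close>

lemma compact_inner_null_neighbourhood:
  assumes K: "compact K" and null: "inner_null K" and \<epsilon>: "0 < \<epsilon>"
  shows "\<exists>D. open D \<and> K \<subseteq> D \<and> inner_capacity \<kappa> D \<le> ereal \<epsilon>"
proof (rule ccontr)
  assume *: "\<not> ?thesis"
  obtain W L where W: "open W" "compact L" "K \<subseteq> W" "W \<subseteq> L"
    using compact_neighbourhood_between[OF K open_UNIV] by blast
  have "open (- K)"
    using K by (simp add: compact_imp_closed open_Compl)
  then obtain Z :: "nat \<Rightarrow> 'a set" where Zc: "\<And>n. compact (Z n)" and Z_inc: "incseq Z" and Z_UN: "(\<Union>n. Z n) = - K"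
    and Z_compact: "\<And>C. compact C \<Longrightarrow> C \<subseteq> - K \<Longrightarrow> \<exists>n. C \<subseteq> Z n"
    using open_absorbing_exhaustion by metis
  note Z_closed = compact_imp_closed[OF Zc]
  have Z_K: "Z n \<subseteq> - K" for n
    using Z_UN by blast
  have "\<exists>P\<in>unit_measures (W - Z n). ip P P < 1 / \<epsilon>" for n
  proof -
    have "open (W - Z n)" "K \<subseteq> W - Z n"
      using W Z_closed Z_K[of n] by (auto intro: open_Diff)
    then have "\<not> inner_capacity \<kappa> (W - Z n) \<le> ereal \<epsilon>"
      using * by blast
    then show ?thesis
      unfolding inner_capacity_le_iff[OF \<epsilon>] by (auto simp: not_le)
  qed
  then obtain P where P: "\<And>n. P n \<in> unit_measures (W - Z n)" "\<And>n. ip (P n) (P n) < 1 / \<epsilon>"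
    by metis
  have fin: "fin_energy (P n)" and unit: "emeasure (P n) UNIV = 1" for n
    using P(1)[of n] by (auto simp: unit_measures_def)
  have off: "emeasure (P n) C = 0" if "C \<in> sets borel" "C \<inter> (W - Z n) = {}" for n C
  proof -
    obtain B where B: "B \<in> sets borel" "B \<subseteq> W - Z n" "emeasure (P n) (- B) = 0"
      using P(1)[of n] by (auto simp: unit_measures_def)
    have "emeasure (P n) C \<le> emeasure (P n) (- B)"
      using B(1,2) that by (intro emeasure_mono) (auto simp: sets_lf fin_lf[OF fin] borel_comp)
    then show ?thesis
      using B(3) by simp
  qed
  have "\<exists>C. \<forall>n. measure (P n) A \<le> C" for A
  proof -
    have "measure (P n) A \<le> 1" for n
    proof -
      have "emeasure (P n) A \<le> emeasure (P n) (space (P n))"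
        by (rule emeasure_space)
      then have "emeasure (P n) A \<le> 1"
        using unit[of n] by (simp add: space_lf fin_lf[OF fin])
      then show ?thesis
        unfolding measure_def using enn2real_leI by fastforce
    qed
    then show ?thesis by blast
  qed
  then obtain P0 F where P0: "locally_finite_borel P0" and F: "F \<noteq> bot" "F \<le> sequentially"
    and lim: "\<And>f. ((\<lambda>n. functional_of (P n) f) \<longlongrightarrow> functional_of P0 f) F"
    using vague_cluster_point[of P, OF fin_lf[OF fin]] by metis
  have "energy P0 P0 \<le> ennreal (1 / \<epsilon>)"
  proof (rule energy_vague_lsc[OF F(1) fin_lf[OF fin] fin_lf[OF fin] P0 P0 lim lim])
    show "\<forall>\<^sub>F n in F. energy (P n) (P n) \<le> ennreal (1 / \<epsilon>)"
      unfolding energy_eq_ip[OF fin fin] by (intro always_eventually allI ennreal_leI less_imp_le P(2))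
  qed
  then have fin0: "fin_energy P0"
    using P0 by (auto simp: fin_energy_def intro: le_less_trans)
  have "emeasure P0 (- K) = 0"
  proof (rule null_openI[OF P0])
    show "open (- K)"
      using K by (simp add: compact_imp_closed open_Compl)
    fix f assume "cc_support f \<subseteq> - K"
    then obtain N where N: "cc_support f \<subseteq> Z N"
      using Z_compact[OF compact_cc_support] by blast
    have "functional_of (P n) f = 0" if "N \<le> n" for n
    proof (rule functional_of_null_support)
      have "Z N \<subseteq> Z n"
        using that by (rule incseqD[OF Z_inc])
      then show "cc_support f \<subseteq> Z n"
        using N by blast
      show "emeasure (P n) (Z n) = 0"
        using Z_closed by (intro off) auto
    qed (use Z_closed in \<open>auto intro: fin_lf fin\<close>)
    then have "\<forall>\<^sub>F n in F. functional_of (P n) f = 0"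
      by (intro filter_leD[OF F(2)] eventually_sequentiallyI[of N])
    then have "((\<lambda>n. functional_of (P n) f) \<longlongrightarrow> 0) F"
      by (rule tendsto_eventually)
    then show "functional_of P0 f = 0"
      by (rule tendsto_unique[OF F(1) lim])
  qed
  moreover have "emeasure P0 K = 0"
    using null fin0 K unfolding inner_null_def by (blast intro: borel_compact)
  moreover have "emeasure P0 UNIV \<le> emeasure P0 K + emeasure P0 (- K)"
    using emeasure_subadditive[of K P0 "- K"] K by (simp add: sets_lf P0 borel_compact borel_comp)
  ultimately have zero: "emeasure P0 UNIV = 0"
    by simp
  obtain h where h: "\<And>x. 0 \<le> cc_apply h x" "\<And>x. x \<in> L \<Longrightarrow> cc_apply h x = 1"
    using bump_function[OF W(2) open_UNIV] by auto
  have "functional_of (P n) h = 1" for n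
  proof -
    have "emeasure (P n) (- L) = 0"
      using W by (intro off) (auto simp: borel_comp borel_compact)
    then have "AE x in P n. x \<notin> - L"
      using W(2) by (intro AE_not_in) (auto simp: null_sets_def sets_lf fin_lf[OF fin] borel_comp borel_compact)
    then have "AE x in P n. cc_apply h x = 1"
      by eventually_elim (use h(2) in blast)
    then have "functional_of (P n) h = (\<integral>x. 1 \<partial>P n)"
      unfolding functional_of_def
      by (intro integral_cong_AE) (auto intro: measurable_cc_apply[OF sets_lf[OF fin_lf[OF fin]]])
    then show ?thesis
      using unit[of n] by (simp add: measure_def space_lf fin_lf[OF fin])
  qed
  then have "((\<lambda>n. functional_of (P n) h) \<longlongrightarrow> 1) F"
    by simp
  then have "functional_of P0 h = 1"
    by (rule tendsto_unique[OF F(1) lim])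
  moreover have "functional_of P0 h = 0"
    using zero by (intro functional_of_null_support[OF P0, of UNIV]) auto
  ultimately show False
    by simp
qed

lemma mass_le_of_inner_capacity:
  assumes P: "fin_energy P" and B: "B \<in> sets borel" "B \<subseteq> D" and c: "0 < c" "inner_capacity \<kappa> D \<le> ereal c"
    and m: "emeasure P B = ennreal m" "0 \<le> m"
  shows "m\<^sup>2 \<le> c * ip (density P (indicator B)) (density P (indicator B))"
proof (cases "m = 0")
  case True
  then show ?thesis
    using c by (simp add: ip_nonneg)
next
  case False
  let ?R = "density P (indicator B)"
  have R: "fin_energy ?R"
    by (intro fin_restrict_measure P B)
  have "1 / c \<le> ip (scale_measure (ennreal (1 / m)) ?R) (scale_measure (ennreal (1 / m)) ?R)"
    using c unit_measure_of[OF P B m(1)] m False by (auto simp: inner_capacity_le_iff)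
  also have "\<dots> = ip ?R ?R / m\<^sup>2"
    using m R by (simp add: ip_scale_left ip_scale_right fin_scale_measure power2_eq_square)
  finally show ?thesis
    using c m False by (simp add: field_simps)
qed

text \<open>Split a unit measure \<open>P\<close> on \<open>\<Union>n. D n\<close> into pieces on disjoint \<open>B n \<subseteq> D n\<close> with masses \<open>m n\<close> and
  energies \<open>e n\<close>. Since \<open>\<kappa> \<ge> 0\<close>, the \<open>e n\<close> sum to at most the energy \<open>e\<close> of \<open>P\<close>. From
  \<open>(m n)\<^sup>2 \<le> \<epsilon> (1/2)\<^sup>n\<^sup>+\<^sup>1 e n\<close> the arithmetic-geometric inequality gives
  \<open>m n \<le> (1/2)\<^sup>n\<^sup>+\<^sup>2 + \<epsilon> e n / 2\<close>, and summation yields \<open>1 \<le> 1/2 + \<epsilon> e / 2\<close>.\<close>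

lemma inner_capacity_UN_le:
  fixes D :: "nat \<Rightarrow> 'a set"
  assumes D: "\<And>n. open (D n)" and \<epsilon>: "0 < \<epsilon>" and cap: "\<And>n. inner_capacity \<kappa> (D n) \<le> ereal (\<epsilon> * (1/2)^Suc n)"
  shows "inner_capacity \<kappa> (\<Union>n. D n) \<le> ereal \<epsilon>"
  unfolding inner_capacity_le_iff[OF \<epsilon>]
proof
  fix P assume "P \<in> unit_measures (\<Union>n. D n)"
  then obtain B where P: "fin_energy P" "emeasure P UNIV = 1"
    and B: "B \<in> sets borel" "B \<subseteq> (\<Union>n. D n)" "emeasure P (- B) = 0"
    by (auto simp: unit_measures_def)
  note lf = fin_lf[OF P(1)]
  define C where "C = disjointed (\<lambda>n. B \<inter> D n)"
  have BD: "B \<inter> D n \<in> sets borel" for n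
    using B D by (intro sets.Int) auto
  have C: "C n \<in> sets borel" "C n \<subseteq> D n" for n
    using sets.range_disjointed_sets[of "\<lambda>n. B \<inter> D n" borel] BD disjointed_subset[of "\<lambda>n. B \<inter> D n" n]
    by (auto simp: C_def)
  have disj: "disjoint_family C"
    unfolding C_def by (rule disjoint_family_disjointed)
  have UC: "(\<Union>n. C n) = B"
    unfolding C_def UN_disjointed_eq using B(2) by blast
  have le1: "emeasure P A \<le> 1" for A
    using emeasure_space[of P A] P(2) by (simp add: space_lf lf)
  define m where "m n = measure P (C n)" for n
  have m: "emeasure P (C n) = ennreal (m n)" "0 \<le> m n" for n
    unfolding m_def using le1[of "C n"] by (auto intro!: emeasure_eq_ennreal_measure simp: top_unique)
  let ?R = "\<lambda>n. density P (indicator (C n))"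
  define e where "e n = ip (?R n) (?R n)" for n
  have fR: "fin_energy (?R n)" for n
    by (intro fin_restrict_measure P C)
  have "(m n)\<^sup>2 \<le> \<epsilon> * (1/2)^Suc n * e n" for n
    unfolding e_def using \<epsilon> by (intro mass_le_of_inner_capacity[OF P(1) C(1) C(2) _ cap m(1) m(2)]) simp
  then have mn: "m n \<le> (1/2) * (1/2)^Suc n + \<epsilon> / 2 * e n" for n
  proof -
    let ?u = "(1/2::real)^Suc n" and ?v = "\<epsilon> * e n"
    have "(2 * m n)\<^sup>2 \<le> (?u + ?v)\<^sup>2"
      using \<open>\<And>n. (m n)\<^sup>2 \<le> \<epsilon> * (1/2)^Suc n * e n\<close>[of n] zero_le_power2[of "?u - ?v"]
      by (simp only: power2_sum power2_diff power_mult_distrib) (simp add: mult_ac)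
    then have "2 * m n \<le> ?u + ?v"
      by (rule power2_le_imp_le) (use \<epsilon> in \<open>simp add: e_def ip_nonneg\<close>)
    then show ?thesis
      by simp
  qed
  have "1 = emeasure P B"
  proof -
    have "emeasure P UNIV \<le> emeasure P B + emeasure P (- B)"
      using emeasure_subadditive[of B P "- B"] B(1) by (simp add: sets_lf lf borel_comp)
    then have "1 \<le> emeasure P B"
      using P(2) B(3) by simp
    then show ?thesis
      by (rule order.antisym[OF _ le1])
  qed
  also have "\<dots> = (\<Sum>n. emeasure P (C n))"
    unfolding UC[symmetric] using C(1) disj by (intro suminf_emeasure[symmetric]) (auto simp: sets_lf lf)
  also have "\<dots> \<le> (\<Sum>n. ennreal ((1/2) * (1/2)^Suc n) + ennreal (\<epsilon> / 2) * energy (?R n) (?R n))"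
  proof (intro suminf_le allI)
    fix n
    have "emeasure P (C n) \<le> ennreal ((1/2) * (1/2)^Suc n + \<epsilon> / 2 * e n)"
      unfolding m(1) by (rule ennreal_leI[OF mn])
    also have "\<dots> = ennreal ((1/2) * (1/2)^Suc n) + ennreal (\<epsilon> / 2) * energy (?R n) (?R n)"
      using \<epsilon> by (simp add: energy_eq_ip[OF fR fR] e_def ip_nonneg ennreal_plus[symmetric] ennreal_mult[symmetric] del: ennreal_plus)
    finally show "emeasure P (C n) \<le> \<dots>" .
  qed auto
  also have "\<dots> = (\<Sum>n. ennreal ((1/2) * (1/2)^Suc n)) + ennreal (\<epsilon> / 2) * (\<Sum>n. energy (?R n) (?R n))"
    by (subst suminf_add[symmetric]) simp_all
  also have "(\<Sum>n. ennreal ((1/2) * (1/2)^Suc n)) = ennreal (1/2)"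
    using sums_mult[OF power_half_series, of "1/2"] by (intro suminf_ennreal_eq) (auto simp del: power_Suc)
  also have "(\<Sum>n. energy (?R n) (?R n)) \<le> ennreal (ip P P)"
  proof -
    have "energy (?R n) (?R n) \<le> (\<integral>\<^sup>+x. pot P x * indicator (C n) x \<partial>P)" for n
    proof -
      note r = restrict_measure[OF lf C(1)[of n]]
      have "energy (?R n) (?R n) = (\<integral>\<^sup>+x. pot (?R n) x * indicator (C n) x \<partial>P)"
        by (simp add: energy_iterated r(1) r(3) pot_measurable)
      also have "\<dots> \<le> (\<integral>\<^sup>+x. pot P x * indicator (C n) x \<partial>P)"
        using r(4) by (intro nn_integral_mono mult_right_mono) auto
      finally show ?thesis .
    qed
    then have "(\<Sum>n. energy (?R n) (?R n)) \<le> (\<Sum>n. \<integral>\<^sup>+x. pot P x * indicator (C n) x \<partial>P)"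
      by (intro suminf_le) auto
    also have "\<dots> = (\<integral>\<^sup>+x. (\<Sum>n. pot P x * indicator (C n) x) \<partial>P)"
      using C(1) by (intro nn_integral_suminf[symmetric] borel_measurable_times_ennreal pot_measurable' lf sets_lf)
        (auto simp: sets_lf[OF lf] intro!: borel_measurable_indicator)
    also have "\<dots> \<le> (\<integral>\<^sup>+x. pot P x \<partial>P)"
    proof (rule nn_integral_mono)
      fix x
      have "(\<Sum>n. pot P x * indicator (C n) x) = pot P x * indicator (\<Union>n. C n) x"
      proof -
        have "(\<Sum>n. indicator (C n) x :: ennreal) = indicator (\<Union>n. C n) x"
          by (rule suminf_indicator[OF disj])
        then show ?thesis
          by simp
      qed
      then show "(\<Sum>n. pot P x * indicator (C n) x) \<le> pot P x"
        by (simp add: indicator_def)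
    qed
    also have "\<dots> = ennreal (ip P P)"
      using energy_eq_ip[OF P(1) P(1)] by (simp add: energy_iterated lf)
    finally show ?thesis .
  qed
  finally have "1 \<le> ennreal (1/2) + ennreal (\<epsilon> / 2) * ennreal (ip P P)"
    by (simp add: add_left_mono mult_left_mono)
  also have "\<dots> = ennreal (1/2 + \<epsilon> / 2 * ip P P)"
  proof -
    have "ennreal (\<epsilon> / 2 * ip P P) = ennreal (\<epsilon> / 2) * ennreal (ip P P)"
      using \<epsilon> by (intro ennreal_mult ip_nonneg) simp
    moreover have "ennreal (1/2 + \<epsilon> / 2 * ip P P) = ennreal (1/2) + ennreal (\<epsilon> / 2 * ip P P)"
      using \<epsilon> by (intro ennreal_plus mult_nonneg_nonneg ip_nonneg) simp_all
    ultimately show ?thesis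
      by (simp only:)
  qed
  finally have "ennreal 1 \<le> ennreal (1/2 + \<epsilon> / 2 * ip P P)"
    by (simp only: ennreal_1)
  moreover have "0 \<le> 1/2 + \<epsilon> / 2 * ip P P"
    using \<epsilon> by (intro add_nonneg_nonneg mult_nonneg_nonneg ip_nonneg) simp_all
  ultimately have "1 \<le> 1/2 + \<epsilon> / 2 * ip P P"
    by (simp only: ennreal_le_iff)
  then show "1 / \<epsilon> \<le> ip P P"
    using \<epsilon> by (simp add: field_simps)
qed

lemma countable_compact_outer_null:
  assumes \<C>: "countable \<C>" "\<And>C. C \<in> \<C> \<Longrightarrow> compact C" and null: "inner_null (\<Union>\<C>)"
  shows "outer_capacity \<kappa> (\<Union>\<C>) = 0"
proof -
  define C where "C = from_nat_into (insert {} \<C>)"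
  have C: "C n \<in> insert {} \<C>" for n
    unfolding C_def by (rule from_nat_into) simp
  have UC: "(\<Union>n. C n) = \<Union>\<C>"
    unfolding C_def using range_from_nat_into[of "insert {} \<C>"] \<C>(1) by simp
  have "outer_capacity \<kappa> (\<Union>\<C>) \<le> ereal \<epsilon>" if \<epsilon>: "0 < \<epsilon>" for \<epsilon>
  proof -
    have "\<exists>D. open D \<and> C n \<subseteq> D \<and> inner_capacity \<kappa> D \<le> ereal (\<epsilon> * (1/2)^Suc n)" for n
    proof (rule compact_inner_null_neighbourhood)
      show "compact (C n)"
        using C[of n] \<C>(2) by auto
      show "inner_null (C n)"
        using C[of n] by (intro inner_null_subset[OF null]) blast
    qed (use \<epsilon> in simp)
    then obtain D where D: "\<And>n. open (D n)" "\<And>n. C n \<subseteq> D n" "\<And>n. inner_capacity \<kappa> (D n) \<le> ereal (\<epsilon> * (1/2)^Suc n)"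
      by metis
    have "\<Union>\<C> \<subseteq> (\<Union>n. D n)"
      unfolding UC[symmetric] using D(2) by (intro UN_mono) auto
    then have "outer_capacity \<kappa> (\<Union>\<C>) \<le> inner_capacity \<kappa> (\<Union>n. D n)"
      unfolding outer_capacity_def using D(1) by (intro INF_lower) auto
    also have "\<dots> \<le> ereal \<epsilon>"
      by (rule inner_capacity_UN_le[OF D(1) \<epsilon> D(3)])
    finally show ?thesis .
  qed
  then have "outer_capacity \<kappa> (\<Union>\<C>) \<le> 0"
    by (simp add: ereal_le_epsilon2)
  moreover have "0 \<le> outer_capacity \<kappa> (\<Union>\<C>)"
    using inner_capacity_nonneg inner_le_outer_capacity order_trans by blast
  ultimately show ?thesis
    by simp
qed

text \<open>The exceptional set is a union of compact pieces \<open>K n \<inter> {pot R \<le> d} \<inter> L\<close>, where \<open>d\<close> runs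
  through a countable dense set and \<open>L\<close> through compact sets exhausting the open set \<open>{pot M > d}\<close>.\<close>

lemma exceptional_set_countable_compact:
  fixes K :: "nat \<Rightarrow> 'a set"
  assumes K: "\<And>n. compact (K n)" and M: "fin_energy M" and R: "fin_energy R"
  shows "\<exists>\<C>. countable \<C> \<and> (\<forall>C\<in>\<C>. compact C) \<and> \<Union>\<C> = {x \<in> (\<Union>n. K n). pot R x < pot M x}"
proof -
  obtain E :: "ennreal set" where E: "countable E" "\<And>U. open U \<Longrightarrow> U \<noteq> {} \<Longrightarrow> \<exists>d\<in>E. d \<in> U"
    using countable_dense_exists by metis
  have "\<exists>L :: nat \<Rightarrow> 'a set. (\<forall>j. compact (L j)) \<and> (\<Union>j. L j) = {x. d < pot M x}" for d
    using open_compact_exhaustion[OF pot_lsc[OF fin_lf[OF M]]] by metis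
  then obtain L :: "ennreal \<Rightarrow> nat \<Rightarrow> 'a set" where L: "\<And>d j. compact (L d j)" "\<And>d. (\<Union>j. L d j) = {x. d < pot M x}"
    by metis
  define piece where "piece p = (case p of (n, d, j) \<Rightarrow> K n \<inter> L d j \<inter> - {x. d < pot R x})" for p
  define \<C> where "\<C> = piece ` (UNIV \<times> E \<times> UNIV)"
  have "countable \<C>"
    unfolding \<C>_def using E(1) by (intro countable_image countable_SIGMA) auto
  moreover have "compact C" if C: "C \<in> \<C>" for C
  proof -
    obtain n d j where "C = K n \<inter> L d j \<inter> - {x. d < pot R x}"
      using C unfolding \<C>_def piece_def by auto
    moreover have "closed (- {x. d < pot R x})"
      using pot_lsc[OF fin_lf[OF R]] by (rule closed_Compl)
    ultimately show ?thesis
      using K L(1) by (simp add: compact_Int compact_Int_closed)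
  qed
  moreover have "\<Union>\<C> = {x \<in> (\<Union>n. K n). pot R x < pot M x}"
  proof (intro set_eqI iffI)
    fix x assume "x \<in> \<Union>\<C>"
    then obtain n d j where x: "x \<in> K n" "x \<in> L d j" "\<not> d < pot R x"
      unfolding \<C>_def piece_def by auto
    have "d < pot M x"
      using x(2) L(2)[of d] by blast
    then have "pot R x < pot M x"
      using x(3) by simp
    then show "x \<in> {x \<in> (\<Union>n. K n). pot R x < pot M x}"
      using x(1) by blast
  next
    fix x assume x: "x \<in> {x \<in> (\<Union>n. K n). pot R x < pot M x}"
    then obtain n where n: "x \<in> K n"
      by blast
    have "{pot R x<..<pot M x} \<noteq> {}"
      using x dense[of "pot R x" "pot M x"] by auto
    then obtain d where d: "d \<in> E" "d \<in> {pot R x<..<pot M x}"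
      using E(2)[OF open_greaterThanLessThan] by blast
    then have "x \<in> (\<Union>j. L d j)"
      by (simp add: L(2))
    then obtain j where j: "x \<in> L d j"
      by blast
    have "x \<in> piece (n, d, j)"
      using n j d(2) by (simp add: piece_def not_less less_imp_le)
    moreover have "piece (n, d, j) \<in> \<C>"
      unfolding \<C>_def using d(1) by (intro imageI) auto
    ultimately show "x \<in> \<Union>\<C>"
      by blast
  qed
  ultimately show ?thesis
    by blast
qed

section \<open>Balayage onto a \<open>K\<^sub>\<sigma>\<close> subset\<close>

text \<open>The inner candidates for \<open>A\<close> and the outer candidates for \<open>A\<^sub>0\<close> are inner candidates for
  \<open>A\<^sub>0\<close>. Since \<open>\<nu>\<close> is minimal among the latter and belongs to all three classes, it solves all
  three problems.\<close>

theorem K_sigma_balayage: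
  "\<exists>A0. K_sigma A0 \<and> A0 \<subseteq> A \<and> (\<forall>\<mu>\<in>pos_finite_energy \<kappa>. \<exists>\<nu>. is_inner_balayage \<kappa> A \<mu> \<nu> \<and>
    is_inner_balayage \<kappa> A0 \<mu> \<nu> \<and> is_outer_balayage \<kappa> A0 \<mu> \<nu>)"
proof -
  obtain K :: "nat \<Rightarrow> 'a set" where K: "incseq K" "\<And>n. compact (K n)" "\<And>n. K n \<subseteq> A"
    and dense: "\<And>C \<xi>. compact C \<Longrightarrow> C \<subseteq> A \<Longrightarrow> fin_on C \<xi> \<Longrightarrow>
      \<exists>p. (\<forall>i. \<exists>n. fin_on (K n) (p i)) \<and> (\<lambda>i. sqdist (p i) \<xi>) \<longlonglongrightarrow> 0"
    using dense_compact_sequence[of A] by metis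
  let ?A0 = "\<Union>n. K n"
  have "K_sigma ?A0"
    unfolding K_sigma_def union_of_def using K(2) by (intro exI[of _ "range K"]) auto
  moreover have "?A0 \<subseteq> A"
    using K(3) by blast
  moreover have "\<exists>\<nu>. is_inner_balayage \<kappa> A \<mu> \<nu> \<and> is_inner_balayage \<kappa> ?A0 \<mu> \<nu> \<and> is_outer_balayage \<kappa> ?A0 \<mu> \<nu>"
    if \<mu>: "\<mu> \<in> pos_finite_energy \<kappa>" for \<mu>
  proof -
    obtain M where M: "fin_energy M" "\<mu> = functional_of M"
      using \<mu> pos_finite_energy_iff by metis
    have "\<exists>\<nu>\<in>balayage_candidates A M. \<forall>R\<in>balayage_candidates ?A0 M. \<forall>x. pot \<nu> x \<le> pot R x"
      by (rule inner_balayage_exists[OF K _ M(1)]) (rule dense)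
    then obtain \<nu> where \<nu>A: "\<nu> \<in> balayage_candidates A M"
      and min: "\<And>R x. R \<in> balayage_candidates ?A0 M \<Longrightarrow> pot \<nu> x \<le> pot R x"
      by metis
    have \<nu>: "fin_energy \<nu>"
      using \<nu>A by (auto simp: balayage_candidates_def)
    have sub: "R \<in> balayage_candidates ?A0 M" if "R \<in> balayage_candidates A M" for R
      using that K(3) unfolding balayage_candidates_def by (auto elim!: inner_null_subset)
    have pos: "functional_of \<nu> \<in> pos_finite_energy \<kappa>"
      using \<nu> pos_finite_energy_iff by blast
    note ne = nearly_everywhere_potential_iff[OF M(1)]
    have "is_inner_balayage \<kappa> A \<mu> (functional_of \<nu>)"
      unfolding is_inner_balayage_def M(2)
      by (rule unique_minimizerI[OF _ \<nu>]) (use \<nu>A pos sub min ne \<nu> in auto)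
    moreover have "is_inner_balayage \<kappa> ?A0 \<mu> (functional_of \<nu>)"
      unfolding is_inner_balayage_def M(2)
      by (rule unique_minimizerI[OF _ \<nu>]) (use sub[OF \<nu>A] pos min ne \<nu> in auto)
    moreover have "is_outer_balayage \<kappa> ?A0 \<mu> (functional_of \<nu>)"
      unfolding is_outer_balayage_def M(2)
    proof (rule unique_minimizerI[OF _ \<nu>])
      let ?N = "{x \<in> ?A0. pot \<nu> x < pot M x}"
      obtain \<C> where \<C>: "countable \<C>" "\<forall>C\<in>\<C>. compact C" "\<Union>\<C> = ?N"
        using exceptional_set_countable_compact[of K, OF K(2) M(1) \<nu>] by (elim exE conjE) (rule that)
      have "inner_null ?N"
        using sub[OF \<nu>A] by (simp add: balayage_candidates_def)
      then have "outer_capacity \<kappa> ?N = 0"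
        using countable_compact_outer_null[OF \<C>(1) bspec[OF \<C>(2)]] \<C>(3) by simp
      moreover have "\<forall>x\<in>?A0 - ?N. potential \<kappa> (functional_of M) x \<le> potential \<kappa> (functional_of \<nu>) x"
        by (auto simp: potential_le_iff fin_lf M(1) \<nu> not_less)
      ultimately have "quasi_everywhere \<kappa> ?A0 (\<lambda>x. potential \<kappa> (functional_of M) x \<le> potential \<kappa> (functional_of \<nu>) x)"
        unfolding quasi_everywhere_def by (intro exI[of _ ?N]) auto
      then show "functional_of \<nu> \<in> {\<nu> \<in> pos_finite_energy \<kappa>.
          quasi_everywhere \<kappa> ?A0 (\<lambda>x. potential \<kappa> (functional_of M) x \<le> potential \<kappa> \<nu> x)}"
        using pos by simp
      fix R x assume R: "fin_energy R" "functional_of R \<in> {\<nu> \<in> pos_finite_energy \<kappa>.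
          quasi_everywhere \<kappa> ?A0 (\<lambda>x. potential \<kappa> (functional_of M) x \<le> potential \<kappa> \<nu> x)}"
      then have "R \<in> balayage_candidates ?A0 M"
        using quasi_imp_nearly ne by auto
      then show "pot \<nu> x \<le> pot R x"
        by (rule min)
    qed auto
    ultimately show ?thesis
      by blast
  qed
  ultimately show ?thesis
    by blast
qed

end

theorem theorem1p4:
  fixes \<kappa> :: "'a::{t2_space,second_countable_topology} \<Rightarrow> 'a \<Rightarrow> ennreal"
    and A :: "'a set"
  assumes "locally_compact_space (euclidean :: 'a topology)"
    and "symmetric_lsc_kernel \<kappa>"
    and "energy_principle \<kappa>"
    and "consistency_principle \<kappa>"
    and "domination_principle \<kappa>"
    and "indlim_topology closure_of cc_potentials \<kappa> = UNIV"
  shows "\<exists>A0. K_sigma A0 \<and> A0 \<subseteq> A \<and>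
    (\<forall>\<mu>\<in>pos_finite_energy \<kappa>. \<exists>\<nu>. is_inner_balayage \<kappa> A \<mu> \<nu> \<and> is_inner_balayage \<kappa> A0 \<mu> \<nu>) \<and>
    (\<forall>\<mu>\<in>pos_finite_energy \<kappa>. \<exists>\<nu>. is_inner_balayage \<kappa> A \<mu> \<nu> \<and> is_inner_balayage \<kappa> A0 \<mu> \<nu> \<and>
        is_outer_balayage \<kappa> A0 \<mu> \<nu>)"
proof -
  interpret energy_kernel \<kappa>
    using assms(1-5) by unfold_locales
  show ?thesis
    using K_sigma_balayage[of A] by blast
qed

end
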